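(* Let $r^*\in(1,\infty)$ and let $X$ be an $r^*$-convex Banach function space over $\mathbf{R}^d$. Then the following are equivalent: (i) $M:X\to X$ and $M:X'\to X'$ are bounded; (ii) there is an $r_0\in(1,r^*]$ so that for all $r\in(1,r_0]$ both $M:X^r\to X^r$ and $M:(X^r)'\to(X^r)'$ are bounded; (iii) there is an $r\in(1,r^*]$ so that $M:(X^r)'\to(X^r)'$ is bounded.
   Context: $L^0(\mathbf{R}^d)$ is the space of measurable functions on $\mathbf{R}^d$ (Lebesgue measure, modulo a.e. equality). Banach function space over $\mathbf{R}^d$: a vector space $X\subseteq L^0(\mathbf{R}^d)$ with a norm $\|\cdot\|_X$ satisfying: (ideal property) if $f\in X$, $g\in L^0(\mathbf{R}^d)$ and $|g|\le|f|$, then $g\in X$ and $\|g\|_X\le\|f\|_X$; (Fatou property) if $0\le f_n\uparrow f$ with $f_n\in X$ and $\sup_n\|f_n\|_X<\infty$, then $f\in X$ and $\|f\|_X=\sup_n\|f_n\|_X$; (saturation property) every measurable $E\subseteq\mathbf{R}^d$ of positive measure has a measurable subset $F\subseteq E$ of positive measure with $\mathbf{1}_F\in X$. The associate space $X'$ is the space of $g\in L^0(\mathbf{R}^d)$ with $\|g\|_{X'}:=\sup_{\|f\|_X\le1}\int_{\mathbf{R}^d}|fg|<\infty$. $X$ is $p$-convex if $\big\|(|f|^p+|g|^p)^{1/p}\big\|_X\le(\|f\|_X^p+\|g\|_X^p)^{1/p}$ for all $f,g\in X$. For $p\in(0,\infty)$ the $p$-concavification is $X^p:=\{f\in L^0(\mathbf{R}^d):|f|^{1/p}\in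 X\}$ with $\|f\|_{X^p}:=\big\||f|^{1/p}\big\|_X^p$. $M$ is the Hardy--Littlewood maximal operator $Mf=\sup_Q\big(\frac1{|Q|}\int_Q|f|\big)\mathbf{1}_Q$, the supremum being over all cubes $Q\subseteq\mathbf{R}^d$. *)

theory Defs
  imports "HOL-Analysis.Analysis"
begin

text \<open>
  Elements of \<open>L\<^sup>0\<close> are represented by Lebesgue measurable functions \<open>real ^ 'n \<Rightarrow> real\<close>. A space of
  a.e.-classes is a set \<open>elems X\<close> of such representatives, and \<open>fnorm X\<close> is a norm on the classes, i.e.
  it vanishes exactly on the functions that are zero a.e. The values of \<open>fnorm X\<close> outside \<open>elems X\<close>
  carry no meaning. Closure of \<open>elems X\<close> under a.e. equality is part of the ideal property, which is
  formulated with a.e. inequalities.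
\<close>

record ('n::finite) fspace =
  elems :: "(real ^ 'n \<Rightarrow> real) set"
  fnorm :: "(real ^ 'n \<Rightarrow> real) \<Rightarrow> real"

definition normed_fspace :: "'n::finite fspace \<Rightarrow> bool" where
  "normed_fspace X \<longleftrightarrow>
     elems X \<subseteq> borel_measurable lebesgue \<and>
     (\<lambda>x. 0) \<in> elems X \<and>
     (\<forall>f\<in>elems X. \<forall>g\<in>elems X. (\<lambda>x. f x + g x) \<in> elems X) \<and>
     (\<forall>c. \<forall>f\<in>elems X. (\<lambda>x. c * f x) \<in> elems X) \<and>
     (\<forall>f\<in>elems X. 0 \<le> fnorm X f) \<and>
     (\<forall>f\<in>elems X. fnorm X f = 0 \<longleftrightarrow> (AE x in lebesgue. f x = 0)) \<and>
     (\<forall>c. \<forall>f\<in>elems X. fnorm X (\<lambda>x. c * f x) = \<bar>c\<bar> * fnorm X f) \<and>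
     (\<forall>f\<in>elems X. \<forall>g\<in>elems X. fnorm X (\<lambda>x. f x + g x) \<le> fnorm X f + fnorm X g)"

definition ideal_property :: "'n::finite fspace \<Rightarrow> bool" where
  "ideal_property X \<longleftrightarrow>
     (\<forall>f\<in>elems X. \<forall>g\<in>borel_measurable lebesgue.
        (AE x in lebesgue. \<bar>g x\<bar> \<le> \<bar>f x\<bar>) \<longrightarrow> g \<in> elems X \<and> fnorm X g \<le> fnorm X f)"

definition fatou_property :: "'n::finite fspace \<Rightarrow> bool" where
  "fatou_property X \<longleftrightarrow>
     (\<forall>u. \<forall>f\<in>borel_measurable lebesgue.
        (\<forall>n. u n \<in> elems X) \<longrightarrow>
        (AE x in lebesgue. (\<forall>n. 0 \<le> u n x) \<and> incseq (\<lambda>n. u n x) \<and> (\<lambda>n. u n x) \<longlonglongrightarrow> f x) \<longrightarrow>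
        bdd_above (range (\<lambda>n. fnorm X (u n))) \<longrightarrow>
        f \<in> elems X \<and> fnorm X f = (SUP n. fnorm X (u n)))"

definition saturation_property :: "'n::finite fspace \<Rightarrow> bool" where
  "saturation_property X \<longleftrightarrow>
     (\<forall>E\<in>sets lebesgue. emeasure lebesgue E > 0 \<longrightarrow>
        (\<exists>F\<in>sets lebesgue. F \<subseteq> E \<and> emeasure lebesgue F > 0 \<and> indicator F \<in> elems X))"

definition banach_function_space :: "'n::finite fspace \<Rightarrow> bool" where
  "banach_function_space X \<longleftrightarrow>
     normed_fspace X \<and> ideal_property X \<and> fatou_property X \<and> saturation_property X"

definition assoc_ennorm :: "'n::finite fspace \<Rightarrow> (real ^ 'n \<Rightarrow> real) \<Rightarrow> ennreal" where
  "assoc_ennorm X g =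
     (SUP f\<in>{f \<in> elems X. fnorm X f \<le> 1}. \<integral>\<^sup>+x. ennreal \<bar>f x * g x\<bar> \<partial>lebesgue)"

definition associate :: "'n::finite fspace \<Rightarrow> 'n fspace" where
  "associate X =
     \<lparr>elems = {g \<in> borel_measurable lebesgue. assoc_ennorm X g < \<infinity>},
      fnorm = (\<lambda>g. enn2real (assoc_ennorm X g))\<rparr>"

definition p_convex :: "real \<Rightarrow> 'n::finite fspace \<Rightarrow> bool" where
  "p_convex p X \<longleftrightarrow>
     (\<forall>f\<in>elems X. \<forall>g\<in>elems X.
        fnorm X (\<lambda>x. (\<bar>f x\<bar> powr p + \<bar>g x\<bar> powr p) powr (1 / p))
          \<le> (fnorm X f powr p + fnorm X g powr p) powr (1 / p))"

definition concavification :: "real \<Rightarrow> 'n::finite fspace \<Rightarrow> 'n fspace" where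
  "concavification p X =
     \<lparr>elems = {f \<in> borel_measurable lebesgue. (\<lambda>x. \<bar>f x\<bar> powr (1 / p)) \<in> elems X},
      fnorm = (\<lambda>f. fnorm X (\<lambda>x. \<bar>f x\<bar> powr (1 / p)) powr p)\<rparr>"

text \<open>
  Cubes have sides parallel to the coordinate axes and are taken closed; passing to open or half-open
  cubes does not change the maximal function at any point.
\<close>

definition cubes :: "(real ^ 'n::finite) set set" where
  "cubes = {cbox a (\<chi> i. a $ i + l) | a l. l > 0}"

definition maximal :: "(real ^ 'n::finite \<Rightarrow> real) \<Rightarrow> real ^ 'n \<Rightarrow> ennreal" where
  "maximal f x =
     (SUP Q\<in>cubes. (\<integral>\<^sup>+y\<in>Q. ennreal \<bar>f y\<bar> \<partial>lebesgue) / emeasure lebesgue Q * indicator Q x)"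

text \<open>
  The maximal function takes values in \<open>[0, \<infinity>]\<close>, so that it lies in a space of real-valued functions
  only if it is finite a.e.; \<open>enn2real\<close> maps \<open>\<infinity>\<close> to 0, whence the explicit finiteness condition.
\<close>

definition maximal_bounded_on :: "'n::finite fspace \<Rightarrow> bool" where
  "maximal_bounded_on X \<longleftrightarrow>
     (\<exists>C. \<forall>f\<in>elems X.
        (AE x in lebesgue. maximal f x < \<infinity>) \<and>
        (\<lambda>x. enn2real (maximal f x)) \<in> elems X \<and>
        fnorm X (\<lambda>x. enn2real (maximal f x)) \<le> C * fnorm X f)"

end

theory Submission
  imports Defs
begin

text \<open>
Write \<open>Y = X\<^sup>r\<close>. The proof passes through \<open>A\<^sub>1\<close> weights, that is, weights \<open>w\<close> with \<open>M w \<le> C w\<close>. If \<open>M\<close> is bounded on a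
space, then the Rubio de Francia algorithm \<open>W = \<Sum>\<^sub>k M\<^sup>k f / (2 \<parallel>M\<parallel>)\<^sup>k\<close> dominates every element \<open>f\<close> of the space by
an \<open>A\<^sub>1\<close> weight with at most twice the norm and with a constant that depends on \<open>\<parallel>M\<parallel>\<close> only (\<open>rubio_de_francia\<close>). Two facts
about an \<open>A\<^sub>1\<close> weight \<open>w\<close> are used: \<open>M\<close> is bounded on \<open>L\<^sup>p(w)\<close> for \<open>p > 1\<close> (\<open>wmax_strong_type\<close> with \<open>emax_le_wmax\<close>), and \<open>w\<^sup>r\<close>
is again an \<open>A\<^sub>1\<close> weight for \<open>r > 1\<close> close to 1, by the reverse Hoelder inequality (\<open>A1_weight_power\<close>).

(i) implies (ii). Let \<open>M\<close> be bounded on \<open>X\<close> and \<open>X'\<close>. For \<open>f\<close> in \<open>Y\<close> let \<open>W\<close> be the Rubio de Francia majorant of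
\<open>\<bar>f\<bar>\<close> to the power \<open>1 / r\<close> in \<open>X\<close>. Then \<open>M f \<le> M (W\<^sup>r) \<le> C W\<^sup>r\<close>, which bounds \<open>M\<close> on \<open>Y\<close> (\<open>max_bounded_conc\<close>). For \<open>g\<close>
in \<open>Y'\<close> the function \<open>g W\<^sup>r / W\<close> belongs to \<open>X'\<close>; let \<open>G\<close> be its majorant in \<open>X'\<close>. Then \<open>g \<le> u\<close> for
\<open>u = G W / W\<^sup>r\<close>, and \<open>u\<close>, as a quotient of powers of \<open>A\<^sub>1\<close> weights, satisfies \<open>M u \<le> C (M \<surd>u)\<^sup>2\<close>. Hence
\<open>\<integral> f M g \<le> C \<integral> (M \<surd>u)\<^sup>2 W\<^sup>r \<le> C \<integral> u W\<^sup>r = C \<integral> G W\<close>, which is bounded by the duality of \<open>X\<close> and \<open>X'\<close>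
(\<open>max_bounded_dual_conc\<close>).

(iii) implies (i). Let \<open>M\<close> be bounded on \<open>Y'\<close>. By convexity \<open>Y\<close> is a Banach function space, so its norm can be computed by
duality with \<open>Y'\<close> (\<open>lorentz_luxemburg\<close>). As elements of \<open>Y'\<close> are dominated by \<open>A\<^sub>1\<close> weights in \<open>Y'\<close>, every operator that
is bounded on \<open>L\<^sup>r(w)\<close>, uniformly over \<open>A\<^sub>1\<close> weights with a given constant, is bounded on \<open>X\<close> (\<open>norm_le_of_A1_bound\<close>).
This applies to \<open>M\<close>. It also applies to the adjoints of linearizations of the maximum over finitely many cubes
(\<open>adj_strong_type\<close>), which gives the bound for \<open>M\<close> on \<open>X'\<close> (\<open>max_bounded_dual_of_dual_conc\<close>).

The statement (iii) is the instance \<open>r = r\<^sub>0\<close> of (ii). All of this is carried out for extended norms of functions with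
values in \<open>[0, \<infinity>]\<close> (\<open>function_norm\<close>), into which the function spaces are translated at the end; there \<open>emax\<close> stands
for \<open>M\<close>, \<open>dual_norm\<close> for the passage to the associate space and \<open>conc r\<close> for the concavification.
\<close>

section \<open>Real powers of extended nonnegative numbers\<close>

text \<open>
Weights, maximal functions and their powers are handled as functions with values in \<open>[0, \<infinity>]\<close>, where
suprema and integrals always exist. The separate case is needed since \<open>enn2real\<close> sends \<open>\<infinity>\<close> to 0; with it
\<open>epow\<close> is multiplicative and an order automorphism of \<open>[0, \<infinity>]\<close> for positive exponents.
\<close>

definition epow :: "ennreal \<Rightarrow> real \<Rightarrow> ennreal" where
  "epow x p = (if x = \<infinity> then \<infinity> else ennreal (enn2real x powr p))"

lemma epow_ennreal [simp]: "0 \<le> a \<Longrightarrow> epow (ennreal a) p = ennreal (a powr p)"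
  by (simp add: epow_def)

lemma epow_top [simp]: "epow top p = top"
  by (simp add: epow_def)

lemma epow_zero [simp]: "epow 0 p = 0"
  by (simp add: epow_def)

lemma epow_one [simp]: "epow 1 p = 1"
  by (simp add: epow_def)

lemma epow_exp_one [simp]: "epow x 1 = x"
  by (cases x) (auto simp: epow_def)

lemma epow_eq_0_iff [simp]: "epow x p = 0 \<longleftrightarrow> x = 0"
  by (cases x) (auto simp: epow_def)

lemma epow_eq_top_iff [simp]: "epow x p = top \<longleftrightarrow> x = top"
  by (cases x) (auto simp: epow_def)

lemma epow_less_top_iff [simp]: "epow x p < top \<longleftrightarrow> x < top"
  by (metis epow_eq_top_iff top.not_eq_extremum)

lemma epow_pos_iff [simp]: "0 < epow x p \<longleftrightarrow> 0 < x"
  by (metis epow_eq_0_iff not_gr_zero)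

lemma enn2real_epow: "enn2real (epow x p) = enn2real x powr p"
  by (cases x) (auto simp: epow_def)

lemma epow_epow [simp]: "epow (epow x p) q = epow x (p * q)"
  by (cases x) (auto simp: powr_powr)

lemma epow_mono: "x \<le> y \<Longrightarrow> 0 \<le> p \<Longrightarrow> epow x p \<le> epow y p"
  by (cases x; cases y) (auto intro!: ennreal_leI powr_mono2 simp: ennreal_le_iff top_unique)

lemma epow_le_iff: "0 < p \<Longrightarrow> epow x p \<le> epow y p \<longleftrightarrow> x \<le> y"
  using epow_mono[of x y p] epow_mono[of "epow x p" "epow y p" "1/p"] by auto

lemma epow_le_iff': "0 < p \<Longrightarrow> epow x p \<le> y \<longleftrightarrow> x \<le> epow y (1/p)"
  using epow_le_iff[of p x "epow y (1/p)"] by simp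

lemma epow_mult: "epow (x * y) p = epow x p * epow y p"
proof (cases "x = 0 \<or> y = 0")
  case False
  then show ?thesis
    by (cases x; cases y)
       (auto simp: ennreal_mult_top ennreal_top_mult powr_mult simp flip: ennreal_mult)
qed auto

lemma epow_add: "0 < p \<Longrightarrow> 0 < q \<Longrightarrow> epow x (p + q) = epow x p * epow x q"
  by (cases x) (auto simp: powr_add ennreal_mult)

lemma epow_measurable [measurable]: "(\<lambda>x. epow x p) \<in> borel_measurable borel"
  unfolding epow_def by measurable

lemma epow_SUP:
  assumes "0 < p"
  shows "epow (SUP i\<in>I. f i) p = (SUP i\<in>I. epow (f i) p)"
proof (rule antisym)
  show "epow (SUP i\<in>I. f i) p \<le> (SUP i\<in>I. epow (f i) p)"
    unfolding epow_le_iff'[OF assms]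
    by (intro SUP_least) (auto simp: epow_le_iff'[OF assms, symmetric] intro: SUP_upper)
  show "(SUP i\<in>I. epow (f i) p) \<le> epow (SUP i\<in>I. f i) p"
    using assms by (intro SUP_least epow_mono SUP_upper) auto
qed

lemma indicator_epow: "epow (indicator A x) p = indicator A x"
  by (auto simp: indicator_def)

text \<open>
Young's inequality with a free parameter, for conjugate exponents. One of the two terms alone suffices,
according to which of \<open>x\<close> and \<open>e * epow y (1 / (p - 1))\<close> is larger. It replaces Hoelder's inequality below.
\<close>

lemma epow_young:
  fixes x y :: ennreal
  assumes p: "1 < p" and e: "0 < e"
  shows "x * y \<le> ennreal (e powr (1 - p)) * epow x p + ennreal e * epow y (p / (p - 1))"
proof (cases "x \<le> ennreal e * epow y (1 / (p - 1))")
  case True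
  have "x * y \<le> ennreal e * (epow y (1 / (p - 1)) * epow y 1)"
    using mult_right_mono[OF True, of y] by (simp add: mult_ac)
  also have "epow y (1 / (p - 1)) * epow y 1 = epow y (p / (p - 1))"
    using p by (subst epow_add[symmetric]) (auto simp: field_simps)
  finally show ?thesis by (simp add: add_increasing)
next
  case False
  then have "ennreal e * epow y (1 / (p - 1)) \<le> x" by simp
  then have "epow (ennreal e * epow y (1 / (p - 1))) (p - 1) \<le> epow x (p - 1)"
    using p by (intro epow_mono) auto
  then have 1: "ennreal (e powr (p - 1)) * y \<le> epow x (p - 1)"
    using p e by (simp add: epow_mult)
  have "y = ennreal (e powr (1 - p)) * (ennreal (e powr (p - 1)) * y)"
    using e by (simp add: mult.assoc[symmetric] powr_add[symmetric] ennreal_mult[symmetric])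
  also have "\<dots> \<le> ennreal (e powr (1 - p)) * epow x (p - 1)"
    by (intro mult_left_mono 1) auto
  finally have "x * y \<le> ennreal (e powr (1 - p)) * (epow x 1 * epow x (p - 1))"
    using mult_left_mono[of y "ennreal (e powr (1 - p)) * epow x (p - 1)" x] by (simp add: mult_ac)
  also have "epow x 1 * epow x (p - 1) = epow x p"
    using p by (subst epow_add[symmetric]) auto
  finally show ?thesis by (simp add: add_increasing2)
qed

lemma le_divide_ennreal_iff:
  fixes a b v :: ennreal
  assumes "0 < v" "v < top"
  shows "b \<le> a / v \<longleftrightarrow> b * v \<le> a"
  using divide_less_ennreal[of v a b] assms by (auto simp: not_less[symmetric])

lemma divide_le_ennreal_iff:
  fixes a b v :: ennreal
  assumes "0 < v" "v < top"
  shows "a / v \<le> b \<longleftrightarrow> a \<le> b * v"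
proof -
  have "(a / v) * v = a"
    using assms by (simp add: ennreal_divide_times)
  moreover have "(b * v) / v = b"
    using assms by (simp add: ennreal_mult_divide_eq)
  ultimately show ?thesis
    by (metis divide_right_mono_ennreal mult_right_mono zero_le)
qed

lemma less_divide_ennreal_iff:
  fixes a b v :: ennreal
  assumes "0 < v" "v < top"
  shows "b < a / v \<longleftrightarrow> b * v < a"
  using divide_le_ennreal_iff[OF assms, of a b] by (simp add: not_le[symmetric])

section \<open>Cubes and a Vitali covering argument\<close>

abbreviation meas :: "(real ^ 'n::finite \<Rightarrow> ennreal) set" where
  "meas \<equiv> borel_measurable lebesgue"

text \<open>
Otherwise \<open>simp\<close> turns Lebesgue measure into Borel measure of a \<open>main_part\<close>.
\<close>

declare emeasure_completion [simp del]

text \<open>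
A weight \<open>v\<close> is identified with the measure \<open>v dx\<close>; \<open>mass v A\<close> is the measure of \<open>A\<close>.
\<close>

abbreviation vol :: "(real ^ 'n::finite) set \<Rightarrow> ennreal" where
  "vol \<equiv> emeasure lebesgue"

abbreviation mass :: "(real ^ 'n::finite \<Rightarrow> ennreal) \<Rightarrow> (real ^ 'n) set \<Rightarrow> ennreal" where
  "mass v A \<equiv> (\<integral>\<^sup>+x\<in>A. v x \<partial>lebesgue)"

definition cube :: "real ^ 'n::finite \<Rightarrow> real \<Rightarrow> (real ^ 'n) set" where
  "cube a l = cbox a (\<chi> i. a $ i + l)"

lemma mem_cube: "x \<in> cube a l \<longleftrightarrow> (\<forall>i. a $ i \<le> x $ i \<and> x $ i \<le> a $ i + l)"
  by (auto simp: cube_def mem_box_cart)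

lemma cubes_eq: "cubes = {cube a l | a l. 0 < l}"
  by (auto simp: cubes_def cube_def)

lemma cube_sets [measurable, simp]: "cube a l \<in> sets lebesgue"
  by (auto simp: cube_def)

lemma emeasure_cube:
  fixes a :: "real ^ 'n::finite"
  assumes "0 \<le> l"
  shows "vol (cube a l) = ennreal (l ^ CARD('n))"
proof -
  have ne: "cbox a (\<chi> i. a $ i + l) \<noteq> {}"
    using assms by (auto simp: interval_ne_empty_cart)
  have "vol (cube a l) = ennreal (measure lborel (cbox a (\<chi> i. a $ i + l)))"
    unfolding cube_def using emeasure_lborel_cbox_finite[of a "\<chi> i. a $ i + l"]
    by (simp add: emeasure_completion emeasure_eq_ennreal_measure less_top)
  also have "measure lborel (cbox a (\<chi> i. a $ i + l)) = l ^ CARD('n)"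
    unfolding content_cbox_cart[OF ne] by simp
  finally show ?thesis .
qed

lemma emeasure_cube_pos: "0 < l \<Longrightarrow> 0 < vol (cube a l)"
  and emeasure_cube_finite: "0 < l \<Longrightarrow> vol (cube a l) < top"
  by (simp_all add: emeasure_cube)

text \<open>
This is the concentric cube with three times the side.
\<close>

definition tricube :: "real ^ 'n::finite \<Rightarrow> real \<Rightarrow> (real ^ 'n) set" where
  "tricube a l = cube (\<chi> i. a $ i - l) (3 * l)"

lemma tricube_sets [measurable, simp]: "tricube a l \<in> sets lebesgue"
  by (simp add: tricube_def)

lemma mem_tricube: "x \<in> tricube a l \<longleftrightarrow> (\<forall>i. a $ i - l \<le> x $ i \<and> x $ i \<le> a $ i + 2 * l)"
  by (auto simp: tricube_def mem_cube algebra_simps)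

lemma emeasure_tricube:
  fixes a :: "real ^ 'n::finite"
  shows "0 < l \<Longrightarrow> vol (tricube a l) = ennreal (3 ^ CARD('n)) * vol (cube a l)"
  unfolding tricube_def by (simp add: emeasure_cube power_mult_distrib ennreal_mult')

lemma cube_subset_tricube: "0 \<le> l \<Longrightarrow> cube a l \<subseteq> tricube a l"
  unfolding mem_tricube mem_cube subset_iff
proof (intro allI impI)
  fix x i assume "0 \<le> l" "\<forall>i. a $ i \<le> x $ i \<and> x $ i \<le> a $ i + l"
  then have "0 \<le> l" "a $ i \<le> x $ i" "x $ i \<le> a $ i + l" by auto
  then show "a $ i - l \<le> x $ i \<and> x $ i \<le> a $ i + 2 * l" by linarith
qed

lemma cube_subset_tricube_of_meet:
  assumes "cube b k \<inter> cube a l \<noteq> {}" "k \<le> l"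
  shows "cube b k \<subseteq> tricube a l"
proof
  fix x assume x: "x \<in> cube b k"
  from assms(1) obtain y where y: "y \<in> cube b k" "y \<in> cube a l" by auto
  have "a $ i - l \<le> x $ i \<and> x $ i \<le> a $ i + 2 * l" for i
  proof -
    have "b $ i \<le> x $ i" "x $ i \<le> b $ i + k" "b $ i \<le> y $ i" "y $ i \<le> b $ i + k"
      "a $ i \<le> y $ i" "y $ i \<le> a $ i + l"
      using x y by (auto simp: mem_cube)
    then show ?thesis using assms(2) by linarith
  qed
  then show "x \<in> tricube a l" by (simp add: mem_tricube)
qed

text \<open>
Greedy selection: take a cube of maximal side, discard the cubes that meet it (all of them lie in its
triple), and repeat.
\<close>

lemma finite_vitali:
  fixes S :: "((real ^ 'n::finite) \<times> real) set"
  assumes "finite S"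
  shows "\<exists>D\<subseteq>S. disjoint_family_on (\<lambda>(a, l). cube a l) D \<and>
           (\<Union>(a, l)\<in>S. cube a l) \<subseteq> (\<Union>(a, l)\<in>D. tricube a l)"
  using assms
proof (induction S rule: finite_psubset_induct)
  case (psubset S)
  show ?case
  proof (cases "\<exists>(a, l)\<in>S. cube a l \<noteq> {}")
    case False
    then show ?thesis
      by (intro exI[of _ "{}"]) (auto simp: disjoint_family_on_def)
  next
    case True
    let ?S0 = "{(a, l)\<in>S. cube a l \<noteq> {}}"
    have fin: "finite ?S0" "?S0 \<noteq> {}"
      using psubset.hyps True by (auto intro: finite_subset[of _ S])
    obtain q where q: "q \<in> ?S0" "\<And>p. p \<in> ?S0 \<Longrightarrow> snd p \<le> snd q"
      using arg_min_if_finite[OF fin, of "\<lambda>p. - snd p"]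
      by (metis (no_types, lifting) linorder_not_le neg_le_iff_le)
    obtain a l where al: "q = (a, l)" by (cases q)
    have alS: "(a, l) \<in> S" "cube a l \<noteq> {}" and max: "\<And>b k. (b, k) \<in> S \<Longrightarrow> cube b k \<noteq> {} \<Longrightarrow> k \<le> l"
      using q al by fastforce+
    let ?T = "{(b, k)\<in>S. cube b k \<inter> cube a l = {}}"
    have "?T \<subset> S" using alS by auto
    from psubset.IH[OF this] obtain D where D: "D \<subseteq> ?T"
      "disjoint_family_on (\<lambda>(a, l). cube a l) D"
      "(\<Union>(a, l)\<in>?T. cube a l) \<subseteq> (\<Union>(a, l)\<in>D. tricube a l)" by (elim exE conjE)
    show ?thesis
    proof (intro exI[of _ "insert (a, l) D"] conjI)
      show "insert (a, l) D \<subseteq> S" using D(1) alS by auto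
      show "disjoint_family_on (\<lambda>(a, l). cube a l) (insert (a, l) D)"
        using D(1,2) unfolding disjoint_family_on_def by fastforce
      show "(\<Union>(a, l)\<in>S. cube a l) \<subseteq> (\<Union>(a, l)\<in>insert (a, l) D. tricube a l)"
      proof (clarsimp)
        fix x b k assume bk: "(b, k) \<in> S" "x \<in> cube b k" and nx: "\<forall>q\<in>D. x \<notin> (case q of (a, b) \<Rightarrow> tricube a b)"
        show "x \<in> tricube a l"
        proof (cases "cube b k \<inter> cube a l = {}")
          case True
          then have "x \<in> (\<Union>(a, l)\<in>?T. cube a l)" using bk by auto
          with D(3) nx show ?thesis by blast
        next
          case False
          then have "cube b k \<subseteq> tricube a l"
            using bk by (intro cube_subset_tricube_of_meet max) auto
          then show ?thesis using bk by auto
        qed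
      qed
    qed
  qed
qed

lemma cover_transfer_finite:
  fixes S :: "((real ^ 'n::finite) \<times> real) set" and u v :: "real ^ 'n \<Rightarrow> ennreal"
  assumes S: "finite S" and [measurable]: "u \<in> meas" "v \<in> meas"
    and le: "\<And>a l. (a, l) \<in> S \<Longrightarrow>
      mass v (tricube a l) \<le> c * mass u (cube a l)"
  shows "mass v (\<Union>(a, l)\<in>S. cube a l)
    \<le> c * mass u (\<Union>(a, l)\<in>S. cube a l)"
proof -
  obtain D where D: "D \<subseteq> S" "disjoint_family_on (\<lambda>(a, l). cube a l) D"
    "(\<Union>(a, l)\<in>S. cube a l) \<subseteq> (\<Union>(a, l)\<in>D. tricube a l)"
    using finite_vitali[OF S] by (elim exE conjE)
  have fD: "finite D" using D S finite_subset by blast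
  have "mass v (\<Union>(a, l)\<in>S. cube a l)
      \<le> (\<integral>\<^sup>+x. (\<Sum>q\<in>D. v x * indicator (tricube (fst q) (snd q)) x) \<partial>lebesgue)"
  proof (intro nn_integral_mono)
    fix x
    show "v x * indicator (\<Union>(a, l)\<in>S. cube a l) x \<le> (\<Sum>q\<in>D. v x * indicator (tricube (fst q) (snd q)) x)"
    proof (cases "x \<in> (\<Union>(a, l)\<in>S. cube a l)")
      case True
      from subsetD[OF D(3) True] obtain q where q: "q \<in> D" "x \<in> tricube (fst q) (snd q)"
        by (auto simp: case_prod_beta)
      have "v x * indicator (\<Union>(a, l)\<in>S. cube a l) x \<le> v x * indicator (tricube (fst q) (snd q)) x"
        using q by (auto simp: indicator_def)
      also have "\<dots> \<le> (\<Sum>q\<in>D. v x * indicator (tricube (fst q) (snd q)) x)"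
        using q fD by (intro member_le_sum) auto
      finally show ?thesis .
    qed auto
  qed
  also have "\<dots> = (\<Sum>q\<in>D. mass v (tricube (fst q) (snd q)))"
    by (intro nn_integral_sum) measurable
  also have "\<dots> \<le> (\<Sum>q\<in>D. c * mass u (cube (fst q) (snd q)))"
    using D(1) by (intro sum_mono le) auto
  also have "\<dots> = c * (\<integral>\<^sup>+x. (\<Sum>q\<in>D. u x * indicator (cube (fst q) (snd q)) x) \<partial>lebesgue)"
    by (subst nn_integral_sum) (measurable, simp add: sum_distrib_left)
  also have "\<dots> \<le> c * mass u (\<Union>(a, l)\<in>S. cube a l)"
  proof (intro mult_left_mono nn_integral_mono)
    fix x
    have dis: "disjoint_family_on (\<lambda>q. cube (fst q) (snd q)) D"
      using D(2) by (simp add: case_prod_unfold)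
    have "(\<Sum>q\<in>D. u x * indicator (cube (fst q) (snd q)) x)
        = u x * (\<Sum>q\<in>D. indicator (cube (fst q) (snd q)) x)"
      by (simp add: sum_distrib_left)
    also have "(\<Sum>q\<in>D. indicator (cube (fst q) (snd q)) x :: ennreal)
        = indicator (\<Union>q\<in>D. cube (fst q) (snd q)) x"
      by (rule indicator_UN_disjoint[OF fD dis, symmetric])
    also have "u x * indicator (\<Union>q\<in>D. cube (fst q) (snd q)) x \<le> u x * indicator (\<Union>(a, l)\<in>S. cube a l) x"
      using D(1) by (intro mult_left_mono) (auto simp: indicator_def case_prod_unfold)
    finally show "(\<Sum>q\<in>D. u x * indicator (cube (fst q) (snd q)) x) \<le> u x * indicator (\<Union>(a, l)\<in>S. cube a l) x" .
  qed auto
  finally show ?thesis .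
qed

text \<open>
This is how the covering lemma is used throughout: an estimate that compares the \<open>v\<close>-mass of the
triple with the \<open>u\<close>-mass of the cube, for each cube of a countable family, passes to the union of the family.
Both the weighted weak type inequality and the reverse weak type inequality are instances.
\<close>

lemma cover_transfer:
  fixes S :: "((real ^ 'n::finite) \<times> real) set" and u v :: "real ^ 'n \<Rightarrow> ennreal"
  assumes S: "countable S" and [measurable]: "u \<in> meas" "v \<in> meas"
    and le: "\<And>a l. (a, l) \<in> S \<Longrightarrow>
      mass v (tricube a l) \<le> c * mass u (cube a l)"
  shows "mass v (\<Union>(a, l)\<in>S. cube a l)
    \<le> c * mass u (\<Union>(a, l)\<in>S. cube a l)"
proof (cases "S = {}")
  case False
  define P where "P n = from_nat_into S ` {..<n}" for n
  have PS: "P n \<subseteq> S" "finite (P n)" for n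
    using from_nat_into[OF False] by (auto simp: P_def)
  have UP: "(\<Union>n. P n) = S"
  proof
    show "S \<subseteq> (\<Union>n. P n)"
    proof
      fix q assume "q \<in> S"
      then obtain i where "q = from_nat_into S i"
        using from_nat_into_surj[OF S] by metis
      then have "q \<in> P (Suc i)" unfolding P_def by blast
      then show "q \<in> (\<Union>n. P n)" by blast
    qed
  qed (use PS in blast)
  define U where "U n = (\<Union>(a, l)\<in>P n. cube a l)" for n
  have UU: "(\<Union>n. U n) = (\<Union>(a, l)\<in>S. cube a l)"
    unfolding U_def UP[symmetric] by blast
  have inc: "incseq U"
    unfolding incseq_def U_def P_def by (intro allI impI UN_mono image_mono) auto
  have [measurable]: "U n \<in> sets lebesgue" for n
    unfolding U_def using PS(2) by (intro sets.finite_UN) auto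
  have ind: "indicator (\<Union>(a, l)\<in>S. cube a l) x = (SUP n. indicator (U n) x :: ennreal)" for x
  proof (cases "x \<in> (\<Union>n. U n)")
    case True
    then obtain n where "x \<in> U n" by blast
    then have "(1::ennreal) \<le> (SUP n. indicator (U n) x)"
      by (intro SUP_upper2[of n]) auto
    moreover have "(SUP n. indicator (U n) x) \<le> (1::ennreal)"
      by (intro SUP_least) (auto simp: indicator_def)
    ultimately have "(SUP n. indicator (U n) x) = (1::ennreal)" by (intro antisym)
    then show ?thesis using True unfolding UU[symmetric] by simp
  next
    case False
    then show ?thesis unfolding UU[symmetric] by simp
  qed
  have "mass v (\<Union>(a, l)\<in>S. cube a l) = (\<integral>\<^sup>+x. (SUP n. v x * indicator (U n) x) \<partial>lebesgue)"
    unfolding ind by (simp add: SUP_mult_left_ennreal)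
  also have "\<dots> = (SUP n. mass v (U n))"
    using inc
    by (intro nn_integral_monotone_convergence_SUP)
       (auto simp: incseq_def le_fun_def indicator_def intro!: mult_left_mono)
  also have "\<dots> \<le> c * mass u (\<Union>(a, l)\<in>S. cube a l)"
  proof (intro SUP_least)
    fix n
    have "mass v (U n) \<le> c * mass u (U n)"
      unfolding U_def using PS by (intro cover_transfer_finite le) auto
    also have "\<dots> \<le> c * mass u (\<Union>(a, l)\<in>S. cube a l)"
      unfolding UU[symmetric]
      by (intro mult_left_mono nn_integral_mono) (auto simp: indicator_def)
    finally show "mass v (U n) \<le> \<dots>" .
  qed
  finally show ?thesis .
qed auto

section \<open>The maximal operator on extended nonnegative functions\<close>

text \<open>
Cubes with rational data are encoded by their lower corner and their side. They suffice for the maximal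
function (\<open>emax_eq_rcubes\<close>) and form a countable family, whence measurability and the use of countable covers.
\<close>

definition rcubes :: "((real ^ 'n::finite) \<times> real) set" where
  "rcubes = {(a, l). (\<forall>i. a $ i \<in> \<rat>) \<and> l \<in> \<rat> \<and> 0 < l}"

lemma countable_rcubes: "countable (rcubes :: ((real ^ 'n::finite) \<times> real) set)"
proof -
  have "countable {a :: real ^ 'n. \<forall>i. a $ i \<in> \<rat>}"
    by (rule countable_vector) (rule countable_rat)
  then have "countable ({a :: real ^ 'n. \<forall>i. a $ i \<in> \<rat>} \<times> \<rat>)"
    using countable_rat by (intro countable_SIGMA)
  then show ?thesis
    by (rule countable_subset[rotated]) (auto simp: rcubes_def)
qed

lemma rcubes_pos: "(a, l) \<in> rcubes \<Longrightarrow> 0 < l"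
  by (simp add: rcubes_def)

definition emax :: "(real ^ 'n::finite \<Rightarrow> ennreal) \<Rightarrow> real ^ 'n \<Rightarrow> ennreal" where
  "emax f x = (SUP Q\<in>cubes. mass f Q / vol Q * indicator Q x)"

lemma maximal_eq_emax: "maximal f = emax (\<lambda>x. ennreal \<bar>f x\<bar>)"
  by (simp add: maximal_def emax_def fun_eq_iff)

lemma emax_upper:
  assumes "0 < l" "x \<in> cube a l"
  shows "mass f (cube a l) \<le> emax f x * vol (cube a l)"
proof -
  have "mass f (cube a l) / vol (cube a l) * indicator (cube a l) x \<le> emax f x"
    unfolding emax_def using assms by (intro SUP_upper) (auto simp: cubes_eq)
  then have "mass f (cube a l) / vol (cube a l) \<le> emax f x"
    using assms by simp
  then show ?thesis
    using assms by (simp add: divide_le_ennreal_iff emeasure_cube_pos emeasure_cube_finite)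
qed

lemma emax_least_all:
  assumes "\<And>a l. 0 < l \<Longrightarrow> x \<in> cube a l \<Longrightarrow> mass f (cube a l) \<le> c * vol (cube a l)"
  shows "emax f x \<le> c"
  unfolding emax_def
proof (rule SUP_least)
  fix Q :: "(real ^ 'a) set" assume "Q \<in> cubes"
  then obtain a l where "Q = cube a l" "0 < l" by (auto simp: cubes_eq)
  then show "mass f Q / vol Q * indicator Q x \<le> c"
    using assms[of l a] by (cases "x \<in> Q") (auto simp: divide_le_ennreal_iff emeasure_cube_pos emeasure_cube_finite)
qed

lemma rational_cube_above:
  fixes a :: "real ^ 'n::finite"
  assumes "0 < l" "0 < d"
  obtains b k where "(b, k) \<in> rcubes" "cube a l \<subseteq> cube b k" "k < l + d"
proof -
  have "\<exists>q\<in>\<rat>. a $ i - d / 2 < q \<and> q < a $ i" for i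
    using Rats_dense_in_real[of "a $ i - d / 2" "a $ i"] assms by auto
  then obtain q where q: "\<And>i. q i \<in> \<rat>" "\<And>i. a $ i - d / 2 < q i" "\<And>i. q i < a $ i"
    by metis
  obtain k where k: "k \<in> \<rat>" "l + d / 2 < k" "k < l + d"
    using Rats_dense_in_real[of "l + d / 2" "l + d"] assms by auto
  show ?thesis
  proof (rule that[of "\<chi> i. q i" k])
    show "cube a l \<subseteq> cube (\<chi> i. q i) k"
    proof
      fix x assume "x \<in> cube a l"
      then have x: "a $ i \<le> x $ i \<and> x $ i \<le> a $ i + l" for i by (auto simp: mem_cube)
      show "x \<in> cube (\<chi> i. q i) k"
        unfolding mem_cube
      proof
        fix i
        show "(\<chi> i. q i) $ i \<le> x $ i \<and> x $ i \<le> (\<chi> i. q i) $ i + k"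
          using x[of i] q(2,3)[of i] k by simp
      qed
    qed
  qed (use q k assms in \<open>auto simp: rcubes_def\<close>)
qed

text \<open>
Every cube lies in a rational cube of almost the same volume, so it is enough to test rational cubes.
\<close>

lemma emax_least:
  fixes f :: "real ^ 'n::finite \<Rightarrow> ennreal"
  assumes le: "\<And>a l. (a, l) \<in> rcubes \<Longrightarrow> x \<in> cube a l \<Longrightarrow>
    mass f (cube a l) \<le> c * vol (cube a l)"
  shows "emax f x \<le> c"
proof (rule emax_least_all)
  fix a :: "real ^ 'n" and l :: real assume l: "0 < l" and x: "x \<in> cube a l"
  show "mass f (cube a l) \<le> c * vol (cube a l)"
  proof (cases c)
    case top
    then show ?thesis using l emeasure_cube_pos[OF l, of a] by (simp add: ennreal_top_mult)
  next
    case (real r)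
    let ?I = "mass f (cube a l)"
    have "?I \<le> ennreal (r * (l + d) ^ CARD('n))" if d: "0 < d" for d
    proof -
      obtain b k where bk: "(b, k) \<in> rcubes" "cube a l \<subseteq> cube b k" "k < l + d"
        using rational_cube_above[OF l d] .
      have "?I \<le> mass f (cube b k)"
        using bk by (intro nn_integral_mono) (auto simp: indicator_def)
      also have "\<dots> \<le> ennreal r * ennreal (k ^ CARD('n))"
        using le[OF bk(1)] bk x real rcubes_pos[OF bk(1)] by (auto simp: emeasure_cube)
      also have "\<dots> = ennreal (r * k ^ CARD('n))"
        using real by (simp add: ennreal_mult')
      also have "\<dots> \<le> ennreal (r * (l + d) ^ CARD('n))"
        using bk real rcubes_pos[OF bk(1)] by (intro ennreal_leI mult_left_mono power_mono) auto
      finally show ?thesis .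
    qed
    then have "\<forall>\<^sub>F d in at_right 0. ?I \<le> ennreal (r * (l + d) ^ CARD('n))"
      by (auto simp: eventually_at_right_less intro: eventually_mono[OF eventually_at_right_less])
    moreover have "((\<lambda>d. ennreal (r * (l + d) ^ CARD('n))) \<longlongrightarrow> ennreal (r * (l + 0) ^ CARD('n))) (at_right 0)"
      by (intro tendsto_ennrealI tendsto_intros)
    ultimately have "?I \<le> ennreal (r * (l + 0) ^ CARD('n))"
      by (intro tendsto_lowerbound) auto
    then show ?thesis using real l by (simp add: emeasure_cube ennreal_mult')
  qed
qed

lemma emax_eq_rcubes:
  "emax f x = (SUP (a, l)\<in>rcubes. mass f (cube a l) / vol (cube a l) * indicator (cube a l) x)"
  (is "_ = ?R")
proof (rule antisym)
  show "emax f x \<le> ?R"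
  proof (rule emax_least)
    fix a :: "real ^ 'a" and l assume al: "(a, l) \<in> rcubes" "x \<in> cube a l"
    have "mass f (cube a l) / vol (cube a l) * indicator (cube a l) x \<le> ?R"
      using al by (intro SUP_upper2[of "(a, l)"]) auto
    then show "mass f (cube a l) \<le> ?R * vol (cube a l)"
      using al rcubes_pos[OF al(1)] by (simp add: divide_le_ennreal_iff emeasure_cube_pos emeasure_cube_finite)
  qed
  show "?R \<le> emax f x"
    unfolding emax_def
  proof (intro SUP_least)
    fix q :: "(real ^ 'a) \<times> real" assume "q \<in> rcubes"
    then obtain a l where q: "q = (a, l)" "(a, l) \<in> rcubes" by (cases q) auto
    then have "cube a l \<in> cubes" using rcubes_pos by (auto simp: cubes_eq)
    then show "(case q of (a, l) \<Rightarrow> mass f (cube a l) / vol (cube a l) * indicator (cube a l) x)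
       \<le> (SUP Q\<in>cubes. mass f Q / vol Q * indicator Q x)"
      unfolding q by (auto intro: SUP_upper2[of "cube a l"])
  qed
qed

lemma emax_measurable [measurable]: "emax f \<in> meas"
proof -
  have "(\<lambda>x. SUP (a, l)\<in>rcubes. mass f (cube a l) / vol (cube a l) * indicator (cube a l) x) \<in> meas"
    by (intro borel_measurable_SUP countable_rcubes) (auto simp: case_prod_beta)
  then show ?thesis by (simp add: emax_eq_rcubes[abs_def])
qed

lemma emax_mono_AE:
  assumes "AE x in lebesgue. f x \<le> g x"
  shows "emax f x \<le> emax g x"
proof -
  have "(\<integral>\<^sup>+y\<in>Q. f y \<partial>lebesgue) \<le> mass g Q" for Q
    by (intro nn_integral_mono_AE eventually_mono[OF assms] mult_right_mono) auto
  then show ?thesis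
    unfolding emax_def by (intro SUP_subset_mono mult_right_mono divide_right_mono_ennreal) auto
qed

lemma emax_cmult:
  assumes [measurable]: "f \<in> meas"
  shows "emax (\<lambda>x. c * f x) x = c * emax f x"
proof -
  have "mass (\<lambda>y. c * f y) Q / vol Q * indicator Q x
      = c * (mass f Q / vol Q * indicator Q x)" if "Q \<in> cubes" for Q
  proof -
    have [measurable]: "Q \<in> sets lebesgue" using that by (auto simp: cubes_eq)
    have "mass (\<lambda>y. c * f y) Q = c * mass f Q"
      by (subst nn_integral_cmult[symmetric]) (auto simp: mult.assoc)
    then show ?thesis by (simp add: ennreal_times_divide[symmetric] mult.assoc)
  qed
  then show ?thesis
    unfolding emax_def by (simp add: SUP_mult_left_ennreal)
qed

lemma emax_suminf:
  assumes "\<And>n. f n \<in> meas"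
  shows "emax (\<lambda>x. \<Sum>n. f n x) x \<le> (\<Sum>n. emax (f n) x)"
proof (rule emax_least_all)
  note [measurable] = assms
  fix a :: "real ^ 'a" and l :: real assume al: "0 < l" "x \<in> cube a l"
  have "mass (\<lambda>y. (\<Sum>n. f n y)) (cube a l) = (\<Sum>n. mass (f n) (cube a l))"
    by (subst nn_integral_suminf[symmetric]) (auto simp: ennreal_suminf_multc)
  also have "\<dots> \<le> (\<Sum>n. emax (f n) x * vol (cube a l))"
    using al by (intro suminf_le emax_upper) auto
  also have "\<dots> = (\<Sum>n. emax (f n) x) * vol (cube a l)"
    by (simp add: ennreal_suminf_multc)
  finally show "mass (\<lambda>y. (\<Sum>n. f n y)) (cube a l) \<le> \<dots>" .
qed

section \<open>The layer cake formula\<close>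

lemma sigma_finite_lebesgue: "sigma_finite_measure (lebesgue :: ('a::euclidean_space) measure)"
proof
  obtain A :: "'a set set" where "countable A" "A \<subseteq> sets lborel" "\<Union>A = space lborel"
    "\<forall>a\<in>A. emeasure lborel a \<noteq> \<infinity>"
    using lborel.sigma_finite_countable by blast
  then show "\<exists>A::'a set set. countable A \<and> A \<subseteq> sets lebesgue \<and> \<Union>A = space lebesgue \<and>
      (\<forall>a\<in>A. emeasure lebesgue a \<noteq> \<infinity>)"
    by (intro exI[of _ A]) (auto simp: emeasure_completion)
qed

lemma ennreal_mult_assoc: "0 \<le> a \<Longrightarrow> ennreal a * (ennreal b * x) = ennreal (a * b) * x"
  by (simp add: ennreal_mult' mult.assoc)

lemma indicator_mono: "A \<subseteq> B \<Longrightarrow> indicator A x \<le> (indicator B x :: ennreal)"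
  by (auto simp: indicator_def)

lemma AE_obtain_in:
  assumes ae: "AE x in M. P x" and A: "A \<in> sets M" "0 < emeasure M A"
  obtains x where "x \<in> A" "P x"
proof (rule ccontr)
  assume "\<not> thesis"
  then have "\<And>x. x \<in> A \<Longrightarrow> \<not> P x" using that by blast
  with ae have "AE x in M. x \<notin> A" by (auto elim!: eventually_mono)
  then have "A \<in> null_sets M" using A(1) by (simp add: AE_iff_null_sets)
  then have "emeasure M A = 0" by auto
  with A(2) show False by simp
qed

lemma epow_eq_integral:
  assumes p: "0 < p"
  shows "epow y p = (\<integral>\<^sup>+t. (if 0 < t \<and> ennreal t < y then ennreal (p * t powr (p - 1)) else 0) \<partial>lborel)"
    (is "_ = ?I y")
proof -
  have base: "(\<integral>\<^sup>+t. ennreal (p * t powr (p - 1)) * indicator {0..c} t \<partial>lborel) = ennreal (c powr p)"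
    if c: "0 \<le> c" for c
  proof (rule nn_integral_has_integral_lebesgue')
    show "((\<lambda>t. p * t powr (p - 1)) has_integral c powr p) {0..c}"
      using has_integral_mult_right[OF has_integral_powr_from_0[of "p - 1" c], of p] p c by simp
  qed (use p in auto)
  have fin: "?I (ennreal c) = ennreal (c powr p)" if c: "0 \<le> c" for c
  proof -
    \<comment> \<open>the integrand and its closed-interval version differ at the two end points only\<close>
    have "AE t in lborel. t \<noteq> 0 \<and> t \<noteq> c"
      using AE_lborel_singleton[of 0] AE_lborel_singleton[of c] by eventually_elim auto
    then have "?I (ennreal c) = (\<integral>\<^sup>+t. ennreal (p * t powr (p - 1)) * indicator {0..c} t \<partial>lborel)"
    proof (intro nn_integral_cong_AE, eventually_elim)
      case (elim t)
      then show ?case using c by (auto simp: indicator_def ennreal_less_iff)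
    qed
    then show ?thesis using base[OF c] by simp
  qed
  show ?thesis
  proof (cases y)
    case (real c)
    then show ?thesis using fin by simp
  next
    case top
    have "ennreal r \<le> ?I top" if r: "0 \<le> r" for r
    proof -
      have "ennreal r = ennreal ((r powr (1/p)) powr p)" using r p by (simp add: powr_powr)
      also have "\<dots> = ?I (ennreal (r powr (1/p)))" by (rule fin[symmetric]) simp
      also have "\<dots> \<le> ?I top" by (intro nn_integral_mono) (auto simp: ennreal_less_top)
      finally show ?thesis .
    qed
    note ge = this
    have "?I top = top"
    proof (cases "?I top")
      case (real r)
      then show ?thesis using ge[of "r + 1"] by simp
    qed
    then show ?thesis using top by simp
  qed
qed

lemma mass_level_set_measurable:
  fixes v F :: "real ^ 'n::finite \<Rightarrow> ennreal"
  assumes [measurable]: "v \<in> meas" "F \<in> meas"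
  shows "(\<lambda>t. mass v {x. ennreal t < F x}) \<in> borel_measurable lborel"
proof -
  interpret sigma_finite_measure "lebesgue :: (real ^ 'n) measure" by (rule sigma_finite_lebesgue)
  have "(\<lambda>t. \<integral>\<^sup>+x. (if ennreal t < F x then v x else 0) \<partial>lebesgue) \<in> borel_measurable lborel"
    by (intro borel_measurable_nn_integral) measurable
  also have "(\<lambda>t. \<integral>\<^sup>+x. (if ennreal t < F x then v x else 0) \<partial>lebesgue) = (\<lambda>t. mass v {x. ennreal t < F x})"
    by (intro ext nn_integral_cong) (auto simp: indicator_def)
  finally show ?thesis .
qed

text \<open>
Tonelli's theorem for \<open>v x * (p * t powr (p - 1))\<close> on the region \<open>0 < t < F x\<close>, in a form with a density \<open>v\<close>.
\<close>

lemma layer_cake: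
  fixes v F :: "real ^ 'n::finite \<Rightarrow> ennreal"
  assumes [measurable]: "v \<in> meas" "F \<in> meas" and p: "0 < p"
  shows "(\<integral>\<^sup>+x. v x * epow (F x) p \<partial>lebesgue)
    = (\<integral>\<^sup>+t\<in>{0<..}. ennreal (p * t powr (p - 1)) * mass v {x. ennreal t < F x} \<partial>lborel)"
proof -
  interpret pair_sigma_finite lebesgue "lborel :: real measure"
    by (intro pair_sigma_finite.intro sigma_finite_lebesgue lborel.sigma_finite_measure_axioms)
  let ?k = "\<lambda>x t. v x * (if 0 < t \<and> ennreal t < F x then ennreal (p * t powr (p - 1)) else 0)"
  have "(\<integral>\<^sup>+x. v x * epow (F x) p \<partial>lebesgue) = (\<integral>\<^sup>+x. \<integral>\<^sup>+t. ?k x t \<partial>lborel \<partial>lebesgue)"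
    by (intro nn_integral_cong) (subst nn_integral_cmult, simp_all add: epow_eq_integral[OF p])
  also have "\<dots> = (\<integral>\<^sup>+t. \<integral>\<^sup>+x. ?k x t \<partial>lebesgue \<partial>lborel)"
    by (rule Fubini'[symmetric]) measurable
  also have "\<dots> = (\<integral>\<^sup>+t\<in>{0<..}. ennreal (p * t powr (p - 1)) * mass v {x. ennreal t < F x} \<partial>lborel)"
  proof (intro nn_integral_cong)
    fix t :: real
    show "(\<integral>\<^sup>+x. ?k x t \<partial>lebesgue) = ennreal (p * t powr (p - 1)) * mass v {x. ennreal t < F x} * indicator {0<..} t"
    proof (cases "0 < t")
      case True
      have "(\<integral>\<^sup>+x. ?k x t \<partial>lebesgue) = (\<integral>\<^sup>+x. ennreal (p * t powr (p - 1)) * (v x * indicator {x. ennreal t < F x} x) \<partial>lebesgue)"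
        using True by (intro nn_integral_cong) (auto simp: indicator_def mult.commute)
      also have "\<dots> = ennreal (p * t powr (p - 1)) * mass v {x. ennreal t < F x}"
        by (intro nn_integral_cmult) measurable
      finally show ?thesis using True by simp
    qed simp
  qed
  finally show ?thesis .
qed

section \<open>Muckenhoupt weights and the weighted maximal function\<close>

text \<open>
Finiteness and positivity almost everywhere are part of the definition: they exclude the weights 0 and
\<open>\<infinity>\<close> and make every cube have positive finite mass.
\<close>

definition A1_weight :: "real \<Rightarrow> (real ^ 'n::finite \<Rightarrow> ennreal) \<Rightarrow> bool" where
  "A1_weight C w \<longleftrightarrow> 1 \<le> C \<and> w \<in> meas \<and> (AE x in lebesgue. 0 < w x \<and> w x < top) \<and>
     (AE x in lebesgue. emax w x \<le> ennreal C * w x)"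

lemma A1_weight_measurable: "A1_weight C w \<Longrightarrow> w \<in> meas"
  by (simp add: A1_weight_def)

text \<open>
The \<open>A\<^sub>1\<close> condition on cubes: the average over a cube is at most \<open>C\<close> times the essential infimum.
\<close>

lemma A1_weight_AE_cube:
  assumes "A1_weight C w"
  shows "AE x in lebesgue. \<forall>a l. 0 < l \<longrightarrow> x \<in> cube a l \<longrightarrow>
    mass w (cube a l) \<le> ennreal C * w x * vol (cube a l)"
proof -
  have "AE x in lebesgue. emax w x \<le> ennreal C * w x"
    using assms by (simp add: A1_weight_def)
  then show ?thesis
  proof eventually_elim
    case (elim x)
    show ?case
      using order_trans[OF emax_upper mult_right_mono[OF elim zero_le]] by auto
  qed
qed

lemma A1_weight_cube_pos_finite:
  assumes w: "A1_weight C w" and l: "0 < l"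
  shows "0 < mass w (cube a l)" "mass w (cube a l) < top"
proof -
  note [measurable] = A1_weight_measurable[OF w]
  have pf: "AE x in lebesgue. 0 < w x \<and> w x < top"
    using w by (simp add: A1_weight_def)
  have "AE x in lebesgue. w x < top \<and> (x \<in> cube a l \<longrightarrow>
    mass w (cube a l) \<le> ennreal C * w x * vol (cube a l))"
    using pf A1_weight_AE_cube[OF w] by eventually_elim (use l in auto)
  note ae = this
  obtain x where x: "x \<in> cube a l" "w x < top \<and> (x \<in> cube a l \<longrightarrow>
    mass w (cube a l) \<le> ennreal C * w x * vol (cube a l))"
    using AE_obtain_in[OF ae cube_sets emeasure_cube_pos[OF l, of a]] by blast
  from x have "mass w (cube a l) \<le> ennreal C * w x * vol (cube a l)" by simp
  also have "\<dots> < top"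
    using x emeasure_cube_finite[OF l, of a] by (simp add: ennreal_mult_less_top)
  finally show "mass w (cube a l) < top" .
  show "0 < mass w (cube a l)"
  proof (rule ccontr)
    assume "\<not> ?thesis"
    then have "AE x in lebesgue. w x * indicator (cube a l) x = 0"
      by (simp add: nn_integral_0_iff_AE)
    then have "AE x in lebesgue. 0 < w x \<and> w x * indicator (cube a l) x = 0"
      using pf by eventually_elim auto
    note ae0 = this
    obtain x where "x \<in> cube a l" "0 < w x \<and> w x * indicator (cube a l) x = 0"
      using AE_obtain_in[OF ae0 cube_sets emeasure_cube_pos[OF l, of a]] by blast
    then show False by auto
  qed
qed

lemma A1_weight_average:
  assumes w: "A1_weight C w" and l: "0 < l"
  obtains m where "0 < m" "mass w (cube a l) = ennreal m * vol (cube a l)" "mass w (cube a l) / vol (cube a l) = ennreal m"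
proof -
  note V = emeasure_cube_pos[OF l, of a] emeasure_cube_finite[OF l, of a]
  let ?A = "mass w (cube a l) / vol (cube a l)"
  have "?A < top" "0 < ?A"
    using V A1_weight_cube_pos_finite[OF w l, of a]
    by (auto simp: divide_less_ennreal ennreal_zero_less_divide ennreal_mult_top)
  then obtain m where "?A = ennreal m" "0 < m" by (cases ?A) auto
  moreover have "mass w (cube a l) = ?A * vol (cube a l)" using V by (simp add: ennreal_divide_times)
  ultimately show ?thesis using that by metis
qed

text \<open>
Integrate over the cube the bound of the average over its triple by \<open>C * w\<close>.
\<close>

lemma A1_weight_doubling:
  fixes w :: "real ^ 'n::finite \<Rightarrow> ennreal"
  assumes w: "A1_weight C w" and l: "0 < l"
  shows "mass w (tricube a l) \<le> ennreal (C * 3 ^ CARD('n)) * mass w (cube a l)"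
proof -
  note [measurable] = A1_weight_measurable[OF w]
  have C: "1 \<le> C" using w by (simp add: A1_weight_def)
  let ?T = "mass w (tricube a l)" and ?v = "vol (cube a l)"
  have "?v * ?T = mass (\<lambda>y. ?T) (cube a l)"
    by (subst nn_integral_cmult_indicator) (auto simp: mult.commute)
  also have "\<dots> \<le> (\<integral>\<^sup>+y. (ennreal (C * 3 ^ CARD('n)) * ?v) * (w y * indicator (cube a l) y) \<partial>lebesgue)"
  proof (rule nn_integral_mono_AE)
    show "AE y in lebesgue. ?T * indicator (cube a l) y \<le> (ennreal (C * 3 ^ CARD('n)) * ?v) * (w y * indicator (cube a l) y)"
      using A1_weight_AE_cube[OF w]
    proof eventually_elim
      case (elim x)
      show ?case
      proof (cases "x \<in> cube a l")
        case True
        then have "x \<in> tricube a l" using cube_subset_tricube[of l a] l by auto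
        then have "?T \<le> ennreal C * w x * vol (tricube a l)"
          using elim l unfolding tricube_def by simp
        then show ?thesis
          using True C l by (simp add: emeasure_tricube ennreal_mult' mult_ac)
      qed simp
    qed
  qed
  also have "\<dots> = ?v * (ennreal (C * 3 ^ CARD('n)) * mass w (cube a l))"
    by (subst nn_integral_cmult) (measurable, simp add: mult_ac)
  finally show ?thesis
    using emeasure_cube_pos[OF l, of a] emeasure_cube_finite[OF l, of a]
    by (subst (asm) ennreal_mult_le_mult_iff) auto
qed

text \<open>
The maximal function for averages with respect to the measure \<open>w dx\<close>. For an \<open>A\<^sub>1\<close> weight it dominates the
unweighted one (\<open>emax_le_wmax\<close>), and it is easier to bound on \<open>L\<^sup>p(w)\<close>, as only the doubling property is used.
\<close>

definition wmax :: "(real ^ 'n::finite \<Rightarrow> ennreal) \<Rightarrow> (real ^ 'n \<Rightarrow> ennreal) \<Rightarrow> real ^ 'n \<Rightarrow> ennreal" where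
  "wmax w f x = (SUP (a, l)\<in>rcubes.
     mass (\<lambda>y. f y * w y) (cube a l) / mass w (cube a l) * indicator (cube a l) x)"

lemma wmax_measurable [measurable]: "wmax w f \<in> meas"
proof -
  have "(\<lambda>x. SUP (a, l)\<in>rcubes. mass (\<lambda>y. f y * w y) (cube a l) / mass w (cube a l) * indicator (cube a l) x) \<in> meas"
    by (intro borel_measurable_SUP countable_rcubes) (auto simp: case_prod_beta)
  then show ?thesis by (simp add: wmax_def[abs_def])
qed

lemma wmax_upper:
  assumes w: "A1_weight C w" and al: "(a, l) \<in> rcubes" "x \<in> cube a l"
  shows "mass (\<lambda>y. f y * w y) (cube a l) \<le> wmax w f x * mass w (cube a l)"
proof -
  have "mass (\<lambda>y. f y * w y) (cube a l) / mass w (cube a l) * indicator (cube a l) x \<le> wmax w f x"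
    unfolding wmax_def using al by (intro SUP_upper2[of "(a, l)"]) auto
  then show ?thesis
    using al A1_weight_cube_pos_finite[OF w rcubes_pos[OF al(1)], of a]
    by (simp add: divide_le_ennreal_iff)
qed

text \<open>
Unweighted averages are dominated by weighted ones, because \<open>w\<close> is at least a constant multiple of its
average on the cube.
\<close>

lemma A1_weight_average_le:
  assumes w: "A1_weight C w" and [measurable]: "f \<in> meas" and l: "0 < l"
  shows "mass w (cube a l) * mass f (cube a l)
    \<le> (ennreal C * vol (cube a l)) * mass (\<lambda>y. f y * w y) (cube a l)"
proof -
  note [measurable] = A1_weight_measurable[OF w]
  let ?W = "mass w (cube a l)" and ?v = "vol (cube a l)"
  have "?W * mass f (cube a l) = (\<integral>\<^sup>+y. ?W * (f y * indicator (cube a l) y) \<partial>lebesgue)"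
    by (subst nn_integral_cmult) auto
  also have "\<dots> \<le> (\<integral>\<^sup>+y. (ennreal C * ?v) * (f y * w y * indicator (cube a l) y) \<partial>lebesgue)"
  proof (rule nn_integral_mono_AE)
    show "AE y in lebesgue. ?W * (f y * indicator (cube a l) y) \<le> (ennreal C * ?v) * (f y * w y * indicator (cube a l) y)"
      using A1_weight_AE_cube[OF w]
    proof eventually_elim
      case (elim y)
      show ?case
      proof (cases "y \<in> cube a l")
        case True
        with elim have "?W \<le> ennreal C * w y * ?v"
          using l by blast
        from mult_right_mono[OF this, of "f y"] show ?thesis
          using True by (simp add: mult_ac)
      qed simp
    qed
  qed
  also have "\<dots> = (ennreal C * ?v) * mass (\<lambda>y. f y * w y) (cube a l)"
    by (intro nn_integral_cmult) measurable
  finally show ?thesis .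
qed

lemma emax_le_wmax:
  assumes w: "A1_weight C w" and f: "f \<in> meas"
  shows "emax f x \<le> ennreal C * wmax w f x"
proof (rule emax_least)
  fix a :: "real ^ 'a" and l assume al: "(a, l) \<in> rcubes" "x \<in> cube a l"
  let ?W = "mass w (cube a l)" and ?v = "vol (cube a l)"
  have W: "0 < ?W" "?W < top"
    using A1_weight_cube_pos_finite[OF w rcubes_pos[OF al(1)]] by auto
  have "?W * mass f (cube a l) \<le> (ennreal C * ?v) * mass (\<lambda>y. f y * w y) (cube a l)"
    by (rule A1_weight_average_le[OF w f rcubes_pos[OF al(1)]])
  also have "\<dots> \<le> (ennreal C * ?v) * (wmax w f x * ?W)"
    by (intro mult_left_mono wmax_upper[OF w] al) auto
  also have "\<dots> = ?W * (ennreal C * wmax w f x * ?v)" by (simp add: mult_ac)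
  finally show "mass f (cube a l) \<le> ennreal C * wmax w f x * ?v"
    using W by (subst (asm) ennreal_mult_le_mult_iff) auto
qed

text \<open>
The weak type inequality, with \<open>f\<close> already truncated at height \<open>t / 2\<close> on the right: on a cube with
\<open>w\<close>-average above \<open>t\<close>, the part of \<open>f\<close> below \<open>t / 2\<close> accounts for at most half of the integral. This form
can be integrated against \<open>t powr (p - 1)\<close> directly.
\<close>

lemma wmax_weak_type:
  fixes w f :: "real ^ 'n::finite \<Rightarrow> ennreal"
  assumes w: "A1_weight C w" and [measurable]: "f \<in> meas" and t: "0 < t"
  shows "mass w {x. ennreal t < wmax w f x}
    \<le> ennreal (2 * C * 3 ^ CARD('n) / t) * mass (\<lambda>x. f x * w x) {x. ennreal t < 2 * f x}"
proof -
  note [measurable] = A1_weight_measurable[OF w]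
  have C: "1 \<le> C" using w by (simp add: A1_weight_def)
  define u where "u x = f x * w x * indicator {x. ennreal t < 2 * f x} x" for x
  have [measurable]: "u \<in> meas" unfolding u_def by measurable
  define S where "S = {(a, l)\<in>rcubes. ennreal t * mass w (cube a l) < mass (\<lambda>y. f y * w y) (cube a l)}"
  have sub: "{x. ennreal t < wmax w f x} \<subseteq> (\<Union>(a, l)\<in>S. cube a l)"
  proof
    fix x assume "x \<in> {x. ennreal t < wmax w f x}"
    then obtain a l where al: "(a, l) \<in> rcubes" and lt: "ennreal t < mass (\<lambda>y. f y * w y) (cube a l) / mass w (cube a l) * indicator (cube a l) x"
      by (auto simp: wmax_def less_SUP_iff)
    then have x: "x \<in> cube a l" by (cases "x \<in> cube a l") auto
    then have "(a, l) \<in> S"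
      using al lt A1_weight_cube_pos_finite[OF w rcubes_pos[OF al], of a]
      by (simp add: S_def less_divide_ennreal_iff)
    with x show "x \<in> (\<Union>(a, l)\<in>S. cube a l)" by auto
  qed
  have "countable S"
    unfolding S_def by (rule countable_subset[OF _ countable_rcubes]) auto
  then have "mass w (\<Union>(a, l)\<in>S. cube a l)
    \<le> ennreal (2 * C * 3 ^ CARD('n) / t) * mass u (\<Union>(a, l)\<in>S. cube a l)"
  proof (rule cover_transfer)
    fix a l assume "(a, l) \<in> S"
    then have al: "(a, l) \<in> rcubes" and lt: "ennreal t * mass w (cube a l) < mass (\<lambda>y. f y * w y) (cube a l)"
      by (auto simp: S_def)
    let ?W = "mass w (cube a l)" and ?U = "mass u (cube a l)"
    have W: "0 < ?W" "?W < top"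
      using A1_weight_cube_pos_finite[OF w rcubes_pos[OF al]] by auto
    have "ennreal t * ?W \<le> mass (\<lambda>y. f y * w y) (cube a l)" using lt by simp
    also have "\<dots> \<le> (\<integral>\<^sup>+y. u y * indicator (cube a l) y + ennreal (t / 2) * (w y * indicator (cube a l) y) \<partial>lebesgue)"
    proof (intro nn_integral_mono)
      fix y
      show "f y * w y * indicator (cube a l) y \<le> u y * indicator (cube a l) y + ennreal (t / 2) * (w y * indicator (cube a l) y)"
      proof (cases "ennreal t < 2 * f y")
        case False
        then have "2 * f y \<le> 2 * ennreal (t / 2)"
          using t by (simp add: numeral_mult_ennreal)
        then have "f y \<le> ennreal (t / 2)"
          by (subst (asm) ennreal_mult_le_mult_iff) auto
        from mult_right_mono[OF this, of "w y"] show ?thesis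
          by (auto simp: u_def indicator_def add_increasing)
      qed (simp add: u_def)
    qed
    also have "\<dots> = ?U + ennreal (t / 2) * ?W"
      by (simp add: nn_integral_add nn_integral_cmult)
    finally have "ennreal t * ?W \<le> ?U + ennreal (t / 2) * ?W" .
    moreover have "ennreal t * ?W = ennreal (t / 2) * ?W + ennreal (t / 2) * ?W"
      using t by (simp add: distrib_right[symmetric] ennreal_plus[symmetric] del: ennreal_plus)
    ultimately have "ennreal (t / 2) * ?W \<le> ?U"
      using W ennreal_add_left_cancel_le[of "ennreal (t / 2) * ?W" "ennreal (t / 2) * ?W" ?U]
      by (auto simp: ennreal_mult_eq_top_iff add.commute[of ?U])
    then have W2: "ennreal (2 / t) * (ennreal (t / 2) * ?W) \<le> ennreal (2 / t) * ?U"
      by (intro mult_left_mono) auto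
    have "ennreal (2 / t) * (ennreal (t / 2) * ?W) = ?W"
      using t by (subst ennreal_mult_assoc) auto
    with W2 have W3: "?W \<le> ennreal (2 / t) * ?U" by simp
    have "mass w (tricube a l) \<le> ennreal (C * 3 ^ CARD('n)) * ?W"
      by (rule A1_weight_doubling[OF w rcubes_pos[OF al]])
    also have "\<dots> \<le> ennreal (C * 3 ^ CARD('n)) * (ennreal (2 / t) * ?U)"
      by (intro mult_left_mono W3) auto
    also have "\<dots> = ennreal (2 * C * 3 ^ CARD('n) / t) * ?U"
      using C t by (subst ennreal_mult_assoc) (auto simp: mult_ac)
    finally show "mass w (tricube a l) \<le> ennreal (2 * C * 3 ^ CARD('n) / t) * ?U" .
  qed measurable
  moreover have "mass w {x. ennreal t < wmax w f x} \<le> mass w (\<Union>(a, l)\<in>S. cube a l)"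
    using sub by (intro nn_integral_mono mult_left_mono indicator_mono) auto
  moreover have "mass u (\<Union>(a, l)\<in>S. cube a l) \<le> mass (\<lambda>x. f x * w x) {x. ennreal t < 2 * f x}"
    by (intro nn_integral_mono) (auto simp: u_def indicator_def)
  ultimately show ?thesis
    by (meson dual_order.trans mult_left_mono zero_le)
qed

text \<open>
The Marcinkiewicz interpolation argument: integrate the truncated weak type inequality, with the layer cake formula
applied twice, to \<open>wmax w f\<close> and back to \<open>2 f\<close>. The constant depends on \<open>w\<close> only through \<open>C\<close>, which is
what makes it useful for weights produced by the Rubio de Francia algorithm.
\<close>

lemma wmax_strong_type:
  assumes p: "1 < p" and C: "1 \<le> C"
  shows "\<exists>K>0. \<forall>(w :: real ^ 'n::finite \<Rightarrow> ennreal) f. A1_weight C w \<longrightarrow> f \<in> meas \<longrightarrow>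
    (\<integral>\<^sup>+x. w x * epow (wmax w f x) p \<partial>lebesgue) \<le> ennreal K * (\<integral>\<^sup>+x. w x * epow (f x) p \<partial>lebesgue)"
proof (intro exI conjI allI impI)
  let ?D = "2 * C * 3 ^ CARD('n)"
  let ?K = "?D * p / (p - 1) * 2 powr (p - 1)"
  show "0 < ?K" using p C by (intro mult_pos_pos divide_pos_pos) auto
  fix w f :: "real ^ 'n::finite \<Rightarrow> ennreal"
  assume w: "A1_weight C w" and [measurable]: "f \<in> meas"
  note [measurable] = A1_weight_measurable[OF w]
  have fw [measurable]: "(\<lambda>x. f x * w x) \<in> meas" by measurable
  have f2 [measurable]: "(\<lambda>x. 2 * f x) \<in> meas" by measurable
  have "(\<integral>\<^sup>+x. w x * epow (wmax w f x) p \<partial>lebesgue)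
     = (\<integral>\<^sup>+t\<in>{0<..}. ennreal (p * t powr (p - 1)) * mass w {x. ennreal t < wmax w f x} \<partial>lborel)"
    using p by (intro layer_cake) auto
  also have "\<dots> \<le> (\<integral>\<^sup>+t. ennreal (?D * p / (p - 1)) * (ennreal ((p - 1) * t powr (p - 1 - 1)) * mass (\<lambda>x. f x * w x) {x. ennreal t < 2 * f x} * indicator {0<..} t) \<partial>lborel)"
  proof (intro nn_integral_mono)
    fix t :: real
    let ?J = "mass (\<lambda>x. f x * w x) {x. ennreal t < 2 * f x}"
    show "ennreal (p * t powr (p - 1)) * mass w {x. ennreal t < wmax w f x} * indicator {0<..} t
      \<le> ennreal (?D * p / (p - 1)) * (ennreal ((p - 1) * t powr (p - 1 - 1)) * ?J * indicator {0<..} t)"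
    proof (cases "0 < t")
      case True
      have pw: "t powr (p - 1) / t = t powr (p - 1 - 1)"
        using True powr_diff[of t "p - 1" 1] by simp
      have "ennreal (p * t powr (p - 1)) * mass w {x. ennreal t < wmax w f x}
        \<le> ennreal (p * t powr (p - 1)) * (ennreal (?D / t) * ?J)"
        by (intro mult_left_mono wmax_weak_type[OF w] True) auto
      also have "\<dots> = ennreal (?D * p * (t powr (p - 1) / t)) * ?J"
        using p by (subst ennreal_mult_assoc) (auto simp: mult_ac)
      also have "\<dots> = ennreal (?D * p / (p - 1)) * (ennreal ((p - 1) * t powr (p - 1 - 1)) * ?J)"
        unfolding pw using p C by (subst ennreal_mult_assoc) (auto simp: mult_ac)
      finally show ?thesis using True by simp
    qed simp
  qed
  also have "\<dots> = ennreal (?D * p / (p - 1)) * (\<integral>\<^sup>+t\<in>{0<..}. ennreal ((p - 1) * t powr (p - 1 - 1)) * mass (\<lambda>x. f x * w x) {x. ennreal t < 2 * f x} \<partial>lborel)"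
  proof (rule nn_integral_cmult)
    note [measurable] = mass_level_set_measurable[OF fw f2]
    show "(\<lambda>t. ennreal ((p - 1) * t powr (p - 1 - 1)) * mass (\<lambda>x. f x * w x) {x. ennreal t < 2 * f x} * indicator {0<..} t) \<in> borel_measurable lborel"
      by measurable
  qed
  also have "(\<integral>\<^sup>+t\<in>{0<..}. ennreal ((p - 1) * t powr (p - 1 - 1)) * mass (\<lambda>x. f x * w x) {x. ennreal t < 2 * f x} \<partial>lborel)
      = (\<integral>\<^sup>+x. f x * w x * epow (2 * f x) (p - 1) \<partial>lebesgue)"
    using p by (intro layer_cake[symmetric]) auto
  also have "\<dots> = (\<integral>\<^sup>+x. ennreal (2 powr (p - 1)) * (w x * epow (f x) p) \<partial>lebesgue)"
  proof (intro nn_integral_cong)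
    fix x
    have "f x * epow (f x) (p - 1) = epow (f x) p"
      using epow_add[of 1 "p - 1" "f x"] p by simp
    moreover have "epow 2 (p - 1) = ennreal (2 powr (p - 1))"
      using epow_ennreal[of 2 "p - 1"] by simp
    ultimately show "f x * w x * epow (2 * f x) (p - 1) = ennreal (2 powr (p - 1)) * (w x * epow (f x) p)"
      by (metis (no_types, opaque_lifting) epow_mult mult.assoc mult.commute)
  qed
  also have "\<dots> = ennreal (2 powr (p - 1)) * (\<integral>\<^sup>+x. w x * epow (f x) p \<partial>lebesgue)"
    by (intro nn_integral_cmult) measurable
  also have "ennreal (?D * p / (p - 1)) * \<dots> = ennreal ?K * (\<integral>\<^sup>+x. w x * epow (f x) p \<partial>lebesgue)"
    using p C by (subst ennreal_mult_assoc) auto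
  finally show "(\<integral>\<^sup>+x. w x * epow (wmax w f x) p \<partial>lebesgue) \<le> ennreal ?K * (\<integral>\<^sup>+x. w x * epow (f x) p \<partial>lebesgue)" .
qed

section \<open>A function is dominated by its maximal function\<close>

text \<open>
Cover \<open>E\<close> by nonoverlapping cubes that meet \<open>E\<close> and stay in an open set \<open>U\<close> of almost the same measure.
On each of them the average of \<open>f\<close> is at most \<open>t\<close>, so the integral of \<open>f\<close> over \<open>E\<close> is at most
\<open>t * vol U\<close>, while it is at least \<open>s * vol E\<close>. Thus \<open>f \<le> emax f\<close> follows from outer regularity alone, and
Lebesgue's differentiation theorem can be avoided.
\<close>

lemma null_set_of_small_averages:
  fixes f :: "real ^ 'n::finite \<Rightarrow> ennreal"
  assumes [measurable]: "f \<in> meas" and E [measurable]: "E \<in> sets lebesgue"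
    and sub: "E \<subseteq> cube a l" and l: "0 < l" and ts: "0 \<le> t" "t < s"
    and fs: "\<And>x. x \<in> E \<Longrightarrow> ennreal s \<le> f x" and Mt: "\<And>x. x \<in> E \<Longrightarrow> emax f x \<le> ennreal t"
  shows "vol E = 0"
proof -
  have "vol E \<le> vol (cube a l)"
    by (intro emeasure_mono sub) auto
  also have "\<dots> < top" using l by (rule emeasure_cube_finite)
  finally obtain m where m: "vol E = ennreal m" "0 \<le> m"
    by (cases "vol E") auto
  have key: "s * m \<le> t * (m + e)" if e: "0 < e" for e
  proof -
    obtain U where U: "open U" "E \<subseteq> U" "(U - E) \<in> lmeasurable" "vol (U - E) < ennreal e"
      using sets_lebesgue_outer_open[OF E e] by metis
    have Us [measurable]: "U \<in> sets lebesgue" using borel_open[OF U(1)] by simp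
    let ?g = "\<lambda>x. if x \<in> U then U else UNIV"
    have gauge: "gauge ?g" using U(1) by (auto simp: gauge_def)
    have ne: "box a (\<chi> i. a $ i + l) \<noteq> {}" using l by (auto simp: interval_ne_empty_cart)
    obtain D where D: "countable D" "\<Union>D \<subseteq> cbox a (\<chi> i. a $ i + l)"
      "\<And>K. K \<in> D \<Longrightarrow> interior K \<noteq> {} \<and> (\<exists>c d. K = cbox c d)"
      "pairwise (\<lambda>A B. interior A \<inter> interior B = {}) D"
      "\<And>K. K \<in> D \<Longrightarrow> \<exists>x \<in> E \<inter> K. K \<subseteq> ?g x"
      "\<And>u v. cbox u v \<in> D \<Longrightarrow> \<exists>n. \<forall>i \<in> Basis. v \<bullet> i - u \<bullet> i = ((\<chi> i. a $ i + l) \<bullet> i - a \<bullet> i) / 2^n"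
      "E \<subseteq> \<Union>D"
      using covering_lemma[OF sub[unfolded cube_def] ne gauge] by metis
    have DK: "\<exists>c k. K = cube c k \<and> 0 < k" if K: "K \<in> D" for K
    proof -
      obtain c d where cd: "K = cbox c d" using D(3)[OF K] by blast
      then obtain n where n: "\<forall>i\<in>Basis. d \<bullet> i - c \<bullet> i = ((\<chi> i. a $ i + l) \<bullet> i - a \<bullet> i) / 2^n"
        using D(6) K by blast
      have "d $ i = c $ i + l / 2 ^ n" for i
        using n[rule_format, of "axis i 1"] by (simp add: inner_axis)
      then have "d = (\<chi> i. c $ i + l / 2 ^ n)" by (simp add: vec_eq_iff)
      then show ?thesis using cd l by (intro exI[of _ c] exI[of _ "l / 2 ^ n"]) (auto simp: cube_def)
    qed
    have intK: "vol (interior K) = vol K" if "K \<in> D" for K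
      using D(3)[OF that] by (auto simp: emeasure_completion emeasure_lborel_box_eq emeasure_lborel_cbox_eq)
    have [measurable]: "K \<in> sets lebesgue" if "K \<in> D" for K
      using DK[OF that] by auto
    have KU: "K \<subseteq> U" if "K \<in> D" for K
      using D(5)[OF that] U(2) by (auto split: if_splits)
    have Kf: "mass f K \<le> ennreal t * vol K" if K: "K \<in> D" for K
    proof -
      obtain c k where ck: "K = cube c k" "0 < k" using DK[OF K] by blast
      obtain x where x: "x \<in> E" "x \<in> K" using D(5)[OF K] by blast
      have "mass f K \<le> emax f x * vol K"
        using ck x emax_upper by blast
      also have "\<dots> \<le> ennreal t * vol K"
        by (intro mult_right_mono Mt x) auto
      finally show ?thesis .
    qed
    have "ennreal s * vol E = (\<integral>\<^sup>+x. ennreal s * indicator E x \<partial>lebesgue)"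
      by (simp add: nn_integral_cmult_indicator)
    also have "\<dots> \<le> (\<integral>\<^sup>+x. (\<integral>\<^sup>+K. f x * indicator K x \<partial>count_space D) \<partial>lebesgue)"
    proof (intro nn_integral_mono)
      fix x
      show "ennreal s * indicator E x \<le> (\<integral>\<^sup>+K. f x * indicator K x \<partial>count_space D)"
      proof (cases "x \<in> E")
        case True
        then obtain K where K: "K \<in> D" "x \<in> K" using D(7) by blast
        have "ennreal s * indicator E x \<le> f x * indicator K x" using fs True K by simp
        also have "\<dots> \<le> (\<integral>\<^sup>+K. f x * indicator K x \<partial>count_space D)"
          by (rule nn_integral_ge_point[OF K(1)])
        finally show ?thesis .
      qed simp
    qed
    also have "\<dots> = (\<integral>\<^sup>+K. (\<integral>\<^sup>+x. f x * indicator K x \<partial>lebesgue) \<partial>count_space D)"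
      by (rule nn_integral_count_space_nn_integral[OF D(1)]) auto
    also have "\<dots> \<le> (\<integral>\<^sup>+K. ennreal t * vol (interior K) \<partial>count_space D)"
      using Kf intK by (intro nn_integral_mono) auto
    also have "\<dots> = ennreal t * (\<integral>\<^sup>+K. vol (interior K) \<partial>count_space D)"
      by (intro nn_integral_cmult) auto
    also have "(\<integral>\<^sup>+K. vol (interior K) \<partial>count_space D) = vol (\<Union>K\<in>D. interior K)"
      using D(1,4) by (intro emeasure_UN_countable[symmetric]) (auto simp: disjoint_family_on_def pairwise_def)
    also have "vol (\<Union>K\<in>D. interior K) \<le> vol U"
    proof (rule emeasure_mono[OF _ Us])
      show "(\<Union>K\<in>D. interior K) \<subseteq> U" using KU interior_subset by blast
    qed
    also have "vol U \<le> vol E + vol (U - E)"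
      using U(2) emeasure_subadditive[of E lebesgue "U - E"] by (simp add: Un_absorb1)
    also have "\<dots> \<le> ennreal m + ennreal e"
      using U(4) m by (intro add_mono) auto
    finally have "ennreal (s * m) \<le> ennreal (t * (m + e))"
      using m ts e by (simp add: ennreal_mult' mult_left_mono flip: ennreal_plus)
    then show ?thesis using ts m e by (subst (asm) ennreal_le_iff) auto
  qed
  have "m = 0"
  proof (rule ccontr)
    assume "m \<noteq> 0"
    then have mp: "0 < m" using m by simp
    \<comment> \<open>chosen so that \<open>t * e < (s - t) * m\<close>; the denominator allows \<open>t = 0\<close>\<close>
    define e where "e = (s - t) * m / (t + 1)"
    have e: "0 < e" unfolding e_def using mp ts by (intro divide_pos_pos mult_pos_pos) auto
    have "t * e < (t + 1) * e" using e by simp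
    also have "\<dots> = (s - t) * m" using ts by (simp add: e_def)
    finally show False using key[OF e] by (simp add: algebra_simps)
  qed
  then show ?thesis using m by simp
qed

lemma mem_centered_cube:
  fixes x :: "real ^ 'n::finite"
  assumes "norm x \<le> real m"
  shows "x \<in> cube (\<chi> i. - real m) (2 * real m + 1)"
proof -
  have "- real m \<le> x $ i \<and> x $ i \<le> - real m + (2 * real m + 1)" for i
    using component_le_norm_cart[of x i] assms by (simp add: abs_le_iff)
  then show ?thesis by (simp add: mem_cube)
qed

text \<open>
The points where the inequality fails form a countable union of null sets of the preceding kind.
\<close>

lemma le_emax:
  fixes f :: "real ^ 'n::finite \<Rightarrow> ennreal"
  assumes [measurable]: "f \<in> meas"
  shows "AE x in lebesgue. f x \<le> emax f x"
proof -
  define c where "c m = ((\<chi> i. - real m) :: real ^ 'n)" for m :: nat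
  define E where "E q r m = {x \<in> cube (c m) (2 * real m + 1). ennreal (of_rat r) \<le> f x \<and> emax f x \<le> ennreal (of_rat q)}" for q r m
  have "vol (E q r m) = 0" if "0 < q" "q < r" for q r m
  proof (rule null_set_of_small_averages[where f = f and s = "of_rat r" and t = "of_rat q"])
    show "E q r m \<in> sets lebesgue" unfolding E_def by measurable
    show "E q r m \<subseteq> cube (c m) (2 * real m + 1)" by (auto simp: E_def)
  qed (use that in \<open>auto simp: E_def of_rat_less\<close>)
  then have "E q r m \<in> null_sets lebesgue" if "0 < q" "q < r" for q r m
    using that unfolding null_sets_def E_def by auto
  then have "AE x in lebesgue. \<forall>q r m. 0 < q \<longrightarrow> q < r \<longrightarrow> x \<notin> E q r m"
    by (intro AE_all_countable[THEN iffD2] allI AE_impI AE_not_in)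
  then show ?thesis
  proof eventually_elim
    case (elim x)
    show ?case
    proof (rule ccontr)
      assume "\<not> f x \<le> emax f x"
      then have "emax f x < f x" by simp
      then obtain r where r: "emax f x < ennreal (of_rat r)" "ennreal (of_rat r) < f x"
        using ennreal_rat_dense by blast
      then obtain q where q: "emax f x < ennreal (of_rat q)" "ennreal (of_rat q) < ennreal (of_rat r)"
        using ennreal_rat_dense by blast
      have "0 < (of_rat q :: real)" using q(1) by (metis ennreal_neg not_less_zero not_less)
      then have qr: "0 < q" "q < r" using q(2)
        by (auto simp: ennreal_less_iff of_rat_less)
      obtain m :: nat where m: "norm x \<le> real m" using real_arch_simple by blast
      have "x \<in> cube (c m) (2 * real m + 1)" unfolding c_def by (rule mem_centered_cube[OF m])
      then have "x \<in> E q r m" using q r by (simp add: E_def less_imp_le)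
      with elim qr show False by blast
    qed
  qed
qed

section \<open>The reverse weak type inequality\<close>

text \<open>
Starting from a cube with average above \<open>t\<close>, triple it until the average drops to \<open>t\<close> or below; this
happens since \<open>v\<close> is integrable. The level set is therefore the union of the last cubes before the drop, and
for such a cube the mass of the triple is at most \<open>3\<^sup>n t\<close> times the volume of the cube.
\<close>

lemma reverse_weak_type:
  fixes v :: "real ^ 'n::finite \<Rightarrow> ennreal"
  assumes [measurable]: "v \<in> meas" and fin: "(\<integral>\<^sup>+x. v x \<partial>lebesgue) < top" and t: "0 < t"
  shows "mass v {x. ennreal t < emax v x}
    \<le> ennreal (3 ^ CARD('n) * t) * vol {x. ennreal t < emax v x}"
proof -
  let ?hi = "\<lambda>a l. ennreal t * vol (cube a l) < mass v (cube a l)"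
  define S where "S = {(a, l)\<in>rcubes. ?hi a l \<and> mass v (tricube a l) \<le> ennreal t * vol (tricube a l)}"
  obtain I where I: "(\<integral>\<^sup>+x. v x \<partial>lebesgue) = ennreal I" "0 \<le> I"
    using fin by (cases "\<integral>\<^sup>+x. v x \<partial>lebesgue") auto
  have cS: "countable S"
    unfolding S_def by (rule countable_subset[OF _ countable_rcubes]) auto
  have sub1: "{x. ennreal t < emax v x} \<subseteq> (\<Union>(a, l)\<in>S. cube a l)"
  proof
    fix x assume "x \<in> {x. ennreal t < emax v x}"
    then obtain a l where al: "(a, l) \<in> rcubes" and lt: "ennreal t < mass v (cube a l) / vol (cube a l) * indicator (cube a l) x"
      by (auto simp: emax_eq_rcubes less_SUP_iff)
    then have x: "x \<in> cube a l" by (cases "x \<in> cube a l") auto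
    then have hi: "?hi a l"
      using lt emeasure_cube_pos[OF rcubes_pos[OF al], of a] emeasure_cube_finite[OF rcubes_pos[OF al], of a]
      by (simp add: less_divide_ennreal_iff)
    show "x \<in> (\<Union>(a, l)\<in>S. cube a l)"
    proof (rule ccontr)
      assume nx: "x \<notin> (\<Union>(a, l)\<in>S. cube a l)"
      have "\<exists>b. (b, 3 ^ k * l) \<in> rcubes \<and> x \<in> cube b (3 ^ k * l) \<and> ?hi b (3 ^ k * l)" for k
      proof (induction k)
        case 0
        show ?case using al x hi by auto
      next
        case (Suc k)
        then obtain b where b: "(b, 3 ^ k * l) \<in> rcubes" "x \<in> cube b (3 ^ k * l)" "?hi b (3 ^ k * l)" by blast
        let ?l = "3 ^ k * l"
        have "(b, ?l) \<notin> S" using nx b by auto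
        then have "?hi (\<chi> i. b $ i - ?l) (3 * ?l)"
          using b by (auto simp: S_def tricube_def not_le)
        moreover have "x \<in> cube (\<chi> i. b $ i - ?l) (3 * ?l)"
          using b cube_subset_tricube[of ?l b] rcubes_pos[OF b(1)] by (auto simp: tricube_def)
        moreover have "((\<chi> i. b $ i - ?l), 3 * ?l) \<in> rcubes"
          using b(1) by (auto simp: rcubes_def)
        ultimately show ?case by (intro exI[of _ "\<chi> i. b $ i - ?l"]) (simp add: mult.assoc)
      qed
      then have bound: "t * (3 ^ k * l) ^ CARD('n) \<le> I" for k
      proof -
        obtain b where b: "?hi b (3 ^ k * l)" "(b, 3 ^ k * l) \<in> rcubes"
          using \<open>\<And>k. \<exists>b. (b, 3 ^ k * l) \<in> rcubes \<and> x \<in> cube b (3 ^ k * l) \<and> ?hi b (3 ^ k * l)\<close> by blast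
        have "ennreal (t * (3 ^ k * l) ^ CARD('n)) = ennreal t * vol (cube b (3 ^ k * l))"
          using t rcubes_pos[OF b(2)] by (simp add: emeasure_cube ennreal_mult')
        also have "\<dots> \<le> mass v (cube b (3 ^ k * l))" using b by simp
        also have "\<dots> \<le> ennreal I" unfolding I(1)[symmetric]
          by (intro nn_integral_mono) (auto simp: indicator_def)
        finally show ?thesis using I by simp
      qed
      have l: "0 < l" using rcubes_pos[OF al] .
      obtain k where k: "(1 + I / t) / l < 3 ^ k" using real_arch_pow[of 3 "(1 + I / t) / l"] by auto
      then have kl: "1 + I / t < 3 ^ k * l" using l by (simp add: field_simps)
      have "3 ^ k * l \<le> (3 ^ k * l) ^ CARD('n)"
        using kl I t by (intro self_le_power) (auto intro: order_trans[of 1 "1 + I / t"])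
      with kl have "I / t < (3 ^ k * l) ^ CARD('n)" by linarith
      then have "I < t * (3 ^ k * l) ^ CARD('n)" using t by (simp add: field_simps)
      with bound[of k] show False by simp
    qed
  qed
  have sub2: "(\<Union>(a, l)\<in>S. cube a l) \<subseteq> {x. ennreal t < emax v x}"
  proof
    fix x assume "x \<in> (\<Union>(a, l)\<in>S. cube a l)"
    then obtain a l where al: "(a, l) \<in> rcubes" "x \<in> cube a l" "?hi a l" by (auto simp: S_def)
    have "ennreal t * vol (cube a l) < emax v x * vol (cube a l)"
      using al emax_upper[OF rcubes_pos[OF al(1)] al(2), of v] by (auto intro: less_le_trans)
    then show "x \<in> {x. ennreal t < emax v x}"
      by (metis (no_types, lifting) mem_Collect_eq mult_right_mono not_le zero_le)
  qed
  have eq: "{x. ennreal t < emax v x} = (\<Union>(a, l)\<in>S. cube a l)" using sub1 sub2 by (rule subset_antisym)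
  have "mass v (\<Union>(a, l)\<in>S. cube a l)
    \<le> ennreal (3 ^ CARD('n) * t) * mass (\<lambda>x. 1) (\<Union>(a, l)\<in>S. cube a l)"
  proof (rule cover_transfer[OF cS])
    fix a l assume "(a, l) \<in> S"
    then have al: "(a, l) \<in> rcubes" and le: "mass v (tricube a l) \<le> ennreal t * vol (tricube a l)"
      by (auto simp: S_def)
    show "mass v (tricube a l) \<le> ennreal (3 ^ CARD('n) * t) * mass (\<lambda>y. 1) (cube a l)"
      using le t rcubes_pos[OF al] by (simp add: emeasure_tricube ennreal_mult' mult_ac)
  qed auto
  also have "mass (\<lambda>x. 1) (\<Union>(a, l)\<in>S. cube a l) = vol {x. ennreal t < emax v x}"
  proof -
    have "{x \<in> space lebesgue. ennreal t < emax v x} \<in> sets lebesgue" by measurable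
    then have "{x. ennreal t < emax v x} \<in> sets lebesgue" by simp
    then show ?thesis unfolding eq[symmetric] by simp
  qed
  finally show ?thesis unfolding eq[symmetric] .
qed

section \<open>The reverse Hoelder inequality\<close>

text \<open>
A cube that meets \<open>cube a l\<close> and reaches outside its triple is larger than \<open>cube a l\<close>, so its average is
at most the average over \<open>cube a l\<close>.
\<close>

lemma emax_localized:
  assumes l: "0 < l" and x: "x \<notin> tricube a l" and [measurable]: "w \<in> meas"
    and t: "mass w (cube a l) \<le> c * vol (cube a l)"
  shows "emax (\<lambda>y. w y * indicator (cube a l) y) x \<le> c"
proof (rule emax_least_all)
  fix b :: "real ^ 'a" and k :: real assume k: "0 < k" and xb: "x \<in> cube b k"
  show "mass (\<lambda>y. (w y * indicator (cube a l) y)) (cube b k) \<le> c * vol (cube b k)"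
  proof (cases "cube b k \<inter> cube a l = {}")
    case True
    then have "mass (\<lambda>y. (w y * indicator (cube a l) y)) (cube b k) = (\<integral>\<^sup>+y. 0 \<partial>(lebesgue :: (real ^ 'a) measure))"
      by (intro nn_integral_cong) (auto simp: indicator_def)
    then show ?thesis by simp
  next
    case False
    then have "\<not> k \<le> l" using cube_subset_tricube_of_meet[OF False] x xb by auto
    then have "vol (cube a l) \<le> vol (cube b k)"
      using l by (auto simp: emeasure_cube intro!: ennreal_leI power_mono)
    moreover have "mass (\<lambda>y. (w y * indicator (cube a l) y)) (cube b k) \<le> mass w (cube a l)"
      by (intro nn_integral_mono) (auto simp: indicator_def)
    ultimately show ?thesis using t by (meson mult_left_mono order_trans zero_le)
  qed
qed

text \<open>
With \<open>v\<close> the restriction of \<open>w\<close> to the cube, bound \<open>epow w (1 + e)\<close> by \<open>v * epow (emax v) e\<close> and use the layer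
cake formula. Heights below the average \<open>m\<close> give the main term. Heights \<open>t \<ge> m\<close> are controlled by the reverse weak
type inequality; there the level sets lie in the triple, where \<open>emax v \<le> C * w\<close>. The gain is the factor \<open>e\<close>
in front of the second term.
\<close>

lemma A1_weight_reverse_Hoelder_step:
  fixes w :: "real ^ 'n::finite \<Rightarrow> ennreal"
  assumes w: "A1_weight C w" and l: "0 < l" and e: "0 < e" "e \<le> 1"
    and m: "mass w (cube a l) = ennreal m * vol (cube a l)" "0 < m"
  shows "mass (\<lambda>y. epow (w y) (1 + e)) (cube a l)
    \<le> ennreal (m powr (1 + e)) * vol (cube a l)
      + ennreal (3 ^ CARD('n) * e * C powr (1 + e)) * mass (\<lambda>y. epow (w y) (1 + e)) (tricube a l)"
proof -
  note [measurable] = A1_weight_measurable[OF w]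
  have C: "1 \<le> C" using w by (simp add: A1_weight_def)
  define v where "v y = w y * indicator (cube a l) y" for y
  have [measurable]: "v \<in> meas" unfolding v_def by measurable
  let ?F = "emax v" and ?V = "vol (cube a l)"
  let ?L = "\<lambda>t. {x. ennreal t < ?F x}"
  have Iv: "(\<integral>\<^sup>+x. v x \<partial>lebesgue) = ennreal m * ?V" using m by (simp add: v_def)
  have fin: "(\<integral>\<^sup>+x. v x \<partial>lebesgue) < top"
    unfolding Iv using emeasure_cube_finite[OF l, of a] by (simp add: ennreal_mult_less_top)
  have Lm [measurable]: "?L t \<in> sets lebesgue" for t
  proof -
    have "{x \<in> space lebesgue. ennreal t < ?F x} \<in> sets lebesgue" by measurable
    then show ?thesis by simp
  qed
  have [measurable]: "(\<lambda>t. mass (\<lambda>x. indicator (tricube a l) x) (?L t)) \<in> borel_measurable lborel"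
    by (rule mass_level_set_measurable) measurable
  have L: "?L t \<subseteq> tricube a l" if "m \<le> t" for t
  proof
    fix x assume x: "x \<in> ?L t"
    show "x \<in> tricube a l"
    proof (rule ccontr)
      assume nx: "x \<notin> tricube a l"
      have "?F x \<le> ennreal t" unfolding v_def
        using m that by (intro emax_localized[OF l nx]) (auto intro!: mult_right_mono ennreal_leI)
      with x show False by simp
    qed
  qed
  have "mass (\<lambda>y. epow (w y) (1 + e)) (cube a l) \<le> (\<integral>\<^sup>+x. v x * epow (?F x) e \<partial>lebesgue)"
  proof (rule nn_integral_mono_AE)
    show "AE x in lebesgue. epow (w x) (1 + e) * indicator (cube a l) x \<le> v x * epow (?F x) e"
      using le_emax[OF \<open>v \<in> meas\<close>]
    proof eventually_elim
      case (elim x)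
      show ?case
      proof (cases "x \<in> cube a l")
        case True
        then have "epow (w x) (1 + e) * indicator (cube a l) x = v x * epow (v x) e"
          using epow_add[of 1 e "w x"] e by (simp add: v_def)
        also have "\<dots> \<le> v x * epow (?F x) e"
          using elim e by (intro mult_left_mono epow_mono) auto
        finally show ?thesis .
      qed simp
    qed
  qed
  also have "\<dots> = (\<integral>\<^sup>+t\<in>{0<..}. ennreal (e * t powr (e - 1)) * mass v (?L t) \<partial>lborel)"
    using e by (intro layer_cake) auto
  also have "\<dots> \<le> (\<integral>\<^sup>+t. (\<integral>\<^sup>+x. v x \<partial>lebesgue) * (if 0 < t \<and> ennreal t < ennreal m then ennreal (e * t powr (e - 1)) else 0)
      + ennreal (3 ^ CARD('n) * e) * (ennreal ((1 + e) * t powr (1 + e - 1)) * mass (\<lambda>x. indicator (tricube a l) x) (?L t) * indicator {0<..} t) \<partial>lborel)"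
  proof (intro nn_integral_mono)
    fix t :: real
    show "ennreal (e * t powr (e - 1)) * mass v (?L t) * indicator {0<..} t
      \<le> (\<integral>\<^sup>+x. v x \<partial>lebesgue) * (if 0 < t \<and> ennreal t < ennreal m then ennreal (e * t powr (e - 1)) else 0)
      + ennreal (3 ^ CARD('n) * e) * (ennreal ((1 + e) * t powr (1 + e - 1)) * mass (\<lambda>x. indicator (tricube a l) x) (?L t) * indicator {0<..} t)"
    proof (cases "0 < t")
      case t: True
      show ?thesis
      proof (cases "t < m")
        case True
        have "mass v (?L t) \<le> (\<integral>\<^sup>+x. v x \<partial>lebesgue)"
          by (intro nn_integral_mono) (auto simp: indicator_def)
        from mult_left_mono[OF this, of "ennreal (e * t powr (e - 1))"] show ?thesis
          using True t by (simp add: ennreal_less_iff mult.commute add_increasing2)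
      next
        case False
        have "mass (\<lambda>x. indicator (tricube a l) x) (?L t) = (\<integral>\<^sup>+x. indicator (?L t) x \<partial>lebesgue)"
          using L[of t] False by (intro nn_integral_cong) (auto simp: indicator_def)
        also have "\<dots> = vol (?L t)" by simp
        finally have T: "mass (\<lambda>x. indicator (tricube a l) x) (?L t) = vol (?L t)" .
        have pw: "t powr (e - 1) * t = t powr e" using t powr_add[of t "e - 1" 1] by simp
        have "ennreal (e * t powr (e - 1)) * mass v (?L t)
          \<le> ennreal (e * t powr (e - 1)) * (ennreal (3 ^ CARD('n) * t) * vol (?L t))"
          by (intro mult_left_mono reverse_weak_type fin t) auto
        also have "\<dots> = ennreal (3 ^ CARD('n) * e * (t powr (e - 1) * t)) * vol (?L t)"
          using e by (subst ennreal_mult_assoc) (auto simp: mult_ac)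
        also have "\<dots> \<le> ennreal (3 ^ CARD('n) * e * ((1 + e) * t powr e)) * vol (?L t)"
          unfolding pw using e by (intro mult_right_mono ennreal_leI mult_left_mono) (auto simp: algebra_simps)
        also have "\<dots> = ennreal (3 ^ CARD('n) * e) * (ennreal ((1 + e) * t powr (1 + e - 1)) * mass (\<lambda>x. indicator (tricube a l) x) (?L t))"
          unfolding T using e by (subst ennreal_mult_assoc) (auto simp: mult_ac)
        finally show ?thesis using t by (simp add: add_increasing)
      qed
    qed simp
  qed
  also have "\<dots> = (\<integral>\<^sup>+t. (\<integral>\<^sup>+x. v x \<partial>lebesgue) * (if 0 < t \<and> ennreal t < ennreal m then ennreal (e * t powr (e - 1)) else 0) \<partial>lborel)
      + (\<integral>\<^sup>+t. ennreal (3 ^ CARD('n) * e) * (ennreal ((1 + e) * t powr (1 + e - 1)) * mass (\<lambda>x. indicator (tricube a l) x) (?L t) * indicator {0<..} t) \<partial>lborel)"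
    by (intro nn_integral_add) measurable
  also have "(\<integral>\<^sup>+t. ennreal (3 ^ CARD('n) * e) * (ennreal ((1 + e) * t powr (1 + e - 1)) * mass (\<lambda>x. indicator (tricube a l) x) (?L t) * indicator {0<..} t) \<partial>lborel)
     = ennreal (3 ^ CARD('n) * e) * (\<integral>\<^sup>+t\<in>{0<..}. ennreal ((1 + e) * t powr (1 + e - 1)) * mass (\<lambda>x. indicator (tricube a l) x) (?L t) \<partial>lborel)"
    by (intro nn_integral_cmult) measurable
  also have "(\<integral>\<^sup>+t\<in>{0<..}. ennreal ((1 + e) * t powr (1 + e - 1)) * mass (\<lambda>x. indicator (tricube a l) x) (?L t) \<partial>lborel)
     = (\<integral>\<^sup>+x. indicator (tricube a l) x * epow (?F x) (1 + e) \<partial>lebesgue)"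
    using e by (intro layer_cake[symmetric]) auto
  also have "(\<integral>\<^sup>+t. (\<integral>\<^sup>+x. v x \<partial>lebesgue) * (if 0 < t \<and> ennreal t < ennreal m then ennreal (e * t powr (e - 1)) else 0) \<partial>lborel)
     = (\<integral>\<^sup>+x. v x \<partial>lebesgue) * epow (ennreal m) e"
    unfolding epow_eq_integral[OF e(1)] by (intro nn_integral_cmult) measurable
  also have "(\<integral>\<^sup>+x. v x \<partial>lebesgue) * epow (ennreal m) e = ennreal (m powr (1 + e)) * ?V"
    unfolding Iv using m by (simp add: powr_add ennreal_mult' mult_ac)
  also have "(\<integral>\<^sup>+x. indicator (tricube a l) x * epow (?F x) (1 + e) \<partial>lebesgue)
     \<le> (\<integral>\<^sup>+x. ennreal (C powr (1 + e)) * (epow (w x) (1 + e) * indicator (tricube a l) x) \<partial>lebesgue)"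
  proof (rule nn_integral_mono_AE)
    have "AE x in lebesgue. emax w x \<le> ennreal C * w x" using w by (simp add: A1_weight_def)
    then show "AE x in lebesgue. indicator (tricube a l) x * epow (?F x) (1 + e)
       \<le> ennreal (C powr (1 + e)) * (epow (w x) (1 + e) * indicator (tricube a l) x)"
    proof eventually_elim
      case (elim x)
      have "?F x \<le> emax w x" by (intro emax_mono_AE) (auto simp: v_def indicator_def)
      then have "epow (?F x) (1 + e) \<le> epow (ennreal C * w x) (1 + e)"
        using elim e by (intro epow_mono) auto
      also have "\<dots> = ennreal (C powr (1 + e)) * epow (w x) (1 + e)"
        using C by (simp add: epow_mult)
      finally show ?case by (auto simp: indicator_def)
    qed
  qed
  also have "\<dots> = ennreal (C powr (1 + e)) * mass (\<lambda>x. epow (w x) (1 + e)) (tricube a l)"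
    by (intro nn_integral_cmult) measurable
  also have "ennreal (3 ^ CARD('n) * e) * \<dots> = ennreal (3 ^ CARD('n) * e * C powr (1 + e)) * mass (\<lambda>y. epow (w y) (1 + e)) (tricube a l)"
    using e by (subst ennreal_mult_assoc) auto
  finally show ?thesis by (simp add: add_left_mono mult_left_mono)
qed

lemma A1_weight_truncate:
  assumes w: "A1_weight C w" and N: "0 < N"
  shows "A1_weight C (\<lambda>x. min (w x) (ennreal N))"
proof -
  note [measurable] = A1_weight_measurable[OF w]
  have C: "1 \<le> C" using w by (simp add: A1_weight_def)
  have "emax (\<lambda>x. min (w x) (ennreal N)) x \<le> ennreal C * min (w x) (ennreal N)" if x: "emax w x \<le> ennreal C * w x" for x
  proof (cases "w x \<le> ennreal N")
    case True
    have "emax (\<lambda>x. min (w x) (ennreal N)) x \<le> emax w x" by (intro emax_mono_AE) auto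
    then show ?thesis using x True by (simp add: min_absorb1)
  next
    case False
    have "emax (\<lambda>x. min (w x) (ennreal N)) x \<le> ennreal N"
    proof (rule emax_least_all)
      fix a :: "real ^ 'a" and l :: real
      have "mass (\<lambda>y. min (w y) (ennreal N)) (cube a l) \<le> (\<integral>\<^sup>+y. ennreal N * indicator (cube a l) y \<partial>lebesgue)"
        by (intro nn_integral_mono mult_right_mono) auto
      then show "mass (\<lambda>y. min (w y) (ennreal N)) (cube a l) \<le> ennreal N * vol (cube a l)"
        by (simp add: nn_integral_cmult_indicator)
    qed
    also have "\<dots> \<le> ennreal C * ennreal N"
      using C mult_right_mono[of 1 "ennreal C" "ennreal N"] by simp
    finally show ?thesis using False by (simp add: min_absorb2)
  qed
  moreover have "AE x in lebesgue. emax w x \<le> ennreal C * w x" using w by (simp add: A1_weight_def)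
  ultimately have "AE x in lebesgue. emax (\<lambda>x. min (w x) (ennreal N)) x \<le> ennreal C * min (w x) (ennreal N)"
    by (auto elim!: eventually_mono)
  then show ?thesis
    using w N by (auto simp: A1_weight_def min_less_iff_disj)
qed

text \<open>
Let \<open>J a l\<close> be the mass of \<open>epow w (1 + e)\<close>. By \<open>A1_weight_reverse_Hoelder_step\<close> it is at most
\<open>m powr (1 + e) * vol\<close> plus a small multiple of the mass over the triple, whose average is comparable to \<open>m\<close> by the
doubling property. Iterating over successive triples sums a geometric series for the main term, and the remainder after
\<open>k\<close> steps is at most \<open>N powr (1 + e) / 2 ^ k\<close> times the volume. Boundedness of \<open>w\<close> only starts the iteration: neither
the constant nor the range of \<open>e\<close> depends on \<open>N\<close>.
\<close>

lemma reverse_Hoelder_bounded: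
  fixes w :: "real ^ 'n::finite \<Rightarrow> ennreal"
  assumes w: "A1_weight C w" and bd: "\<And>x. w x \<le> ennreal N" and N: "0 \<le> N"
    and e: "0 < e" "e \<le> 1" "2 * 9 ^ CARD('n) * C ^ 4 * e \<le> 1"
    and l: "0 < l" and m: "0 < m" "mass w (cube a l) \<le> ennreal m * vol (cube a l)"
  shows "mass (\<lambda>y. epow (w y) (1 + e)) (cube a l) \<le> ennreal (2 * m powr (1 + e)) * vol (cube a l)"
proof -
  note [measurable] = A1_weight_measurable[OF w]
  have C: "1 \<le> C" using w by (simp add: A1_weight_def)
  define J where "J a l = mass (\<lambda>y. epow (w y) (1 + e)) (cube a l)" for a l
  define M where "M = N powr (1 + e)"
  let ?c = "3 ^ CARD('n) * e * C powr (1 + e)"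
  have c: "?c * (3 ^ CARD('n) * C powr (1 + e)) \<le> 1 / 2"
  proof -
    have "C powr (1 + e) \<le> C powr 2" using C e by (intro powr_mono) auto
    then have C2: "C powr (1 + e) \<le> C ^ 2" using C by simp
    have n9: "(3::real) ^ CARD('n) * 3 ^ CARD('n) = 9 ^ CARD('n)"
      by (simp add: power_mult_distrib[symmetric])
    have "?c * (3 ^ CARD('n) * C powr (1 + e)) = 9 ^ CARD('n) * e * (C powr (1 + e) * C powr (1 + e))"
      unfolding n9[symmetric] by (simp add: mult_ac)
    also have "\<dots> \<le> 9 ^ CARD('n) * e * (C ^ 2 * C ^ 2)"
      using C2 C e by (intro mult_left_mono mult_mono) auto
    also have "\<dots> \<le> 1 / 2" using e(3) by (simp add: power_add[symmetric] mult_ac)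
    finally show ?thesis .
  qed
  have claim: "J a l \<le> ennreal (2 * m powr (1 + e) + M / 2 ^ k) * vol (cube a l)"
    if "0 < l" "mass w (cube a l) = ennreal m * vol (cube a l)" "0 < m" for a l m k
    using that
  proof (induction k arbitrary: a l m)
    case 0
    have "J a l \<le> (\<integral>\<^sup>+y. ennreal M * indicator (cube a l) y \<partial>lebesgue)"
      unfolding J_def M_def using e N
      by (intro nn_integral_mono mult_right_mono) (auto intro!: order_trans[OF epow_mono[OF bd]])
    also have "\<dots> = ennreal M * vol (cube a l)" by (simp add: nn_integral_cmult_indicator)
    also have "\<dots> \<le> ennreal (2 * m powr (1 + e) + M / 2 ^ 0) * vol (cube a l)"
      by (intro mult_right_mono ennreal_leI) auto
    finally show ?case .
  next
    case (Suc k)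
    let ?b = "\<chi> i. a $ i - l"
    have l3: "0 < 3 * l" using Suc.prems by simp
    obtain m' where m': "0 < m'" "mass w (cube ?b (3 * l)) = ennreal m' * vol (cube ?b (3 * l))"
      by (rule A1_weight_average[OF w l3]) (rule that)
    have tV: "vol (cube ?b (3 * l)) = ennreal (3 ^ CARD('n)) * vol (cube a l)"
      using emeasure_tricube[OF Suc.prems(1), of a] by (simp add: tricube_def)
    have "ennreal m' * vol (cube ?b (3 * l)) \<le> ennreal (C * 3 ^ CARD('n)) * (ennreal m * vol (cube a l))"
      using A1_weight_doubling[OF w Suc.prems(1), of a] m'(2) Suc.prems(2) by (simp add: tricube_def)
    also have "\<dots> = ennreal (C * m) * vol (cube ?b (3 * l))"
      unfolding tV using C by (simp add: ennreal_mult' mult_ac)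
    finally have "ennreal m' \<le> ennreal (C * m)"
      using emeasure_cube_pos[OF l3, of ?b] emeasure_cube_finite[OF l3, of ?b]
      by (subst (asm) (1 2) mult.commute, subst (asm) ennreal_mult_le_mult_iff) auto
    then have "m' \<le> C * m" using C Suc.prems(3) by (subst (asm) ennreal_le_iff) auto
    then have "m' powr (1 + e) \<le> (C * m) powr (1 + e)" using m' e by (intro powr_mono2) auto
    then have tA: "m' powr (1 + e) \<le> C powr (1 + e) * m powr (1 + e)" by (simp add: powr_mult)
    let ?R = "2 * m' powr (1 + e) + M / 2 ^ k"
    have R: "0 \<le> ?R" by (simp add: M_def)
    have "J a l \<le> ennreal (m powr (1 + e)) * vol (cube a l) + ennreal ?c * J ?b (3 * l)"
      using A1_weight_reverse_Hoelder_step[OF w Suc.prems(1) e(1,2) Suc.prems(2,3)]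
      by (simp add: J_def tricube_def)
    also have "J ?b (3 * l) \<le> ennreal ?R * (ennreal (3 ^ CARD('n)) * vol (cube a l))"
      using Suc.IH[OF l3 m'(2,1)] by (simp only: tV)
    also have "ennreal ?c * (ennreal ?R * (ennreal (3 ^ CARD('n)) * vol (cube a l))) = ennreal (?c * (?R * 3 ^ CARD('n))) * vol (cube a l)"
    proof -
      have c0: "0 \<le> ?c" using e C by simp
      show ?thesis by (simp only: ennreal_mult_assoc[OF R] ennreal_mult_assoc[OF c0])
    qed
    also have "ennreal (m powr (1 + e)) * vol (cube a l) + ennreal (?c * (?R * 3 ^ CARD('n))) * vol (cube a l)
      = ennreal (m powr (1 + e) + ?c * (?R * 3 ^ CARD('n))) * vol (cube a l)"
    proof -
      have "0 \<le> ?c * (?R * 3 ^ CARD('n))" using R e C by (intro mult_nonneg_nonneg) auto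
      then show ?thesis by (subst ennreal_plus) (auto simp only: distrib_right powr_ge_zero)
    qed
    also have "\<dots> \<le> ennreal (2 * m powr (1 + e) + M / 2 ^ Suc k) * vol (cube a l)"
    proof (intro mult_right_mono ennreal_leI)
      have Cp: "1 \<le> C powr (1 + e)" using C e by (intro ge_one_powr_ge_zero) auto
      have M0: "0 \<le> M / 2 ^ k" by (simp add: M_def)
      have "M / 2 ^ k \<le> C powr (1 + e) * (M / 2 ^ k)" using mult_right_mono[OF Cp M0] by simp
      then have "?R \<le> C powr (1 + e) * (2 * m powr (1 + e) + M / 2 ^ k)"
        using tA unfolding distrib_left by linarith
      then have "?c * (?R * 3 ^ CARD('n)) \<le> ?c * ((C powr (1 + e) * (2 * m powr (1 + e) + M / 2 ^ k)) * 3 ^ CARD('n))"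
        using e by (intro mult_left_mono mult_right_mono) auto
      also have "\<dots> = ?c * (3 ^ CARD('n) * C powr (1 + e)) * (2 * m powr (1 + e) + M / 2 ^ k)"
        by (simp only: mult_ac)
      also have "\<dots> \<le> 1 / 2 * (2 * m powr (1 + e) + M / 2 ^ k)"
        using M0 by (intro mult_right_mono c) auto
      finally have half: "?c * (?R * 3 ^ CARD('n)) \<le> 1 / 2 * (2 * m powr (1 + e) + M / 2 ^ k)" .
      have eq: "2 * m powr (1 + e) + M / 2 ^ Suc k = m powr (1 + e) + 1 / 2 * (2 * m powr (1 + e) + M / 2 ^ k)"
        by (simp add: field_simps)
      show "m powr (1 + e) + ?c * (?R * 3 ^ CARD('n)) \<le> 2 * m powr (1 + e) + M / 2 ^ Suc k"
        unfolding eq by (rule add_left_mono[OF half])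
    qed auto
    finally show ?case by (simp add: add_left_mono mult_left_mono)
  qed
  obtain m0 where m0: "0 < m0" "mass w (cube a l) = ennreal m0 * vol (cube a l)"
    by (rule A1_weight_average[OF w l]) (rule that)
  note V = emeasure_cube_pos[OF l, of a] emeasure_cube_finite[OF l, of a]
  have "ennreal m0 \<le> ennreal m"
    using m(2) V unfolding m0(2) by (subst (asm) (1 2) mult.commute, subst (asm) ennreal_mult_le_mult_iff) auto
  then have "m0 \<le> m" using m by simp
  have "J a l / vol (cube a l) \<le> ennreal (2 * m0 powr (1 + e))"
  proof (rule ennreal_le_epsilon)
    fix d :: real assume d: "0 < d"
    obtain k where "M / d < 2 ^ k" using real_arch_pow[of 2 "M / d"] by auto
    then have k: "M / 2 ^ k \<le> d" using d by (simp add: field_simps)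
    have "J a l / vol (cube a l) \<le> ennreal (2 * m0 powr (1 + e) + M / 2 ^ k)"
      using claim[OF l m0(2,1), of k] V by (simp only: divide_le_ennreal_iff)
    also have "\<dots> \<le> ennreal (2 * m0 powr (1 + e) + d)" using k by (intro ennreal_leI) simp
    also have "\<dots> = ennreal (2 * m0 powr (1 + e)) + ennreal d" using d by (intro ennreal_plus) auto
    finally show "J a l / vol (cube a l) \<le> ennreal (2 * m0 powr (1 + e)) + ennreal d" .
  qed
  also have "\<dots> \<le> ennreal (2 * m powr (1 + e))"
    using m0 \<open>m0 \<le> m\<close> e by (intro ennreal_leI mult_left_mono powr_mono2) auto
  finally show ?thesis using V by (simp only: divide_le_ennreal_iff J_def)
qed

text \<open>
The truncations \<open>min w N\<close> satisfy the \<open>A\<^sub>1\<close> condition with the same constant, so \<open>reverse_Hoelder_bounded\<close> holds for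
them uniformly in \<open>N\<close>, and monotone convergence gives it for \<open>w\<close>. Combined with the \<open>A\<^sub>1\<close> condition, the reverse
Hoelder inequality says that a small power above 1 of \<open>w\<close> is again an \<open>A\<^sub>1\<close> weight.
\<close>

lemma A1_weight_power:
  assumes C: "1 \<le> C"
  obtains r0 where "1 < r0" "\<And>(w :: real ^ 'n::finite \<Rightarrow> ennreal) r. A1_weight C w \<Longrightarrow> 1 < r \<Longrightarrow> r \<le> r0 \<Longrightarrow>
    A1_weight (2 * C powr r) (\<lambda>x. epow (w x) r)"
proof
  define e0 where "e0 = 1 / (2 * 9 ^ CARD('n) * C ^ 4)"
  have e0: "0 < e0" using C by (simp add: e0_def)
  have "1 * 1 \<le> (2 * 9 ^ CARD('n)) * C ^ 4"
    using C by (intro mult_mono one_le_power) (auto intro: order_trans[OF one_le_power[of 9 "CARD('n)"]])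
  then have e01: "e0 \<le> 1" unfolding e0_def by (subst divide_le_eq_1_pos) linarith+
  show "1 < 1 + e0" using e0 by simp
  fix w :: "real ^ 'n \<Rightarrow> ennreal" and r
  assume w: "A1_weight C w" and r: "1 < r" "r \<le> 1 + e0"
  note [measurable] = A1_weight_measurable[OF w]
  define e where "e = r - 1"
  have e: "0 < e" "e \<le> 1" and re: "r = 1 + e" using r e01 by (auto simp: e_def)
  have "2 * 9 ^ CARD('n) * C ^ 4 * e \<le> 2 * 9 ^ CARD('n) * C ^ 4 * e0"
    using r C by (intro mult_left_mono) (auto simp: e_def)
  also have "\<dots> = 1" using C by (simp add: e0_def)
  finally have e3: "2 * 9 ^ CARD('n) * C ^ 4 * e \<le> 1" .
  have RH: "mass (\<lambda>y. epow (w y) r) (cube a l) \<le> ennreal (2 * m powr r) * vol (cube a l)"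
    if l: "0 < l" and m: "0 < m" "mass w (cube a l) = ennreal m * vol (cube a l)" for a l m
  proof -
    let ?w = "\<lambda>k y. min (w y) (ennreal (real (Suc k)))"
    have trunc: "mass (\<lambda>y. epow (?w k y) r) (cube a l) \<le> ennreal (2 * m powr r) * vol (cube a l)" for k
      unfolding re
    proof (rule reverse_Hoelder_bounded[where N = "real (Suc k)", OF A1_weight_truncate[OF w] _ _ e e3 l m(1)])
      show "mass (?w k) (cube a l) \<le> ennreal m * vol (cube a l)"
        unfolding m(2)[symmetric] by (intro nn_integral_mono mult_right_mono) auto
    qed auto
    have sup: "epow (w y) r * indicator (cube a l) y = (SUP k. epow (?w k y) r * indicator (cube a l) y)" for y
    proof -
      have "w y \<le> (SUP k. ?w k y)"
      proof (rule ccontr)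
        assume "\<not> ?thesis"
        then have lt: "(SUP k. ?w k y) < w y" by simp
        then obtain c where c: "(SUP k. ?w k y) < ennreal c" "ennreal c < w y"
          using dense[OF lt] by (metis ennreal_cases less_top_ennreal not_less_iff_gr_or_eq top.not_eq_extremum)
        obtain k :: nat where k: "c \<le> real k" using real_arch_simple by blast
        have "ennreal c \<le> ?w k y"
          using k by (intro min.boundedI less_imp_le[OF c(2)] ennreal_leI) simp
        also have "\<dots> \<le> (SUP k. ?w k y)" by (rule SUP_upper) simp
        finally show False using c(1) by simp
      qed
      moreover have "(SUP k. ?w k y) \<le> w y" by (intro SUP_least) auto
      ultimately have "w y = (SUP k. ?w k y)" by simp
      then have "epow (w y) r = (SUP k. epow (?w k y) r)"
        using epow_SUP[of r] r by (metis less_trans zero_less_one)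
      then show ?thesis by (simp add: SUP_mult_right_ennreal)
    qed
    have "mass (\<lambda>y. epow (w y) r) (cube a l) = (\<integral>\<^sup>+y. (SUP k. epow (?w k y) r * indicator (cube a l) y) \<partial>lebesgue)"
      by (intro nn_integral_cong sup)
    also have "\<dots> = (SUP k. mass (\<lambda>y. epow (?w k y) r) (cube a l))"
      using r by (intro nn_integral_monotone_convergence_SUP)
        (auto simp: incseq_def le_fun_def intro!: mult_right_mono epow_mono min.mono ennreal_leI)
    also have "\<dots> \<le> ennreal (2 * m powr r) * vol (cube a l)" by (intro SUP_least trunc)
    finally show ?thesis .
  qed
  have ae: "AE x in lebesgue. emax w x \<le> ennreal C * w x" and pos: "AE x in lebesgue. 0 < w x \<and> w x < top"
    using w by (auto simp: A1_weight_def)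
  have "AE x in lebesgue. emax (\<lambda>x. epow (w x) r) x \<le> ennreal (2 * C powr r) * epow (w x) r"
    using ae
  proof eventually_elim
    case (elim x)
    show ?case
    proof (rule emax_least_all)
      fix a :: "real ^ 'n" and l :: real assume l: "0 < l" and xa: "x \<in> cube a l"
      note V = emeasure_cube_pos[OF l, of a] emeasure_cube_finite[OF l, of a]
      obtain m where m: "0 < m" "mass w (cube a l) = ennreal m * vol (cube a l)" "mass w (cube a l) / vol (cube a l) = ennreal m"
        by (rule A1_weight_average[OF w l]) (rule that)
      have "ennreal m \<le> emax w x"
        unfolding m(3)[symmetric] using emax_upper[OF l xa] V by (simp add: divide_le_ennreal_iff)
      also note elim
      finally have "epow (ennreal m) r \<le> epow (ennreal C * w x) r" using r by (intro epow_mono) auto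
      then have "ennreal (m powr r) \<le> ennreal (C powr r) * epow (w x) r"
        using m C by (simp add: epow_mult)
      then have "ennreal 2 * ennreal (m powr r) \<le> ennreal 2 * (ennreal (C powr r) * epow (w x) r)"
        by (intro mult_left_mono) auto
      then have "ennreal (2 * m powr r) \<le> ennreal (2 * C powr r) * epow (w x) r"
        by (simp add: ennreal_mult' mult.assoc)
      from order_trans[OF RH[OF l m(1,2)] mult_right_mono[OF this]]
      show "mass (\<lambda>y. epow (w y) r) (cube a l) \<le> ennreal (2 * C powr r) * epow (w x) r * vol (cube a l)" by simp
    qed
  qed
  moreover have "1 \<le> C powr r" using C r by (intro ge_one_powr_ge_zero) auto
  ultimately show "A1_weight (2 * C powr r) (\<lambda>x. epow (w x) r)"
    unfolding A1_weight_def using pos by auto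
qed

section \<open>Function norms and the Rubio de Francia algorithm\<close>

text \<open>
The properties shared by the norm of a Banach function space (extended by \<open>\<infinity>\<close>), its dual norm and its
concavifications. The axiom \<open>sup\<close> is the Fatou property; \<open>finite_AE\<close> says that a function in the space is
finite almost everywhere.
\<close>

locale function_norm =
  fixes N :: "(real ^ 'n::finite \<Rightarrow> ennreal) \<Rightarrow> ennreal"
  assumes mono: "\<And>f g. f \<in> meas \<Longrightarrow> g \<in> meas \<Longrightarrow> AE x in lebesgue. f x \<le> g x \<Longrightarrow> N f \<le> N g"
    and scale: "\<And>f c. f \<in> meas \<Longrightarrow> 0 < c \<Longrightarrow> N (\<lambda>x. ennreal c * f x) \<le> ennreal c * N f"
    and add: "\<And>f g. f \<in> meas \<Longrightarrow> g \<in> meas \<Longrightarrow> N (\<lambda>x. f x + g x) \<le> N f + N g"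
    and sup: "\<And>f. (\<And>n::nat. f n \<in> meas) \<Longrightarrow> (\<And>x. incseq (\<lambda>n. f n x)) \<Longrightarrow> N (\<lambda>x. SUP n. f n x) \<le> (SUP n. N (f n))"
    and zero: "N (\<lambda>x. 0) = 0"
    and finite_AE: "\<And>f. f \<in> meas \<Longrightarrow> N f < top \<Longrightarrow> AE x in lebesgue. f x < top"
begin

lemma mono': "f \<in> meas \<Longrightarrow> g \<in> meas \<Longrightarrow> (\<And>x. f x \<le> g x) \<Longrightarrow> N f \<le> N g"
  by (rule mono) auto

lemma sum_le: "(\<And>n::nat. f n \<in> meas) \<Longrightarrow> N (\<lambda>x. \<Sum>k<n. f k x) \<le> (\<Sum>k<n. N (f k))"
proof (induction n)
  case (Suc n)
  then have "N (\<lambda>x. (\<Sum>k<n. f k x) + f n x) \<le> N (\<lambda>x. \<Sum>k<n. f k x) + N (f n)"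
    by (intro add) auto
  also have "\<dots> \<le> (\<Sum>k<n. N (f k)) + N (f n)" using Suc by (intro add_right_mono) auto
  finally show ?case by simp
qed (simp add: zero)

lemma countably_subadditive:
  assumes [measurable]: "\<And>n::nat. f n \<in> meas"
  shows "N (\<lambda>x. \<Sum>n. f n x) \<le> (\<Sum>n. N (f n))"
proof -
  have "N (\<lambda>x. \<Sum>n. f n x) = N (\<lambda>x. SUP n. \<Sum>k<n. f k x)"
    by (simp add: suminf_eq_SUP)
  also have "\<dots> \<le> (SUP n. N (\<lambda>x. \<Sum>k<n. f k x))"
    by (intro sup) (auto simp: incseq_def intro!: sum_mono2)
  also have "\<dots> \<le> (SUP n. \<Sum>k<n. N (f k))"
    by (intro SUP_subset_mono sum_le) auto
  also have "\<dots> = (\<Sum>n. N (f n))" by (simp add: suminf_eq_SUP)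
  finally show ?thesis .
qed

end

text \<open>
The normalization \<open>1 \<le> B\<close> makes the inequality trivial when \<open>N f\<close> is infinite and gives the \<open>A\<^sub>1\<close>
weights below constants that are at least 1.
\<close>

definition max_bounded :: "real \<Rightarrow> ((real ^ 'n::finite \<Rightarrow> ennreal) \<Rightarrow> ennreal) \<Rightarrow> bool" where
  "max_bounded B N \<longleftrightarrow> 1 \<le> B \<and> (\<forall>f\<in>meas. N (emax f) \<le> ennreal B * N f)"

text \<open>
Here \<open>W\<close> is the sum of the iterates \<open>emax\<^sup>k f\<close> divided by \<open>(2 B)\<^sup>k\<close>. Applying \<open>emax\<close> shifts the series, and
the norms of the terms are dominated by a geometric series.
\<close>

lemma (in function_norm) rubio_de_francia:
  assumes B: "max_bounded B N" and f [measurable]: "f \<in> meas"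
  obtains W where "W \<in> meas" "\<And>x. f x \<le> W x" "N W \<le> 2 * N f" "\<And>x. emax W x \<le> ennreal (2 * B) * W x"
proof
  have B1: "1 \<le> B" using B by (simp add: max_bounded_def)
  define T where "T k = (emax ^^ k) f" for k
  have Tm [measurable]: "T k \<in> meas" for k
    unfolding T_def by (cases k) auto
  have NT: "N (T k) \<le> ennreal (B ^ k) * N f" for k
  proof (induction k)
    case (Suc k)
    have "N (T (Suc k)) \<le> ennreal B * N (T k)"
      using B Tm[of k] by (simp add: max_bounded_def T_def)
    also have "\<dots> \<le> ennreal B * (ennreal (B ^ k) * N f)" by (intro mult_left_mono Suc) auto
    also have "\<dots> = ennreal (B ^ Suc k) * N f" using B1 by (subst ennreal_mult_assoc) auto
    finally show ?case .
  qed (simp add: T_def)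
  \<comment> \<open>the weights of the Rubio de Francia series\<close>
  define c where "c k = 1 / (2 * B) ^ k" for k :: nat
  have c0: "0 < c k" for k using B1 by (simp add: c_def)
  define W where "W x = (\<Sum>k. ennreal (c k) * T k x)" for x
  show "W \<in> meas" unfolding W_def by measurable
  show "f x \<le> W x" for x
  proof -
    have "f x = (\<Sum>k<1. ennreal (c k) * T k x)" by (simp add: c_def T_def)
    also have "\<dots> \<le> W x" unfolding W_def suminf_eq_SUP by (rule SUP_upper) simp
    finally show ?thesis .
  qed
  show "N W \<le> 2 * N f"
  proof -
    have "N W \<le> (\<Sum>k. N (\<lambda>x. ennreal (c k) * T k x))"
      unfolding W_def by (intro countably_subadditive) auto
    also have "\<dots> \<le> (\<Sum>k. ennreal ((1/2) ^ k) * N f)"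
    proof (intro suminf_le)
      fix k
      have "N (\<lambda>x. ennreal (c k) * T k x) \<le> ennreal (c k) * N (T k)" by (intro scale c0) auto
      also have "\<dots> \<le> ennreal (c k) * (ennreal (B ^ k) * N f)" by (intro mult_left_mono NT) auto
      also have "\<dots> = ennreal (c k * B ^ k) * N f" using c0[of k] by (intro ennreal_mult_assoc) simp
      also have "c k * B ^ k = (1/2) ^ k" using B1 by (simp add: c_def power_mult_distrib power_divide)
      finally show "N (\<lambda>x. ennreal (c k) * T k x) \<le> ennreal ((1/2) ^ k) * N f" .
    qed auto
    also have "\<dots> = (\<Sum>k. ennreal ((1/2) ^ k)) * N f" by simp
    also have "(\<Sum>k. ennreal ((1/2) ^ k)) = ennreal 2"
      by (rule suminf_ennreal_eq) (use geometric_sums[of "1/2 :: real"] in auto)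
    finally show ?thesis by simp
  qed
  show "emax W x \<le> ennreal (2 * B) * W x" for x
  proof -
    have "emax W x \<le> (\<Sum>k. emax (\<lambda>x. ennreal (c k) * T k x) x)"
      unfolding W_def by (intro emax_suminf) auto
    also have "\<dots> = (\<Sum>k. ennreal (2 * B) * (ennreal (c (Suc k)) * T (Suc k) x))"
    proof (intro suminf_cong)
      fix k
      have "emax (\<lambda>x. ennreal (c k) * T k x) x = ennreal (c k) * T (Suc k) x"
        using emax_cmult[OF Tm, of "ennreal (c k)" k x] by (simp add: T_def)
      also have "ennreal (c k) * T (Suc k) x = ennreal (2 * B) * (ennreal (c (Suc k)) * T (Suc k) x)"
      proof -
        have ck: "c k = 2 * B * c (Suc k)" using B1 by (simp add: c_def)
        show ?thesis unfolding ck using B1 by (intro ennreal_mult_assoc[symmetric]) simp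
      qed
      finally show "emax (\<lambda>x. ennreal (c k) * T k x) x = \<dots>" .
    qed
    also have "\<dots> = ennreal (2 * B) * (\<Sum>k. ennreal (c (Suc k)) * T (Suc k) x)" by simp
    also have "(\<Sum>k. ennreal (c (Suc k)) * T (Suc k) x) \<le> W x"
      unfolding W_def suminf_eq_SUP
    proof (intro SUP_mono)
      fix n
      show "\<exists>m\<in>UNIV. (\<Sum>i<n. ennreal (c (Suc i)) * T (Suc i) x) \<le> (\<Sum>i<m. ennreal (c i) * T i x)"
        by (intro bexI[of _ "Suc n"]) (auto simp: sum.lessThan_Suc_shift simp del: sum.lessThan_Suc)
    qed
    finally show ?thesis by (simp add: mult_left_mono)
  qed
qed

text \<open>
If \<open>W\<close> vanishes at one point, then so does \<open>emax W\<close>, hence all averages over cubes containing this point,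
hence \<open>W\<close> almost everywhere. So the output of the Rubio de Francia algorithm is an \<open>A\<^sub>1\<close> weight unless it is zero.
\<close>

lemma A1_weightI:
  fixes W :: "real ^ 'n::finite \<Rightarrow> ennreal"
  assumes [measurable]: "W \<in> meas" and C: "1 \<le> C" and A1: "\<And>x. emax W x \<le> ennreal C * W x"
    and fin: "AE x in lebesgue. W x < top" and nz: "\<not> (AE x in lebesgue. W x = 0)"
  shows "A1_weight C W"
proof -
  define Q where "Q m = cube ((\<chi> i. - real m) :: real ^ 'n) (2 * real m + 1)" for m :: nat
  have Qx: "x \<in> Q m" if "norm x \<le> real m" for x m
    unfolding Q_def by (rule mem_centered_cube[OF that])
  have [measurable]: "Q m \<in> sets lebesgue" for m by (simp add: Q_def)
  \<comment> \<open>a cube about the origin on which \<open>W\<close> has positive integral; larger cubes reach every point\<close>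
  obtain m0 where m0: "mass W (Q m0) \<noteq> 0"
  proof (rule ccontr)
    assume "\<not> thesis"
    then have "mass W (Q m) = 0" for m using that by blast
    then have "AE x in lebesgue. W x * indicator (Q m) x = 0" for m
      by (subst (asm) nn_integral_0_iff_AE) auto
    then have "AE x in lebesgue. \<forall>m. W x * indicator (Q m) x = 0"
      by (intro AE_all_countable[THEN iffD2] allI)
    then have "AE x in lebesgue. W x = 0"
    proof eventually_elim
      case (elim x)
      obtain m :: nat where "norm x \<le> real m" using real_arch_simple by blast
      with elim[rule_format, of m] Qx[of x m] show ?case by simp
    qed
    with nz show False by simp
  qed
  have "0 < W x" for x
  proof (rule ccontr)
    assume "\<not> 0 < W x"
    then have Mx: "emax W x = 0" using A1[of x] by simp
    obtain m1 :: nat where m1: "norm x \<le> real m1" using real_arch_simple by blast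
    let ?m = "max m0 m1"
    have "x \<in> Q ?m" using m1 by (intro Qx) simp
    then have "mass W (Q ?m) \<le> emax W x * vol (Q ?m)"
      unfolding Q_def by (intro emax_upper) auto
    then have "mass W (Q ?m) = 0" using Mx by simp
    moreover have "Q m0 \<subseteq> Q ?m"
    proof
      fix y assume y: "y \<in> Q m0"
      have "- real ?m \<le> y $ i \<and> y $ i \<le> - real ?m + (2 * real ?m + 1)" for i
      proof -
        have "- real m0 \<le> y $ i" "y $ i \<le> - real m0 + (2 * real m0 + 1)"
          using y by (auto simp: Q_def mem_cube)
        moreover have "real m0 \<le> real ?m" by simp
        ultimately show ?thesis by linarith
      qed
      then show "y \<in> Q ?m" by (simp add: mem_cube Q_def)
    qed
    then have "mass W (Q m0) \<le> mass W (Q ?m)"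
      by (intro nn_integral_mono mult_left_mono indicator_mono) auto
    ultimately show False using m0 by simp
  qed
  then show ?thesis using fin A1 C by (auto simp: A1_weight_def)
qed

section \<open>The dual norm\<close>

text \<open>
This is the norm of the associate space, extended to all functions with values in \<open>[0, \<infinity>]\<close>.
\<close>

definition dual_norm :: "((real ^ 'n::finite \<Rightarrow> ennreal) \<Rightarrow> ennreal) \<Rightarrow> (real ^ 'n \<Rightarrow> ennreal) \<Rightarrow> ennreal" where
  "dual_norm N g = (SUP f\<in>{f \<in> meas. N f \<le> 1}. \<integral>\<^sup>+x. f x * g x \<partial>lebesgue)"

definition saturated :: "((real ^ 'n::finite \<Rightarrow> ennreal) \<Rightarrow> ennreal) \<Rightarrow> bool" where
  "saturated N \<longleftrightarrow> (\<forall>E\<in>sets lebesgue. 0 < vol E \<longrightarrow>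
     (\<exists>F\<in>sets lebesgue. F \<subseteq> E \<and> 0 < vol F \<and> N (indicator F) < top))"

lemma (in function_norm) dual_norm_bound:
  assumes f [measurable]: "f \<in> meas" and [measurable]: "g \<in> meas" and c: "0 < c" "N f \<le> ennreal c"
  shows "(\<integral>\<^sup>+x. f x * g x \<partial>lebesgue) \<le> ennreal c * dual_norm N g"
proof -
  have "N (\<lambda>x. ennreal (1 / c) * f x) \<le> ennreal (1 / c) * N f" using c by (intro scale) auto
  also have "\<dots> \<le> ennreal (1 / c) * ennreal c" by (intro mult_left_mono c) auto
  also have "\<dots> = 1" using c by (simp add: ennreal_mult'[symmetric])
  finally have "(\<integral>\<^sup>+x. (ennreal (1 / c) * f x) * g x \<partial>lebesgue) \<le> dual_norm N g"
    unfolding dual_norm_def by (intro SUP_upper2[of "\<lambda>x. ennreal (1 / c) * f x"]) auto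
  then have "ennreal c * (\<integral>\<^sup>+x. ennreal (1 / c) * (f x * g x) \<partial>lebesgue) \<le> ennreal c * dual_norm N g"
    by (intro mult_left_mono) (auto simp: mult.assoc)
  also have "(\<integral>\<^sup>+x. ennreal (1 / c) * (f x * g x) \<partial>lebesgue) = ennreal (1 / c) * (\<integral>\<^sup>+x. f x * g x \<partial>lebesgue)"
    by (intro nn_integral_cmult) measurable
  also have "ennreal c * \<dots> = (\<integral>\<^sup>+x. f x * g x \<partial>lebesgue)"
    using c by (subst ennreal_mult_assoc) auto
  finally show ?thesis .
qed

lemma dual_norm_least:
  "(\<And>f. f \<in> meas \<Longrightarrow> N f \<le> 1 \<Longrightarrow> (\<integral>\<^sup>+x. f x * g x \<partial>lebesgue) \<le> c) \<Longrightarrow> dual_norm N g \<le> c"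
  unfolding dual_norm_def by (rule SUP_least) auto

lemma dual_norm_upper:
  "f \<in> meas \<Longrightarrow> N f \<le> 1 \<Longrightarrow> (\<integral>\<^sup>+x. f x * g x \<partial>lebesgue) \<le> dual_norm N g"
  unfolding dual_norm_def by (rule SUP_upper) auto

text \<open>
Saturation enters only through finiteness almost everywhere: a function that is infinite on a set of positive
measure has infinite integral over a smaller set whose indicator belongs to the space.
\<close>

lemma (in function_norm) function_norm_dual:
  assumes sat: "saturated N"
  shows "function_norm (dual_norm N)"
proof
  fix f g :: "real ^ 'n \<Rightarrow> ennreal" assume [measurable]: "f \<in> meas" "g \<in> meas"
  show "dual_norm N f \<le> dual_norm N g" if "AE x in lebesgue. f x \<le> g x"
  proof (rule dual_norm_least)
    fix h :: "real ^ 'n \<Rightarrow> ennreal" assume h: "h \<in> meas" "N h \<le> 1"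
    have "(\<integral>\<^sup>+x. h x * f x \<partial>lebesgue) \<le> (\<integral>\<^sup>+x. h x * g x \<partial>lebesgue)"
      by (intro nn_integral_mono_AE eventually_mono[OF that] mult_left_mono) auto
    also have "\<dots> \<le> dual_norm N g" by (rule dual_norm_upper) (use h in auto)
    finally show "(\<integral>\<^sup>+x. h x * f x \<partial>lebesgue) \<le> dual_norm N g" .
  qed
  show "dual_norm N (\<lambda>x. f x + g x) \<le> dual_norm N f + dual_norm N g"
  proof (rule dual_norm_least)
    fix h :: "real ^ 'n \<Rightarrow> ennreal" assume h [measurable]: "h \<in> meas" and hN: "N h \<le> 1"
    have "(\<integral>\<^sup>+x. h x * (f x + g x) \<partial>lebesgue) = (\<integral>\<^sup>+x. h x * f x \<partial>lebesgue) + (\<integral>\<^sup>+x. h x * g x \<partial>lebesgue)"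
      by (simp add: distrib_left nn_integral_add)
    also have "\<dots> \<le> dual_norm N f + dual_norm N g" by (intro add_mono dual_norm_upper h hN)
    finally show "(\<integral>\<^sup>+x. h x * (f x + g x) \<partial>lebesgue) \<le> dual_norm N f + dual_norm N g" .
  qed
next
  fix f :: "real ^ 'n \<Rightarrow> ennreal" and c :: real assume [measurable]: "f \<in> meas" and c: "0 < c"
  show "dual_norm N (\<lambda>x. ennreal c * f x) \<le> ennreal c * dual_norm N f"
  proof (rule dual_norm_least)
    fix h :: "real ^ 'n \<Rightarrow> ennreal" assume h [measurable]: "h \<in> meas" and hN: "N h \<le> 1"
    have "(\<integral>\<^sup>+x. h x * (ennreal c * f x) \<partial>lebesgue) = ennreal c * (\<integral>\<^sup>+x. h x * f x \<partial>lebesgue)"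
      by (subst nn_integral_cmult[symmetric]) (auto simp: mult_ac)
    also have "\<dots> \<le> ennreal c * dual_norm N f" by (intro mult_left_mono dual_norm_upper h hN) auto
    finally show "(\<integral>\<^sup>+x. h x * (ennreal c * f x) \<partial>lebesgue) \<le> ennreal c * dual_norm N f" .
  qed
next
  fix f :: "nat \<Rightarrow> real ^ 'n \<Rightarrow> ennreal" assume f [measurable]: "\<And>n. f n \<in> meas" and inc: "\<And>x. incseq (\<lambda>n. f n x)"
  show "dual_norm N (\<lambda>x. SUP n. f n x) \<le> (SUP n. dual_norm N (f n))"
  proof (rule dual_norm_least)
    fix h :: "real ^ 'n \<Rightarrow> ennreal" assume h [measurable]: "h \<in> meas" and hN: "N h \<le> 1"
    have "(\<integral>\<^sup>+x. h x * (SUP n. f n x) \<partial>lebesgue) = (\<integral>\<^sup>+x. (SUP n. h x * f n x) \<partial>lebesgue)"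
      by (simp add: SUP_mult_left_ennreal)
    also have "\<dots> = (SUP n. \<integral>\<^sup>+x. h x * f n x \<partial>lebesgue)"
      using inc by (intro nn_integral_monotone_convergence_SUP) (auto simp: incseq_def le_fun_def intro!: mult_left_mono)
    also have "\<dots> \<le> (SUP n. dual_norm N (f n))"
      by (intro SUP_subset_mono dual_norm_upper h hN) auto
    finally show "(\<integral>\<^sup>+x. h x * (SUP n. f n x) \<partial>lebesgue) \<le> (SUP n. dual_norm N (f n))" .
  qed
next
  have "dual_norm N (\<lambda>x. 0) \<le> 0" by (rule dual_norm_least) simp
  then show "dual_norm N (\<lambda>x. 0) = 0" by simp
next
  fix f :: "real ^ 'n \<Rightarrow> ennreal" assume [measurable]: "f \<in> meas" and fin: "dual_norm N f < top"
  define E where "E = {x \<in> space lebesgue. f x = top}"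
  have E [measurable]: "E \<in> sets lebesgue" unfolding E_def by measurable
  have "vol E = 0"
  proof (rule ccontr)
    assume "vol E \<noteq> 0"
    then have "0 < vol E" by (simp add: zero_less_iff_neq_zero)
    then obtain F where F [measurable]: "F \<in> sets lebesgue" and FE: "F \<subseteq> E" "0 < vol F" "N (indicator F) < top"
      using sat E unfolding saturated_def by blast
    obtain c where c: "N (indicator F) = ennreal c" "0 \<le> c" using FE(3) by (cases "N (indicator F)") auto
    have "(\<integral>\<^sup>+x. indicator F x * f x \<partial>lebesgue) \<le> ennreal (c + 1) * dual_norm N f"
      using c by (intro dual_norm_bound) (auto intro: ennreal_leI)
    also have "\<dots> < top" using fin by (simp add: ennreal_mult_less_top)
    finally have "(\<integral>\<^sup>+x. indicator F x * f x \<partial>lebesgue) < top" .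
    moreover have "(\<integral>\<^sup>+x. indicator F x * f x \<partial>lebesgue) = (\<integral>\<^sup>+x. top * indicator F x \<partial>lebesgue)"
      using FE(1) by (intro nn_integral_cong) (auto simp: indicator_def E_def)
    moreover have "(\<integral>\<^sup>+x. top * indicator F x \<partial>lebesgue) = top"
      using FE(2) by (subst nn_integral_cmult_indicator) (auto simp: ennreal_top_mult)
    ultimately show False by simp
  qed
  then have "E \<in> null_sets lebesgue" using E by auto
  then have "AE x in lebesgue. x \<notin> E" by (rule AE_not_in)
  then show "AE x in lebesgue. f x < top"
    by (rule eventually_mono) (auto simp: E_def less_top)
qed

section \<open>Concavification of a function norm\<close>

definition conc :: "real \<Rightarrow> ((real ^ 'n::finite \<Rightarrow> ennreal) \<Rightarrow> ennreal) \<Rightarrow> (real ^ 'n \<Rightarrow> ennreal) \<Rightarrow> ennreal" where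
  "conc r N f = epow (N (\<lambda>x. epow (f x) (1 / r))) r"

lemma conc_conc: "conc s (conc r N) f = conc (s * r) N f"
  by (simp add: conc_def mult.commute)

lemma (in function_norm) conc_mono:
  assumes "0 < r" and [measurable]: "f \<in> meas" "g \<in> meas" and ae: "AE x in lebesgue. f x \<le> g x"
  shows "conc r N f \<le> conc r N g"
  unfolding conc_def using assms(1)
  by (intro epow_mono mono eventually_mono[OF ae]) auto

lemma conc_scale:
  assumes scale: "\<And>f c. f \<in> meas \<Longrightarrow> 0 < c \<Longrightarrow> N (\<lambda>x. ennreal c * f x) \<le> ennreal c * N f"
    and r: "0 < r" and [measurable]: "f \<in> meas" and c: "0 < c"
  shows "conc r N (\<lambda>x. ennreal c * f x) \<le> ennreal c * conc r N f"
proof -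
  have "conc r N (\<lambda>x. ennreal c * f x) = epow (N (\<lambda>x. ennreal (c powr (1 / r)) * epow (f x) (1 / r))) r"
    using c by (simp add: conc_def epow_mult)
  also have "\<dots> \<le> epow (ennreal (c powr (1 / r)) * N (\<lambda>x. epow (f x) (1 / r))) r"
    using c r by (intro epow_mono scale) auto
  also have "\<dots> = ennreal c * conc r N f"
    using c r by (simp add: conc_def epow_mult powr_powr)
  finally show ?thesis .
qed

lemma powr_convex_combination:
  fixes u v s :: real
  assumes s: "1 \<le> s" and uv: "0 \<le> u" "0 \<le> v" and lm: "0 < l" "0 < m" "l + m = 1"
  shows "(l * u + m * v) powr s \<le> l * u powr s + m * v powr s"
proof -
  have small: "k powr s \<le> k" if "0 < k" "k \<le> 1" for k :: real
    using that s powr_mono'[of 1 s k] by simp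
  consider "u = 0" | "v = 0" | "0 < u" "0 < v" using uv by linarith
  then show ?thesis
  proof cases
    case 1
    then show ?thesis using lm uv small[of m] s by (simp add: powr_mult mult_right_mono)
  next
    case 2
    then show ?thesis using lm uv small[of l] s by (simp add: powr_mult mult_right_mono)
  next
    case 3
    have "l = 1 - m" using lm by simp
    then show ?thesis
      using convex_onD[OF powr_convex[OF s], of m u v] 3 lm unfolding \<open>l = 1 - m\<close> by simp
  qed
qed

text \<open>
If \<open>conc s N\<close> satisfies the triangle inequality for some \<open>s \<ge> 1\<close>, then so does \<open>N\<close>. Write \<open>(f + g) / (a + b)\<close>
as a convex combination of \<open>f / a\<close> and \<open>g / b\<close>, where \<open>a\<close> and \<open>b\<close> exceed the norms, and apply convexity of the power
\<open>s\<close>. This is how \<open>q\<close>-convexity is passed down to smaller exponents.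
\<close>

lemma subadditive_of_conc:
  fixes N :: "(real ^ 'n::finite \<Rightarrow> ennreal) \<Rightarrow> ennreal"
  assumes mono: "\<And>f g. f \<in> meas \<Longrightarrow> g \<in> meas \<Longrightarrow> AE x in lebesgue. f x \<le> g x \<Longrightarrow> N f \<le> N g"
    and scale: "\<And>f c. f \<in> meas \<Longrightarrow> 0 < c \<Longrightarrow> N (\<lambda>x. ennreal c * f x) \<le> ennreal c * N f"
    and s: "1 \<le> s"
    and add: "\<And>f g. f \<in> meas \<Longrightarrow> g \<in> meas \<Longrightarrow> conc s N (\<lambda>x. f x + g x) \<le> conc s N f + conc s N g"
    and [measurable]: "f \<in> meas" "g \<in> meas"
  shows "N (\<lambda>x. f x + g x) \<le> N f + N g"
proof (cases "N f = top \<or> N g = top")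
  case False
  then obtain a0 b0 where ab0: "N f = ennreal a0" "0 \<le> a0" "N g = ennreal b0" "0 \<le> b0"
    by (cases "N f"; cases "N g") auto
  have "N (\<lambda>x. f x + g x) \<le> ennreal (a0 + b0 + e)" if e: "0 < e" for e
  proof -
    define a b where "a = a0 + e / 2" and "b = b0 + e / 2"
    have ab: "0 < a" "0 < b" "a0 \<le> a" "b0 \<le> b" using ab0 e by (auto simp: a_def b_def)
    define l m where "l = a / (a + b)" and "m = b / (a + b)"
    have lm: "0 < l" "0 < m" "l + m = 1" using ab by (auto simp: l_def m_def add_divide_distrib[symmetric])
    let ?F = "\<lambda>x. epow (ennreal (1 / a) * f x) s" and ?G = "\<lambda>x. epow (ennreal (1 / b) * g x) s"
    \<comment> \<open>normalized functions, raised to the power \<open>s\<close>, lie in the unit ball of \<open>conc s N\<close>\<close>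
    have unit: "conc s N (\<lambda>x. epow (ennreal (1 / c) * h x) s) \<le> 1"
      if [measurable]: "h \<in> meas" and c: "0 < c" "N h \<le> ennreal c" for h c
    proof -
      have "N (\<lambda>x. ennreal (1 / c) * h x) \<le> ennreal (1 / c) * N h" using c by (intro scale) auto
      also have "\<dots> \<le> ennreal (1 / c) * ennreal c" by (intro mult_left_mono c) auto
      also have "\<dots> = 1" using c by (simp add: ennreal_mult'[symmetric])
      finally have "epow (N (\<lambda>x. ennreal (1 / c) * h x)) s \<le> epow 1 s"
        using s by (intro epow_mono) auto
      then show ?thesis using s by (simp add: conc_def)
    qed
    have pt: "epow (ennreal (1 / (a + b)) * (f x + g x)) s \<le> ennreal l * ?F x + ennreal m * ?G x" for x
    proof (cases "f x = top \<or> g x = top")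
      case True
      then have "ennreal l * ?F x + ennreal m * ?G x = top"
        using lm ab by (auto simp: ennreal_mult_eq_top_iff)
      then show ?thesis by (metis top_greatest)
    next
      case False
      then obtain u v where uv: "f x = ennreal u" "0 \<le> u" "g x = ennreal v" "0 \<le> v"
        by (cases "f x"; cases "g x") auto
      have "epow (ennreal (1 / (a + b)) * (f x + g x)) s = ennreal ((1 / (a + b) * (u + v)) powr s)"
        using uv ab by (simp add: ennreal_mult'[symmetric] ennreal_plus[symmetric] del: ennreal_plus)
      also have "1 / (a + b) * (u + v) = l * (1 / a * u) + m * (1 / b * v)"
        using ab by (simp add: l_def m_def add_divide_distrib)
      also have "ennreal ((l * (1 / a * u) + m * (1 / b * v)) powr s) \<le> ennreal (l * (1 / a * u) powr s + m * (1 / b * v) powr s)"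
        using uv ab lm s by (intro ennreal_leI powr_convex_combination) auto
      also have "\<dots> = ennreal l * ennreal ((1 / a * u) powr s) + ennreal m * ennreal ((1 / b * v) powr s)"
        using lm by (subst ennreal_plus) (auto simp: ennreal_mult')
      also have "\<dots> = ennreal l * ?F x + ennreal m * ?G x"
        using uv ab epow_ennreal[of "1 / a * u" s] epow_ennreal[of "1 / b * v" s] by (simp add: ennreal_mult'[of "1 / a"] ennreal_mult'[of "1 / b"] flip: ennreal_mult')
      finally show ?thesis .
    qed
    have "conc s N (\<lambda>x. epow (ennreal (1 / (a + b)) * (f x + g x)) s) \<le> conc s N (\<lambda>x. ennreal l * ?F x + ennreal m * ?G x)"
      unfolding conc_def using pt s by (intro epow_mono mono AE_I2) (auto simp: epow_le_iff'[symmetric])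
    also have "\<dots> \<le> conc s N (\<lambda>x. ennreal l * ?F x) + conc s N (\<lambda>x. ennreal m * ?G x)"
      by (intro add) auto
    also have "\<dots> \<le> ennreal l * conc s N ?F + ennreal m * conc s N ?G"
      using lm s by (intro add_mono conc_scale scale) auto
    also have "\<dots> \<le> ennreal l * 1 + ennreal m * 1"
      using ab ab0 by (intro add_mono mult_left_mono unit) (auto intro: ennreal_leI)
    also have "\<dots> = epow 1 s" using lm by (simp add: ennreal_plus[symmetric] del: ennreal_plus)
    finally have "N (\<lambda>x. ennreal (1 / (a + b)) * (f x + g x)) \<le> 1"
      using s unfolding conc_def by (subst (asm) epow_le_iff) auto
    then have "ennreal (a + b) * N (\<lambda>x. ennreal (1 / (a + b)) * (f x + g x)) \<le> ennreal (a + b) * 1"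
      by (intro mult_left_mono) auto
    moreover have "N (\<lambda>x. f x + g x) \<le> ennreal (a + b) * N (\<lambda>x. ennreal (1 / (a + b)) * (f x + g x))"
    proof -
      have "(\<lambda>x. f x + g x) = (\<lambda>x. ennreal (a + b) * (ennreal (1 / (a + b)) * (f x + g x)))"
        using ab by (auto simp: ennreal_mult_assoc fun_eq_iff simp del: ennreal_plus)
      then show ?thesis
        using scale[of "\<lambda>x. ennreal (1 / (a + b)) * (f x + g x)" "a + b"] ab by (simp del: ennreal_plus)
    qed
    ultimately show ?thesis by (simp add: a_def b_def algebra_simps del: ennreal_plus)
  qed
  note le = this
  have "N (\<lambda>x. f x + g x) \<le> ennreal (a0 + b0)"
  proof (rule ennreal_le_epsilon)
    fix e :: real assume "0 < e"
    from le[OF this] show "N (\<lambda>x. f x + g x) \<le> ennreal (a0 + b0) + ennreal e"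
      using ab0 \<open>0 < e\<close> by simp
  qed
  then show ?thesis using ab0 by simp
qed auto

text \<open>
The \<open>q\<close>-convexity of a space says precisely that its \<open>q\<close>-concavification satisfies the triangle inequality.
\<close>

definition norm_convex :: "real \<Rightarrow> ((real ^ 'n::finite \<Rightarrow> ennreal) \<Rightarrow> ennreal) \<Rightarrow> bool" where
  "norm_convex q N \<longleftrightarrow> (\<forall>f\<in>meas. \<forall>g\<in>meas.
     N (\<lambda>x. epow (epow (f x) q + epow (g x) q) (1 / q)) \<le> epow (epow (N f) q + epow (N g) q) (1 / q))"

lemma (in function_norm) function_norm_conc:
  assumes r: "0 < r" "r \<le> q" and conv: "norm_convex q N"
  shows "function_norm (conc r N)"
proof
  have q: "0 < q" using r by simp
  have addq: "conc q N (\<lambda>x. f x + g x) \<le> conc q N f + conc q N g" if [measurable]: "f \<in> meas" "g \<in> meas" for f g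
  proof -
    have fm: "(\<lambda>x. epow (f x) (1 / q)) \<in> meas" and gm: "(\<lambda>x. epow (g x) (1 / q)) \<in> meas" by measurable
    have "N (\<lambda>x. epow (f x + g x) (1 / q)) \<le> epow (conc q N f + conc q N g) (1 / q)"
      using bspec[OF bspec[OF conv[unfolded norm_convex_def] fm] gm] q by (simp add: conc_def)
    then have "epow (N (\<lambda>x. epow (f x + g x) (1 / q))) q \<le> epow (epow (conc q N f + conc q N g) (1 / q)) q"
      using q by (intro epow_mono) auto
    then show ?thesis using q by (simp add: conc_def)
  qed
  fix f g :: "real ^ 'n \<Rightarrow> ennreal" assume [measurable]: "f \<in> meas" "g \<in> meas"
  show "conc r N f \<le> conc r N g" if "AE x in lebesgue. f x \<le> g x"
    using r that by (intro conc_mono) auto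
  show "conc r N (\<lambda>x. f x + g x) \<le> conc r N f + conc r N g"
  proof (rule subadditive_of_conc[where s = "q / r"])
    show "1 \<le> q / r" using r by simp
    have "q / r * r = q" using r by simp
    then show "conc (q / r) (conc r N) (\<lambda>x. f x + g x) \<le> conc (q / r) (conc r N) f + conc (q / r) (conc r N) g"
      if "f \<in> meas" "g \<in> meas" for f g
      unfolding conc_conc using addq[OF that] by simp
  qed (use r in \<open>auto intro: conc_mono conc_scale scale\<close>)
next
  fix f :: "real ^ 'n \<Rightarrow> ennreal" and c :: real assume "f \<in> meas" "0 < c"
  then show "conc r N (\<lambda>x. ennreal c * f x) \<le> ennreal c * conc r N f"
    using r by (intro conc_scale scale) auto
next
  fix f :: "nat \<Rightarrow> real ^ 'n \<Rightarrow> ennreal" assume f [measurable]: "\<And>n. f n \<in> meas" and inc: "\<And>x. incseq (\<lambda>n. f n x)"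
  have "N (\<lambda>x. SUP n. epow (f n x) (1 / r)) \<le> (SUP n. N (\<lambda>x. epow (f n x) (1 / r)))"
    using inc r by (intro sup) (auto simp: incseq_def intro!: epow_mono)
  then have "epow (N (\<lambda>x. SUP n. epow (f n x) (1 / r))) r \<le> epow (SUP n. N (\<lambda>x. epow (f n x) (1 / r))) r"
    using r by (intro epow_mono) auto
  then show "conc r N (\<lambda>x. SUP n. f n x) \<le> (SUP n. conc r N (f n))"
    using r by (simp add: conc_def epow_SUP)
next
  show "conc r N (\<lambda>x. 0) = 0" by (simp add: conc_def zero)
next
  fix f :: "real ^ 'n \<Rightarrow> ennreal" assume [measurable]: "f \<in> meas" and fin: "conc r N f < top"
  have "AE x in lebesgue. epow (f x) (1 / r) < top"
    using fin by (intro finite_AE) (auto simp: conc_def)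
  then show "AE x in lebesgue. f x < top" by simp
qed

lemma saturated_conc: "saturated N \<Longrightarrow> saturated (conc r N)"
  unfolding saturated_def conc_def indicator_epow by simp

section \<open>Lorentz-Luxemburg duality\<close>

lemma integrable_bounded_support:
  fixes f :: "real ^ 'n::finite \<Rightarrow> real"
  assumes "f \<in> borel_measurable lebesgue" "F \<in> sets lebesgue" "vol F < top"
    and "\<And>x. \<bar>f x\<bar> \<le> c * indicator F x"
  shows "integrable lebesgue f"
proof (rule Bochner_Integration.integrable_bound[of lebesgue "\<lambda>x. c * indicator F x"])
  show "integrable lebesgue (\<lambda>x. c * indicator F x)"
    using assms by (intro integrable_mult_right integrable_real_indicator) auto
  show "AE x in lebesgue. norm (f x) \<le> norm (c * indicator F x)"
    using assms(4) by (intro AE_I2) (metis abs_ge_self order_trans real_norm_def)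
qed (use assms in auto)

text \<open>
A pointwise form of the completeness of \<open>L\<^sup>2\<close>: rapidly Cauchy sequences converge almost everywhere.
\<close>

lemma convergent_of_geometric_increments:
  fixes b :: "nat \<Rightarrow> real"
  assumes "(\<Sum>k. ennreal (4 ^ k * (b (Suc k) - b k)\<^sup>2)) < top"
  shows "convergent b"
proof -
  obtain S where S: "(\<Sum>k. ennreal (4 ^ k * (b (Suc k) - b k)\<^sup>2)) = ennreal S" "0 \<le> S"
    using assms unfolding less_top_ennreal by (elim exE conjE)
  have le: "\<bar>b (Suc k) - b k\<bar> \<le> sqrt S * (1 / 2) ^ k" for k
  proof -
    have "ennreal (4 ^ k * (b (Suc k) - b k)\<^sup>2) \<le> ennreal S"
    proof -
      let ?f = "\<lambda>k. ennreal (4 ^ k * (b (Suc k) - b k)\<^sup>2)"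
      have "?f k \<le> (\<Sum>i<Suc k. ?f i)" by (rule member_le_sum) auto
      also have "\<dots> \<le> (\<Sum>i. ?f i)" unfolding suminf_eq_SUP by (rule SUP_upper) simp
      also have "\<dots> = ennreal S" by (rule S(1))
      finally show ?thesis .
    qed
    then have "4 ^ k * (b (Suc k) - b k)\<^sup>2 \<le> S" using S by simp
    moreover have "4 ^ k * (b (Suc k) - b k)\<^sup>2 = (2 ^ k * \<bar>b (Suc k) - b k\<bar>)\<^sup>2"
    proof -
      have "(4 :: real) ^ k = (2 ^ k)\<^sup>2" by (simp add: power2_eq_square flip: power_mult_distrib)
      then show ?thesis by (simp add: power_mult_distrib)
    qed
    ultimately have "2 ^ k * \<bar>b (Suc k) - b k\<bar> \<le> sqrt S"
      using real_le_rsqrt by metis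
    then show ?thesis by (simp add: field_simps)
  qed
  have "summable (\<lambda>k. b (Suc k) - b k)"
    by (rule summable_comparison_test'[of "\<lambda>k. sqrt S * (1 / 2) ^ k" 0]) (use le in \<open>auto intro!: summable_mult summable_geometric\<close>)
  then have "convergent (\<lambda>n. \<Sum>k<n. b (Suc k) - b k)" by (simp add: summable_iff_convergent)
  then have "convergent (\<lambda>n. b n - b 0)" by (simp add: sum_lessThan_telescope)
  then have "convergent (\<lambda>n. (b n - b 0) + b 0)" by (intro convergent_add convergent_const)
  then show ?thesis by simp
qed

text \<open>
Project \<open>h\<close> in \<open>L\<^sup>2\<close> onto the convex set \<open>K\<close> of functions between 0 and \<open>h\<close> in the unit ball. The projection
\<open>bb\<close> exists by the parallelogram law, since \<open>K\<close> is closed under almost everywhere limits by the Fatou property.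
The first variation at \<open>bb\<close> shows that \<open>g = h - bb\<close> separates \<open>h\<close> from the unit ball: the dual norm of \<open>g\<close> is at
most the integral of \<open>g * bb\<close>. The hypothesis then forces the integral of \<open>g * h - g * bb\<close>, that is of \<open>g\<^sup>2\<close>,
to vanish, whence \<open>h = bb\<close>.
\<close>

lemma (in function_norm) lorentz_luxemburg_bounded:
  fixes h :: "real ^ 'n \<Rightarrow> real"
  assumes hm [measurable]: "h \<in> borel_measurable lebesgue" and F [measurable]: "F \<in> sets lebesgue"
    and Ffin: "vol F < top" and h0: "\<And>x. 0 \<le> h x" and hc: "\<And>x. h x \<le> c * indicator F x"
    and dual: "\<And>u. u \<in> meas \<Longrightarrow> (\<integral>\<^sup>+x. ennreal (h x) * u x \<partial>lebesgue) \<le> dual_norm N u"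
  shows "N (\<lambda>x. ennreal (h x)) \<le> 1"
proof -
  \<comment> \<open>the part of the unit ball between 0 and \<open>h\<close>, and the squared distance to \<open>h\<close>\<close>
  define K where "K = {b. b \<in> borel_measurable lebesgue \<and> (\<forall>x. 0 \<le> b x \<and> b x \<le> h x) \<and> N (\<lambda>x. ennreal (b x)) \<le> 1}"
  define D where "D b = (\<integral>x. (h x - b x)\<^sup>2 \<partial>lebesgue)" for b
  have hF: "h x = 0" if "x \<notin> F" for x using h0[of x] hc[of x] that by simp
  have hc1: "h x \<le> \<bar>c\<bar>" for x using hc[of x] by (cases "x \<in> F") auto
  have int: "integrable lebesgue f" if "f \<in> borel_measurable lebesgue" "\<And>x. x \<notin> F \<Longrightarrow> f x = 0" "\<And>x. \<bar>f x\<bar> \<le> k" for f :: "real ^ 'n \<Rightarrow> real" and k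
  proof (rule integrable_bounded_support[OF that(1) F Ffin])
    show "\<bar>f x\<bar> \<le> k * indicator F x" for x using that(2)[of x] that(3)[of x] by (cases "x \<in> F") auto
  qed
  have Kdiff: "\<bar>b x - b' x\<bar> \<le> \<bar>c\<bar>" "x \<notin> F \<Longrightarrow> b x - b' x = 0" if "b \<in> K" "b' \<in> K" for b b' x
    using that hc1[of x] hF[of x] unfolding K_def by (auto simp: abs_le_iff) (smt (verit))+
  have Km: "b \<in> borel_measurable lebesgue" if "b \<in> K" for b using that by (simp add: K_def)
  have sqint: "integrable lebesgue (\<lambda>x. (b x - b' x)\<^sup>2)" if "b \<in> K" "b' \<in> K" for b b'
  proof (rule int)
    show "(\<lambda>x. (b x - b' x)\<^sup>2) \<in> borel_measurable lebesgue" using Km[OF that(1)] Km[OF that(2)] by measurable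
    show "\<bar>(b x - b' x)\<^sup>2\<bar> \<le> \<bar>c\<bar>\<^sup>2" for x
      using power_mono[OF Kdiff(1)[OF that, of x], of 2] by simp
  qed (use Kdiff(2)[OF that] in simp)
  have hbint: "integrable lebesgue (\<lambda>x. (h x - b x)\<^sup>2)" if "b \<in> K" for b
  proof (rule int)
    have b: "0 \<le> b x" "b x \<le> h x" for x using that by (auto simp: K_def)
    show "(\<lambda>x. (h x - b x)\<^sup>2) \<in> borel_measurable lebesgue" using Km[OF that] by measurable
    show "\<bar>(h x - b x)\<^sup>2\<bar> \<le> \<bar>c\<bar>\<^sup>2" for x
      using power_mono[of "h x - b x" "\<bar>c\<bar>" 2] b[of x] hc1[of x] by simp
    show "(h x - b x)\<^sup>2 = 0" if "x \<notin> F" for x using b[of x] hF[OF that] by simp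
  qed
  have zK: "(\<lambda>x. 0) \<in> K" using h0 zero by (simp add: K_def)
  have D0: "0 \<le> D b" for b unfolding D_def by (intro integral_nonneg_AE) auto
  define I where "I = Inf (D ` K)"
  have bdd: "bdd_below (D ` K)" using D0 by (intro bdd_belowI2[of _ 0]) auto
  have ID: "I \<le> D b" if "b \<in> K" for b unfolding I_def using that bdd by (intro cInf_lower) auto
  have "\<exists>b\<in>K. D b < I + (1/8) ^ k" for k :: nat
  proof -
    have "\<exists>y\<in>D ` K. y < I + (1/8) ^ k"
      unfolding I_def using zK bdd by (subst cInf_less_iff[symmetric]) auto
    then show ?thesis by blast
  qed
  then obtain b where bK: "\<And>k. b k \<in> K" and bI: "\<And>k. D (b k) < I + (1/8) ^ k" by metis
  have convex: "(\<lambda>x. (1 - t) * f x + t * g x) \<in> borel_measurable lebesgue"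
       "N (\<lambda>x. ennreal ((1 - t) * f x + t * g x)) \<le> 1"
    if [measurable]: "f \<in> borel_measurable lebesgue" "g \<in> borel_measurable lebesgue"
      and fg: "\<And>x. 0 \<le> f x" "\<And>x. 0 \<le> g x" "N (\<lambda>x. ennreal (f x)) \<le> 1" "N (\<lambda>x. ennreal (g x)) \<le> 1"
      and t: "0 < t" "t < 1" for f g t
  proof -
    show "(\<lambda>x. (1 - t) * f x + t * g x) \<in> borel_measurable lebesgue" by measurable
    have "N (\<lambda>x. ennreal ((1 - t) * f x + t * g x)) = N (\<lambda>x. ennreal (1 - t) * ennreal (f x) + ennreal t * ennreal (g x))"
      using fg t by (simp add: ennreal_mult')
    also have "\<dots> \<le> N (\<lambda>x. ennreal (1 - t) * ennreal (f x)) + N (\<lambda>x. ennreal t * ennreal (g x))"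
      by (intro add) auto
    also have "\<dots> \<le> ennreal (1 - t) * N (\<lambda>x. ennreal (f x)) + ennreal t * N (\<lambda>x. ennreal (g x))"
      using t by (intro add_mono scale) auto
    also have "\<dots> \<le> ennreal (1 - t) * 1 + ennreal t * 1" by (intro add_mono mult_left_mono fg) auto
    also have "\<dots> = 1" using t by (simp add: ennreal_plus[symmetric] del: ennreal_plus)
    finally show "N (\<lambda>x. ennreal ((1 - t) * f x + t * g x)) \<le> 1" .
  qed
  \<comment> \<open>parallelogram law: the midpoint of two almost minimizers lies in \<open>K\<close>\<close>
  have incr: "(\<integral>x. (b (Suc k) x - b k x)\<^sup>2 \<partial>lebesgue) \<le> 4 * (1/8) ^ k" for k
  proof -
    let ?f = "b k" and ?g = "b (Suc k)"
    let ?m = "\<lambda>x. (1 - 1/2) * ?f x + 1/2 * ?g x"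
    have fK: "?f \<in> borel_measurable lebesgue" "\<And>x. 0 \<le> ?f x" "\<And>x. ?f x \<le> h x" "N (\<lambda>x. ennreal (?f x)) \<le> 1"
      and gK: "?g \<in> borel_measurable lebesgue" "\<And>x. 0 \<le> ?g x" "\<And>x. ?g x \<le> h x" "N (\<lambda>x. ennreal (?g x)) \<le> 1"
      using bK[of k] bK[of "Suc k"] by (auto simp: K_def)
    have mK: "?m \<in> K"
    proof -
      have "0 \<le> ?m x \<and> ?m x \<le> h x" for x
        using fK(2,3)[of x] gK(2,3)[of x] by (auto simp: field_simps)
      then show ?thesis
        unfolding K_def using convex[OF fK(1) gK(1) fK(2) gK(2) fK(4) gK(4), of "1/2"] by auto
    qed
    have "(\<integral>x. (?g x - ?f x)\<^sup>2 \<partial>lebesgue) = (\<integral>x. 2 * (h x - ?f x)\<^sup>2 + 2 * (h x - ?g x)\<^sup>2 - 4 * (h x - ?m x)\<^sup>2 \<partial>lebesgue)"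
      by (intro Bochner_Integration.integral_cong) (auto simp: power2_eq_square field_simps)
    also have "\<dots> = 2 * D ?f + 2 * D ?g - 4 * D ?m"
      unfolding D_def using hbint[OF bK[of k]] hbint[OF bK[of "Suc k"]] hbint[OF mK]
      by (simp add: Bochner_Integration.integral_diff Bochner_Integration.integral_add)
    also have "\<dots> \<le> 2 * (I + (1/8) ^ k) + 2 * (I + (1/8) ^ k) - 4 * I"
    proof -
      \<comment> \<open>stated for variables, because the integrals obscure the linear arithmetic\<close>
      have lin: "2 * p + 2 * q - 4 * d \<le> 2 * (I + e) + 2 * (I + e) - 4 * I"
        if "p < I + e" "q < I + e'" "e' \<le> e" "I \<le> d" for p q d e e' :: real
        using that by argo
      show ?thesis by (rule lin[OF bI[of k] bI[of "Suc k"] _ ID[OF mK]]) simp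
    qed
    finally show ?thesis by simp
  qed
  have bm [measurable]: "b k \<in> borel_measurable lebesgue" for k using bK[of k] by (simp add: K_def)
  have "(\<integral>\<^sup>+x. (\<Sum>k. ennreal (4 ^ k * (b (Suc k) x - b k x)\<^sup>2)) \<partial>lebesgue)
      = (\<Sum>k. \<integral>\<^sup>+x. ennreal (4 ^ k * (b (Suc k) x - b k x)\<^sup>2) \<partial>lebesgue)"
    by (intro nn_integral_suminf) measurable
  also have "\<dots> \<le> (\<Sum>k. ennreal (4 * (1/2) ^ k))"
  proof (intro suminf_le)
    fix k
    have "(\<integral>\<^sup>+x. ennreal (4 ^ k * (b (Suc k) x - b k x)\<^sup>2) \<partial>lebesgue) = ennreal (\<integral>x. 4 ^ k * (b (Suc k) x - b k x)\<^sup>2 \<partial>lebesgue)"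
      by (intro nn_integral_eq_integral integrable_mult_right sqint bK AE_I2) auto
    also have "\<dots> \<le> ennreal (4 ^ k * (4 * (1/8) ^ k))"
      using incr[of k] by (intro ennreal_leI) simp
    also have "4 ^ k * (4 * (1/8) ^ k) = 4 * (1/2 :: real) ^ k"
    proof -
      have "(4 :: real) ^ k * (1/8) ^ k = (4 * (1/8)) ^ k" by (rule power_mult_distrib[symmetric])
      then show ?thesis by simp
    qed
    finally show "(\<integral>\<^sup>+x. ennreal (4 ^ k * (b (Suc k) x - b k x)\<^sup>2) \<partial>lebesgue) \<le> ennreal (4 * (1/2) ^ k)" .
  qed auto
  also have "\<dots> = ennreal 8"
    by (rule suminf_ennreal_eq) (use sums_mult[OF geometric_sums[of "1/2 :: real"], of 4] in auto)
  also have "\<dots> < top" by simp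
  finally have "AE x in lebesgue. (\<Sum>k. ennreal (4 ^ k * (b (Suc k) x - b k x)\<^sup>2)) \<noteq> \<infinity>"
    by (intro nn_integral_noteq_infinite) auto
  then have conv: "AE x in lebesgue. convergent (\<lambda>k. b k x)"
    by (rule eventually_mono) (auto intro: convergent_of_geometric_increments simp: less_top)
  \<comment> \<open>the lower limit is defined everywhere and agrees with the limit almost everywhere\<close>
  define L where "L x = liminf (\<lambda>k. ennreal (b k x))" for x
  define bb where "bb x = enn2real (L x)" for x
  have b0: "0 \<le> b k x" "b k x \<le> h x" for k x using bK[of k] by (auto simp: K_def)
  have Lh: "L x \<le> ennreal (h x)" for x
    unfolding L_def
    by (rule order_trans[OF Liminf_le_Limsup Limsup_bounded]) (auto intro!: always_eventually ennreal_leI b0)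
  then have Lfin: "L x < top" for x by (rule le_less_trans) simp
  then have bbL: "ennreal (bb x) = L x" for x by (simp add: bb_def)
  have [measurable]: "L \<in> meas" unfolding L_def by measurable
  have bbm [measurable]: "bb \<in> borel_measurable lebesgue" unfolding bb_def by measurable
  have bb0: "0 \<le> bb x" "bb x \<le> h x" for x
    using Lh[of x] h0[of x] unfolding bbL[symmetric] by (auto simp: bb_def)
  have lim: "AE x in lebesgue. (\<lambda>k. b k x) \<longlonglongrightarrow> bb x"
    using conv
  proof eventually_elim
    case (elim x)
    then obtain l where l: "(\<lambda>k. b k x) \<longlonglongrightarrow> l" by (auto simp: convergent_def)
    then have "0 \<le> l" using b0 by (intro LIMSEQ_le_const) auto
    have "(\<lambda>k. ennreal (b k x)) \<longlonglongrightarrow> ennreal l" using l by (intro tendsto_ennrealI)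
    then have "L x = ennreal l" unfolding L_def by (intro lim_imp_Liminf) auto
    then show ?case using l \<open>0 \<le> l\<close> by (simp add: bb_def)
  qed
  have "N (\<lambda>x. ennreal (bb x)) = N (\<lambda>x. SUP n. INF m\<in>{n..}. ennreal (b m x))"
    by (simp add: bbL L_def liminf_SUP_INF)
  also have "\<dots> \<le> (SUP n. N (\<lambda>x. INF m\<in>{n..}. ennreal (b m x)))"
    by (intro sup) (auto simp: incseq_def intro!: INF_superset_mono)
  also have "\<dots> \<le> 1"
  proof (intro SUP_least)
    fix n
    have "N (\<lambda>x. INF m\<in>{n..}. ennreal (b m x)) \<le> N (\<lambda>x. ennreal (b n x))"
      by (intro mono') (auto intro: INF_lower)
    also have "\<dots> \<le> 1" using bK[of n] by (simp add: K_def)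
    finally show "N (\<lambda>x. INF m\<in>{n..}. ennreal (b m x)) \<le> 1" .
  qed
  finally have Nbb: "N (\<lambda>x. ennreal (bb x)) \<le> 1" .
  have bbK: "bb \<in> K" using Nbb bb0 by (simp add: K_def)
  have "(\<lambda>k. D (b k)) \<longlonglongrightarrow> D bb"
    unfolding D_def
  proof (rule integral_dominated_convergence[where w = "\<lambda>x. (h x)\<^sup>2"])
    show "integrable lebesgue (\<lambda>x. (h x)\<^sup>2)" using hbint[OF zK] by simp
    show "AE x in lebesgue. (\<lambda>k. (h x - b k x)\<^sup>2) \<longlonglongrightarrow> (h x - bb x)\<^sup>2"
      using lim by eventually_elim (intro tendsto_intros)
    show "AE x in lebesgue. norm ((h x - b k x)\<^sup>2) \<le> (h x)\<^sup>2" for k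
      using b0 by (intro AE_I2) (auto intro!: power_mono)
  qed measurable
  moreover have "(\<lambda>k. I + (1/8) ^ k) \<longlonglongrightarrow> I + 0"
    by (intro tendsto_intros LIMSEQ_realpow_zero) auto
  ultimately have "D bb \<le> I + 0"
    by (rule LIMSEQ_le) (use bI less_imp_le in blast)
  then have Dbb: "D bb \<le> D b'" if "b' \<in> K" for b' using ID[OF that] by simp
  define g where "g x = h x - bb x" for x
  have gm [measurable]: "g \<in> borel_measurable lebesgue" unfolding g_def by measurable
  have g0: "0 \<le> g x" "g x \<le> \<bar>c\<bar>" "x \<notin> F \<Longrightarrow> g x = 0" for x
    using bb0[of x] hc1[of x] hF[of x] by (auto simp: g_def)
  have bbint: "integrable lebesgue (\<lambda>x. g x * bb x)"
  proof (rule int)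
    show "\<bar>g x * bb x\<bar> \<le> \<bar>c\<bar> * \<bar>c\<bar>" for x
      unfolding abs_mult using g0(1,2)[of x] bb0[of x] hc1[of x] by (intro mult_mono) auto
  qed (use g0 in auto)
  \<comment> \<open>the first variation, for bounded competitors supported in \<open>F\<close>\<close>
  have vari: "(\<integral>x. g x * k x \<partial>lebesgue) \<le> (\<integral>x. g x * bb x \<partial>lebesgue)"
    if k [measurable]: "k \<in> borel_measurable lebesgue" and k0: "\<And>x. 0 \<le> k x" "\<And>x. k x \<le> M" "\<And>x. x \<notin> F \<Longrightarrow> k x = 0"
      and Nk: "N (\<lambda>x. ennreal (k x)) \<le> 1" for k M
  proof -
    have M: "0 \<le> M" using k0(1)[of undefined] k0(2)[of undefined] by simp
    let ?d = "\<lambda>x. k x - bb x"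
    have dF: "?d x = 0" if "x \<notin> F" for x using k0(3)[OF that] bb0[of x] hF[OF that] by simp
    have dM: "\<bar>?d x\<bar> \<le> M + \<bar>c\<bar>" for x using k0(1,2)[of x] bb0[of x] hc1[of x] by (auto simp: abs_le_iff)
    have i1: "integrable lebesgue (\<lambda>x. g x * ?d x)"
    proof (rule int)
      show "\<bar>g x * ?d x\<bar> \<le> \<bar>c\<bar> * (M + \<bar>c\<bar>)" for x
        unfolding abs_mult using g0(1,2)[of x] dM[of x] by (intro mult_mono) auto
    qed (use dF in auto)
    have i2: "integrable lebesgue (\<lambda>x. (?d x)\<^sup>2)"
    proof (rule int)
      show "\<bar>(?d x)\<^sup>2\<bar> \<le> (M + \<bar>c\<bar>)\<^sup>2" for x using power_mono[OF dM[of x], of 2] by simp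
    qed (use dF in auto)
    have i3: "integrable lebesgue (\<lambda>x. (g x)\<^sup>2)" using hbint[OF bbK] by (simp add: g_def)
    \<comment> \<open>expand the square in \<open>D bb \<le> D y\<close> and divide by \<open>t\<close>\<close>
    have ineq: "2 * (\<integral>x. g x * ?d x \<partial>lebesgue) \<le> t * (\<integral>x. (?d x)\<^sup>2 \<partial>lebesgue)" if t: "0 < t" "t < 1" for t
    proof -
      \<comment> \<open>a competitor on the segment towards \<open>k\<close>, cut off at \<open>h\<close> to stay in \<open>K\<close>\<close>
      define z where "z x = (1 - t) * bb x + t * k x" for x
      note cz = convex[OF bbm k bb0(1) k0(1) Nbb Nk t]
      have [measurable]: "z \<in> borel_measurable lebesgue" unfolding z_def by measurable
      have z0: "0 \<le> z x" for x using bb0[of x] k0(1)[of x] t by (simp add: z_def)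
      define y where "y x = min (z x) (h x)" for x
      have [measurable]: "y \<in> borel_measurable lebesgue" unfolding y_def by measurable
      have "N (\<lambda>x. ennreal (y x)) \<le> N (\<lambda>x. ennreal (z x))"
        by (intro mono') (auto simp: y_def intro!: ennreal_leI)
      also have "\<dots> \<le> 1" using cz(2) by (simp add: z_def)
      finally have yK: "y \<in> K" using z0 h0 by (auto simp: K_def y_def)
      have i4: "integrable lebesgue (\<lambda>x. (g x)\<^sup>2 - 2 * t * (g x * ?d x) + t\<^sup>2 * (?d x)\<^sup>2)"
        using i1 i2 i3 by (intro Bochner_Integration.integrable_add Bochner_Integration.integrable_diff integrable_mult_right)
      have "D bb \<le> D y" by (rule Dbb[OF yK])
      also have "\<dots> \<le> (\<integral>x. (g x)\<^sup>2 - 2 * t * (g x * ?d x) + t\<^sup>2 * (?d x)\<^sup>2 \<partial>lebesgue)"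
        unfolding D_def
      proof (rule integral_mono[OF hbint[OF yK] i4])
        fix x
        have "(h x - y x)\<^sup>2 \<le> (h x - z x)\<^sup>2"
          by (rule abs_le_square_iff[THEN iffD1]) (auto simp: y_def)
        also have "\<dots> = (g x)\<^sup>2 - 2 * t * (g x * ?d x) + t\<^sup>2 * (?d x)\<^sup>2"
          by (simp add: g_def z_def power2_eq_square algebra_simps)
        finally show "(h x - y x)\<^sup>2 \<le> (g x)\<^sup>2 - 2 * t * (g x * ?d x) + t\<^sup>2 * (?d x)\<^sup>2" .
      qed
      also have "\<dots> = D bb - 2 * t * (\<integral>x. g x * ?d x \<partial>lebesgue) + t\<^sup>2 * (\<integral>x. (?d x)\<^sup>2 \<partial>lebesgue)"
        using i1 i2 i3 by (simp add: D_def g_def)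
      finally have "t * (2 * (\<integral>x. g x * ?d x \<partial>lebesgue)) \<le> t * (t * (\<integral>x. (?d x)\<^sup>2 \<partial>lebesgue))"
        by (simp add: power2_eq_square algebra_simps)
      then show ?thesis using t by simp
    qed
    have "2 * (\<integral>x. g x * ?d x \<partial>lebesgue) \<le> 0"
    proof (rule tendsto_le[OF trivial_limit_at_right_real[of 0]])
      have "((\<lambda>t. t * (\<integral>x. (?d x)\<^sup>2 \<partial>lebesgue)) \<longlongrightarrow> 0 * (\<integral>x. (?d x)\<^sup>2 \<partial>lebesgue)) (at_right 0)"
        by (intro tendsto_intros)
      then show "((\<lambda>t. t * (\<integral>x. (?d x)\<^sup>2 \<partial>lebesgue)) \<longlongrightarrow> 0) (at_right 0)" by simp
      show "((\<lambda>t. 2 * (\<integral>x. g x * ?d x \<partial>lebesgue)) \<longlongrightarrow> 2 * (\<integral>x. g x * ?d x \<partial>lebesgue)) (at_right 0)"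
        by (rule tendsto_const)
      show "\<forall>\<^sub>F t in at_right 0. 2 * (\<integral>x. g x * ?d x \<partial>lebesgue) \<le> t * (\<integral>x. (?d x)\<^sup>2 \<partial>lebesgue)"
        using ineq unfolding eventually_at_right_field by (intro exI[of _ 1]) auto
    qed
    moreover have "(\<integral>x. g x * k x \<partial>lebesgue) = (\<integral>x. g x * ?d x + g x * bb x \<partial>lebesgue)"
      by (simp add: algebra_simps)
    moreover have "\<dots> = (\<integral>x. g x * ?d x \<partial>lebesgue) + (\<integral>x. g x * bb x \<partial>lebesgue)"
      by (rule Bochner_Integration.integral_add[OF i1 bbint])
    ultimately show ?thesis by simp
  qed
  \<comment> \<open>exhaust an arbitrary element of the unit ball by such competitors\<close>
  have dg: "dual_norm N (\<lambda>x. ennreal (g x)) \<le> ennreal (\<integral>x. g x * bb x \<partial>lebesgue)"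
  proof (rule dual_norm_least)
    fix f :: "real ^ 'n \<Rightarrow> ennreal" assume f [measurable]: "f \<in> meas" and Nf: "N f \<le> 1"
    define k where "k m x = enn2real (min (f x) (ennreal (real m))) * indicator F x" for m x
    have kf: "ennreal (k m x) = min (f x) (ennreal (real m)) * indicator F x" for m x
    proof -
      have "min (f x) (ennreal (real m)) < top" by (simp add: min_less_iff_disj)
      then show ?thesis by (auto simp: k_def indicator_def)
    qed
    have km [measurable]: "k m \<in> borel_measurable lebesgue" for m unfolding k_def by measurable
    have kM: "0 \<le> k m x" "k m x \<le> real m" "x \<notin> F \<Longrightarrow> k m x = 0" for m x
    proof -
      have "enn2real (min (f x) (ennreal (real m))) \<le> real m" by (rule enn2real_leI) auto
      then show "0 \<le> k m x" "k m x \<le> real m" "x \<notin> F \<Longrightarrow> k m x = 0" by (auto simp: k_def indicator_def)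
    qed
    have "(\<integral>\<^sup>+x. ennreal (k m x) * ennreal (g x) \<partial>lebesgue) \<le> ennreal (\<integral>x. g x * bb x \<partial>lebesgue)" for m
    proof -
      have "N (\<lambda>x. ennreal (k m x)) \<le> N f"
        by (intro mono') (auto simp: kf indicator_def)
      then have "N (\<lambda>x. ennreal (k m x)) \<le> 1" using Nf by simp
      then have le: "(\<integral>x. g x * k m x \<partial>lebesgue) \<le> (\<integral>x. g x * bb x \<partial>lebesgue)"
        by (intro vari[where M = "real m"] km kM)
      have ki: "integrable lebesgue (\<lambda>x. g x * k m x)"
      proof (rule int)
        show "\<bar>g x * k m x\<bar> \<le> \<bar>c\<bar> * real m" for x
          unfolding abs_mult using g0(1,2)[of x] kM(1,2)[of m x] by (intro mult_mono) auto
      qed (use g0 in auto)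
      have "(\<integral>\<^sup>+x. ennreal (k m x) * ennreal (g x) \<partial>lebesgue) = (\<integral>\<^sup>+x. ennreal (g x * k m x) \<partial>lebesgue)"
        using g0 kM by (intro nn_integral_cong) (simp add: ennreal_mult'' mult.commute)
      also have "\<dots> = ennreal (\<integral>x. g x * k m x \<partial>lebesgue)"
        using g0 kM by (intro nn_integral_eq_integral ki) auto
      also have "\<dots> \<le> ennreal (\<integral>x. g x * bb x \<partial>lebesgue)" by (rule ennreal_leI[OF le])
      finally show ?thesis .
    qed
    note kle = this
    have "f x * ennreal (g x) = (SUP m. ennreal (k m x) * ennreal (g x))" for x
    proof (cases "x \<in> F")
      case True
      have "f x = (SUP m::nat. min (f x) (of_nat m))"
      proof (cases "f x")
        case (real r)
        obtain m :: nat where "r \<le> real m" using real_arch_simple by blast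
        then have "f x \<le> min (f x) (of_nat m)" using real by (simp add: ennreal_of_nat_eq_real_of_nat)
        also have "\<dots> \<le> (SUP m::nat. min (f x) (of_nat m))" by (rule SUP_upper) simp
        finally show ?thesis by (intro antisym SUP_least) auto
      next
        case top
        then show ?thesis by (simp add: ennreal_SUP_of_nat_eq_top)
      qed
      then show ?thesis using True by (simp add: kf SUP_mult_right_ennreal[symmetric] ennreal_of_nat_eq_real_of_nat)
    qed (simp add: g0)
    then have "(\<integral>\<^sup>+x. f x * ennreal (g x) \<partial>lebesgue) = (\<integral>\<^sup>+x. (SUP m. ennreal (k m x) * ennreal (g x)) \<partial>lebesgue)" by simp
    also have "\<dots> = (SUP m. \<integral>\<^sup>+x. ennreal (k m x) * ennreal (g x) \<partial>lebesgue)"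
    proof (rule nn_integral_monotone_convergence_SUP)
      show "incseq (\<lambda>m x. ennreal (k m x) * ennreal (g x))"
        unfolding incseq_def le_fun_def kf
        by (intro allI impI mult_right_mono min.mono ennreal_leI) auto
    qed measurable
    also have "\<dots> \<le> ennreal (\<integral>x. g x * bb x \<partial>lebesgue)" by (intro SUP_least kle)
    finally show "(\<integral>\<^sup>+x. f x * ennreal (g x) \<partial>lebesgue) \<le> ennreal (\<integral>x. g x * bb x \<partial>lebesgue)" .
  qed
  have ihg: "integrable lebesgue (\<lambda>x. h x * g x)"
  proof (rule int)
    show "\<bar>h x * g x\<bar> \<le> \<bar>c\<bar> * \<bar>c\<bar>" for x
      unfolding abs_mult using g0(1,2)[of x] h0[of x] hc1[of x] by (intro mult_mono) auto
  qed (use g0 in auto)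
  have i3: "integrable lebesgue (\<lambda>x. (g x)\<^sup>2)" using hbint[OF bbK] by (simp add: g_def)
  have bbnn: "0 \<le> (\<integral>x. g x * bb x \<partial>lebesgue)" using g0 bb0 by (intro integral_nonneg_AE AE_I2) auto
  have "ennreal (\<integral>x. h x * g x \<partial>lebesgue) = (\<integral>\<^sup>+x. ennreal (h x) * ennreal (g x) \<partial>lebesgue)"
    using h0 g0 by (subst nn_integral_eq_integral[OF ihg, symmetric]) (auto simp: ennreal_mult)
  also have "\<dots> \<le> dual_norm N (\<lambda>x. ennreal (g x))" by (intro dual) measurable
  also have "\<dots> \<le> ennreal (\<integral>x. g x * bb x \<partial>lebesgue)" by (rule dg)
  finally have "(\<integral>x. h x * g x \<partial>lebesgue) \<le> (\<integral>x. g x * bb x \<partial>lebesgue)" using bbnn by simp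
  moreover have "(\<integral>x. h x * g x \<partial>lebesgue) = (\<integral>x. g x * bb x + (g x)\<^sup>2 \<partial>lebesgue)"
    by (simp add: g_def power2_eq_square algebra_simps)
  moreover have "\<dots> = (\<integral>x. g x * bb x \<partial>lebesgue) + (\<integral>x. (g x)\<^sup>2 \<partial>lebesgue)"
    by (rule Bochner_Integration.integral_add[OF bbint i3])
  ultimately have "(\<integral>x. (g x)\<^sup>2 \<partial>lebesgue) \<le> 0" by simp
  then have "(\<integral>x. (g x)\<^sup>2 \<partial>lebesgue) = 0" by (intro antisym integral_nonneg_AE) auto
  then have "AE x in lebesgue. (g x)\<^sup>2 = 0"
    by (subst (asm) integral_nonneg_eq_0_iff_AE[OF i3]) auto
  then have "AE x in lebesgue. ennreal (h x) \<le> ennreal (bb x)"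
    by (rule eventually_mono) (simp add: g_def)
  then have "N (\<lambda>x. ennreal (h x)) \<le> N (\<lambda>x. ennreal (bb x))" by (intro mono) auto
  with Nbb show ?thesis by simp
qed

text \<open>
The norm is dominated by the norm of the second dual. Truncation and the Fatou property reduce this to bounded
functions with bounded support.
\<close>

theorem (in function_norm) lorentz_luxemburg:
  assumes f [measurable]: "f \<in> meas" and K: "0 < K"
    and dual: "\<And>u. u \<in> meas \<Longrightarrow> dual_norm N u < top \<Longrightarrow> (\<integral>\<^sup>+x. f x * u x \<partial>lebesgue) \<le> ennreal K * dual_norm N u"
  shows "N f \<le> ennreal K"
proof -
  define F where "F m = (ball 0 (real m) :: (real ^ 'n) set)" for m :: nat
  have F [measurable]: "F m \<in> sets lebesgue" for m by (simp add: F_def)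
  have Ffin: "vol (F m) < top" for m
    unfolding F_def using lmeasurable_ball[of 0 "real m"] by (simp add: fmeasurable_def)
  define k where "k m x = min (f x) (ennreal (real m)) * indicator (F m) x" for m x
  have [measurable]: "k m \<in> meas" for m unfolding k_def by measurable
  have inc: "incseq (\<lambda>m. k m x)" for x
    unfolding incseq_def k_def F_def
    by (intro allI impI mult_mono min.mono ennreal_leI indicator_mono subset_ball) auto
  have Nk: "N (k m) \<le> ennreal K" for m
  proof -
    define h where "h x = enn2real (k m x) / K" for x
    have kle: "k m x \<le> ennreal (real m) * indicator (F m) x" for x
      unfolding k_def by (intro mult_right_mono) auto
    have kfin: "k m x < top" for x using le_less_trans[OF kle] by (auto simp: indicator_def)
    have kh: "k m x = ennreal K * ennreal (h x)" for x
      using K kfin[of x] by (simp add: h_def ennreal_mult'[symmetric])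
    have "N (\<lambda>x. ennreal (h x)) \<le> 1"
    proof (rule lorentz_luxemburg_bounded[OF _ F Ffin])
      show "h \<in> borel_measurable lebesgue" unfolding h_def by measurable
      show "0 \<le> h x" for x using K by (simp add: h_def)
      show "h x \<le> real m / K * indicator (F m) x" for x
      proof -
        have "enn2real (k m x) \<le> real m * indicator (F m) x"
          using kle[of x] by (intro enn2real_leI) (auto simp: indicator_def)
        then show ?thesis using K by (auto simp: h_def indicator_def divide_right_mono)
      qed
      fix u :: "real ^ 'n \<Rightarrow> ennreal" assume u [measurable]: "u \<in> meas"
      show "(\<integral>\<^sup>+x. ennreal (h x) * u x \<partial>lebesgue) \<le> dual_norm N u"
      proof (cases "dual_norm N u < top")
        case True
        have [measurable]: "h \<in> borel_measurable lebesgue" unfolding h_def by measurable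
        have "ennreal K * (\<integral>\<^sup>+x. ennreal (h x) * u x \<partial>lebesgue) = (\<integral>\<^sup>+x. k m x * u x \<partial>lebesgue)"
          by (subst nn_integral_cmult[symmetric]) (auto simp: kh mult.assoc)
        also have "\<dots> \<le> (\<integral>\<^sup>+x. f x * u x \<partial>lebesgue)"
          by (intro nn_integral_mono mult_right_mono) (auto simp: k_def indicator_def)
        also have "\<dots> \<le> ennreal K * dual_norm N u" by (rule dual[OF u True])
        finally show ?thesis using K by (subst (asm) ennreal_mult_le_mult_iff) auto
      qed (simp add: not_less top.extremum_unique)
    qed
    have [measurable]: "h \<in> borel_measurable lebesgue" unfolding h_def by measurable
    have "N (k m) = N (\<lambda>x. ennreal K * ennreal (h x))" by (simp only: kh[symmetric])
    also have "\<dots> \<le> ennreal K * N (\<lambda>x. ennreal (h x))" using K by (intro scale) auto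
    also have "\<dots> \<le> ennreal K * 1" by (intro mult_left_mono) (use \<open>N (\<lambda>x. ennreal (h x)) \<le> 1\<close> in auto)
    finally show ?thesis by simp
  qed
  have sup_k: "f x \<le> (SUP m. k m x)" for x
  proof (rule ccontr)
    assume "\<not> ?thesis"
    then have lt: "(SUP m. k m x) < f x" by simp
    obtain c where c: "(SUP m. k m x) < c" "c < f x" using dense[OF lt] by blast
    then obtain r where r: "c = ennreal r" "0 \<le> r" by (cases c) auto
    obtain m :: nat where m: "max r (norm x + 1) \<le> real m" using real_arch_simple by blast
    then have "x \<in> F m" by (simp add: F_def)
    then have "c \<le> k m x" using m c r by (auto simp: k_def intro!: ennreal_leI)
    also have "\<dots> \<le> (SUP m. k m x)" by (rule SUP_upper) simp
    finally show False using c(1) by simp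
  qed
  have "N f \<le> N (\<lambda>x. SUP m. k m x)" by (intro mono' sup_k) auto
  also have "\<dots> \<le> (SUP m. N (k m))" by (intro sup inc) auto
  also have "\<dots> \<le> ennreal K" by (intro SUP_least Nk)
  finally show ?thesis .
qed

section \<open>Self-improvement of the bounds on a space and its dual\<close>

lemma max_boundedI_finite:
  assumes K: "1 \<le> K" and le: "\<And>f. f \<in> meas \<Longrightarrow> N f < top \<Longrightarrow> N (emax f) \<le> ennreal K * N f"
  shows "max_bounded K N"
  unfolding max_bounded_def
proof (intro conjI ballI K)
  fix f :: "real ^ 'a \<Rightarrow> ennreal" assume f: "f \<in> meas"
  show "N (emax f) \<le> ennreal K * N f"
  proof (cases "N f < top")
    case False
    then have "N f = top" by (simp only: not_less top.extremum_unique)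
    moreover have "ennreal K \<noteq> 0" using K by (subst ennreal_eq_0_iff) linarith
    ultimately show ?thesis by (simp only: ennreal_mult_top if_False top_greatest)
  qed (rule le[OF f])
qed

lemma max_boundedI:
  assumes K: "1 \<le> K" and le: "\<And>f a. f \<in> meas \<Longrightarrow> 0 < a \<Longrightarrow> N f \<le> ennreal a \<Longrightarrow> N (emax f) \<le> ennreal (K * a)"
  shows "max_bounded K N"
proof (rule max_boundedI_finite[OF K])
  fix f :: "real ^ 'a \<Rightarrow> ennreal" assume f: "f \<in> meas" and "N f < top"
  then obtain a where a: "N f = ennreal a" "0 \<le> a" by (cases "N f") auto
  show "N (emax f) \<le> ennreal K * N f"
  proof (rule ennreal_le_epsilon)
    fix e :: real assume e: "0 < e"
    have "N (emax f) \<le> ennreal (K * (a + e / K))"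
      using a e K by (intro le f) (auto intro: ennreal_leI add_nonneg_pos)
    also have "K * (a + e / K) = K * a + e" using K by (simp add: field_simps)
    also have "ennreal (K * a + e) = ennreal K * N f + ennreal e"
      using a e K by (simp add: ennreal_mult')
    finally show "N (emax f) \<le> ennreal K * N f + ennreal e" .
  qed
qed

lemma AE_zero_or_A1_weight:
  fixes W :: "real ^ 'n::finite \<Rightarrow> ennreal"
  assumes "W \<in> meas" "1 \<le> C" "\<And>x. emax W x \<le> ennreal C * W x" "AE x in lebesgue. W x < top"
  obtains "AE x in lebesgue. W x = 0" | "A1_weight C W"
  using A1_weightI[OF assms] by blast

lemma (in function_norm) rubio_de_francia_A1:
  assumes B: "max_bounded B N" and f [measurable]: "f \<in> meas" and fin: "N f < top"
  obtains W where "W \<in> meas" "\<And>x. f x \<le> W x" "N W \<le> 2 * N f" "\<And>x. emax W x \<le> ennreal (2 * B) * W x"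
    "AE x in lebesgue. W x < top" "(AE x in lebesgue. f x = 0) \<or> A1_weight (2 * B) W"
proof -
  obtain W where W: "W \<in> meas" "\<And>x. f x \<le> W x" "N W \<le> 2 * N f" "\<And>x. emax W x \<le> ennreal (2 * B) * W x"
    using rubio_de_francia[OF B f] by metis
  have "N W < top" using W(3) fin by (auto simp: ennreal_mult_less_top intro: le_less_trans)
  then have Wfin: "AE x in lebesgue. W x < top" by (rule finite_AE[OF W(1)])
  have B1: "1 \<le> 2 * B" using B by (simp add: max_bounded_def)
  have "(AE x in lebesgue. f x = 0) \<or> A1_weight (2 * B) W"
  proof (rule AE_zero_or_A1_weight[OF W(1) B1 W(4) Wfin])
    assume "AE x in lebesgue. W x = 0"
    then have "AE x in lebesgue. f x = 0"
      by (rule eventually_mono) (use W(2) in \<open>metis le_zero_eq\<close>)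
    then show ?thesis ..
  qed blast
  then show ?thesis using that W Wfin by blast
qed

lemma emax_zero_AE:
  assumes "AE x in lebesgue. f x = 0"
  shows "emax f x = 0"
proof -
  have "emax f x \<le> emax (\<lambda>x. 0) x"
    by (intro emax_mono_AE eventually_mono[OF assms]) auto
  also have "\<dots> \<le> 0" by (rule emax_least) simp
  finally show ?thesis by simp
qed

text \<open>
For \<open>F = epow f (1 / r)\<close> with Rubio de Francia majorant \<open>W\<close>, the power \<open>epow W r\<close> is an \<open>A\<^sub>1\<close> weight when
\<open>r\<close> is close to 1, so \<open>emax f \<le> emax (epow W r) \<le> C * epow W r\<close>, and the norm of \<open>W\<close> is at most twice that of \<open>F\<close>.
\<close>

lemma (in function_norm) max_bounded_conc:
  assumes B: "max_bounded B N"
  obtains r0 where "1 < r0" "\<And>r. 1 < r \<Longrightarrow> r \<le> r0 \<Longrightarrow> \<exists>K. max_bounded K (conc r N)"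
proof -
  have B1: "1 \<le> 2 * B" using B by (simp add: max_bounded_def)
  obtain r0 where r0: "1 < r0" "\<And>(w :: real ^ 'n \<Rightarrow> ennreal) r. A1_weight (2 * B) w \<Longrightarrow> 1 < r \<Longrightarrow> r \<le> r0 \<Longrightarrow>
    A1_weight (2 * (2 * B) powr r) (\<lambda>x. epow (w x) r)"
    using A1_weight_power[OF B1, where 'n = 'n] by metis
  show thesis
  proof (rule that[OF r0(1)])
    fix r assume r: "1 < r" "r \<le> r0"
    let ?C = "2 * (2 * B) powr r"
    let ?K = "?C * 2 powr r"
    have C1: "1 \<le> (2 * B) powr r" using B1 r by (intro ge_one_powr_ge_zero) auto
    have K1: "1 \<le> ?K"
    proof -
      have "1 * 1 \<le> ?C * 2 powr r" using C1 r by (intro mult_mono ge_one_powr_ge_zero) auto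
      then show ?thesis by simp
    qed
    have "max_bounded ?K (conc r N)"
    proof (rule max_boundedI_finite[OF K1])
      fix f :: "real ^ 'n \<Rightarrow> ennreal" assume f [measurable]: "f \<in> meas" and fin: "conc r N f < top"
      let ?F = "\<lambda>x. epow (f x) (1 / r)"
      have Fm: "?F \<in> meas" by measurable
      have "N ?F < top" using fin by (simp add: conc_def)
      then obtain W where W: "W \<in> meas" "\<And>x. ?F x \<le> W x" "N W \<le> 2 * N ?F"
        "(AE x in lebesgue. ?F x = 0) \<or> A1_weight (2 * B) W"
        using rubio_de_francia_A1[OF B Fm] by metis
      note [measurable] = W(1)
      show "conc r N (emax f) \<le> ennreal ?K * conc r N f"
      proof (cases "AE x in lebesgue. ?F x = 0")
        case True
        then have "AE x in lebesgue. f x = 0" by simp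
        then have "emax f = (\<lambda>x. 0)" by (intro ext emax_zero_AE)
        then show ?thesis by (simp add: conc_def zero)
      next
        case False
        then have A1: "A1_weight ?C (\<lambda>x. epow (W x) r)" using W(4) r by (intro r0) auto
        have fW: "f x \<le> epow (W x) r" for x
          using epow_mono[OF W(2)[of x], of r] r by simp
        have "AE x in lebesgue. emax (\<lambda>x. epow (W x) r) x \<le> ennreal ?C * epow (W x) r"
          using A1 by (simp add: A1_weight_def)
        then have "AE x in lebesgue. emax f x \<le> ennreal ?C * epow (W x) r"
        proof eventually_elim
          case (elim x)
          have "emax f x \<le> emax (\<lambda>x. epow (W x) r) x" by (intro emax_mono_AE AE_I2 fW)
          then show ?case using elim by simp
        qed
        then have "conc r N (emax f) \<le> conc r N (\<lambda>x. ennreal ?C * epow (W x) r)"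
          using r by (intro conc_mono) auto
        also have "\<dots> \<le> ennreal ?C * conc r N (\<lambda>x. epow (W x) r)"
          using r C1 by (intro conc_scale scale) auto
        also have "conc r N (\<lambda>x. epow (W x) r) = epow (N W) r" using r by (simp add: conc_def)
        also have "\<dots> \<le> epow (2 * N ?F) r" using W(3) r by (intro epow_mono) auto
        also have "\<dots> = ennreal (2 powr r) * conc r N f"
          using epow_ennreal[of 2 r] by (simp add: conc_def epow_mult)
        also have "ennreal ?C * (ennreal (2 powr r) * conc r N f) = ennreal ?K * conc r N f"
          by (intro ennreal_mult_assoc) simp
        finally show ?thesis by (simp add: mult_left_mono)
      qed
    qed
    then show "\<exists>K. max_bounded K (conc r N)" by blast
  qed
qed

text \<open>
The geometric mean of \<open>x\<close> and \<open>y\<close> with weights \<open>1 / r\<close> and \<open>1 - 1 / r\<close> is at most their maximum.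
\<close>

lemma epow_interpolate:
  assumes r: "1 < r"
  shows "epow (x * epow y (r - 1)) (1 / r) \<le> x + y"
proof -
  let ?z = "max x y"
  have "epow (x * epow y (r - 1)) (1 / r) \<le> epow (?z * epow ?z (r - 1)) (1 / r)"
    using r by (intro epow_mono mult_mono) auto
  also have "?z * epow ?z (r - 1) = epow ?z r"
    using epow_add[of 1 "r - 1" ?z] r by simp
  also have "epow (epow ?z r) (1 / r) = ?z" using r by simp
  also have "\<dots> \<le> x + y" by (auto simp: max_def add_increasing add_increasing2)
  finally show ?thesis .
qed

text \<open>
Let \<open>u = G * W powr (1 - r)\<close>. On a cube, \<open>W\<close> is bounded below and \<open>G\<close> is bounded below
by multiples of their averages. The first fact bounds the average of \<open>u\<close> from above by \<open>\<mu> * m powr (1 - r)\<close>, where \<open>\<mu>\<close>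
and \<open>m\<close> are the averages of \<open>G\<close> and \<open>W\<close>. The second fact, together with Chebyshev's
observation that \<open>W\<close> cannot exceed \<open>2 m\<close> on more than half of the cube, bounds the average of the square root of \<open>u\<close> from below by a multiple of the square root of
the same quantity. So \<open>u\<close> satisfies a reverse Hoelder inequality with exponents 1 and 1/2, and \<open>emax u\<close>, an operator
without \<open>L\<^sup>1\<close> bounds, is reduced to the maximal operator on \<open>L\<^sup>2\<close>.
\<close>

lemma emax_A1_quotient_le:
  fixes W G :: "real ^ 'n::finite \<Rightarrow> ennreal"
  assumes W: "A1_weight C W" and [measurable]: "G \<in> meas" and GA: "\<And>x. emax G x \<le> ennreal C' * G x" and C': "1 \<le> C'"
    and r: "1 < r"
  defines "u \<equiv> \<lambda>x. G x * ennreal (enn2real (W x) powr (1 - r))"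
  shows "emax u x \<le> ennreal (4 * C' * (2 * C) powr (r - 1)) * epow (emax (\<lambda>x. epow (u x) (1 / 2)) x) 2"
proof (rule emax_least_all)
  note [measurable] = A1_weight_measurable[OF W]
  have [measurable]: "u \<in> meas" unfolding u_def by measurable
  have C: "1 \<le> C" using W by (simp add: A1_weight_def)
  fix a :: "real ^ 'n" and l :: real assume l: "0 < l" and xa: "x \<in> cube a l"
  let ?V = "vol (cube a l)"
  note V = emeasure_cube_pos[OF l, of a] emeasure_cube_finite[OF l, of a]
  define s where "s = mass (\<lambda>y. epow (u y) (1 / 2)) (cube a l) / ?V"
  define \<mu> where "\<mu> = mass G (cube a l) / ?V"
  have \<mu>: "mass G (cube a l) = \<mu> * ?V"
    using V by (simp add: \<mu>_def ennreal_divide_times)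
  obtain m where m: "mass W (cube a l) = ennreal m * ?V" "0 < m"
    by (rule A1_weight_average[OF W l]) (rule that)
  have GQ: "\<mu> \<le> ennreal C' * G y" if "y \<in> cube a l" for y
  proof -
    have "\<mu> \<le> emax G y" unfolding \<mu>_def using emax_upper[OF l that] V by (simp add: divide_le_ennreal_iff)
    then show ?thesis using GA[of y] by (rule order_trans)
  qed
  have WQ: "AE y in lebesgue. y \<in> cube a l \<longrightarrow> (\<exists>t. W y = ennreal t \<and> 0 < t \<and> m \<le> C * t)"
  proof -
    have "AE y in lebesgue. 0 < W y \<and> W y < top" using W by (simp add: A1_weight_def)
    then show ?thesis
      using A1_weight_AE_cube[OF W]
    proof eventually_elim
      case (elim y)
      show ?case
      proof
        assume y: "y \<in> cube a l"
        obtain t where t: "W y = ennreal t" "0 < t" using elim(1) by (cases "W y") auto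
        have "ennreal m * ?V \<le> ennreal C * W y * ?V"
          using elim(2) l y m(1) by metis
        then have "ennreal m \<le> ennreal C * W y"
          using V by (subst (asm) (1 2) mult.commute, subst (asm) ennreal_mult_le_mult_iff) auto
        then have "ennreal m \<le> ennreal (C * t)" using t C by (simp add: ennreal_mult')
        then show "\<exists>t. W y = ennreal t \<and> 0 < t \<and> m \<le> C * t"
          using t C by (intro exI[of _ t]) (auto simp: ennreal_le_iff)
      qed
    qed
  qed
  have up: "mass u (cube a l) \<le> ennreal ((C / m) powr (r - 1)) * \<mu> * ?V"
  proof -
    have "mass u (cube a l) \<le> (\<integral>\<^sup>+y. ennreal ((C / m) powr (r - 1)) * (G y * indicator (cube a l) y) \<partial>lebesgue)"
    proof (rule nn_integral_mono_AE)
      show "AE y in lebesgue. u y * indicator (cube a l) y \<le> ennreal ((C / m) powr (r - 1)) * (G y * indicator (cube a l) y)"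
        using WQ
      proof eventually_elim
        case (elim y)
        show ?case
        proof (cases "y \<in> cube a l")
          case True
          then obtain t where t: "W y = ennreal t" "0 < t" "m \<le> C * t" using elim by blast
          have "t powr (1 - r) = (1 / t) powr (r - 1)"
            using t powr_minus_divide[of t "r - 1"] by (simp add: powr_divide)
          also have "\<dots> \<le> (C / m) powr (r - 1)"
            using t m r by (intro powr_mono2) (auto simp: field_simps)
          finally have "G y * ennreal (t powr (1 - r)) \<le> G y * ennreal ((C / m) powr (r - 1))"
            by (intro mult_left_mono ennreal_leI) auto
          then show ?thesis using True t by (simp add: u_def mult.commute)
        qed simp
      qed
    qed
    also have "\<dots> = ennreal ((C / m) powr (r - 1)) * (\<mu> * ?V)"
      unfolding \<mu>[symmetric] by (intro nn_integral_cmult) measurable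
    finally show ?thesis by (simp add: mult.assoc)
  qed
  define \<alpha> where "\<alpha> = (r - 1) / 2"
  have \<alpha>: "0 < \<alpha>" using r by (simp add: \<alpha>_def)
  let ?q = "epow (\<mu> * ennreal (1 / C')) (1 / 2)"
  have low1: "?q * ?V \<le> ennreal (2 * (2 * m) powr \<alpha>) * (s * ?V)"
  proof -
    \<comment> \<open>the first term is at least 1 where \<open>t \<le> 2 m\<close>, the second elsewhere\<close>
    have pt: "1 \<le> (2 * m) powr \<alpha> * t powr (- \<alpha>) + t / (2 * m)" if t: "0 < t" for t
    proof (cases "t \<le> 2 * m")
      case True
      have "(2 * m) powr \<alpha> * t powr (- \<alpha>) = (2 * m / t) powr \<alpha>"
        using t m by (simp add: powr_minus_divide powr_divide)
      moreover have "1 \<le> (2 * m / t) powr \<alpha>" using True t \<alpha> by (intro ge_one_powr_ge_zero) auto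
      ultimately show ?thesis using t m by (simp add: add_increasing2)
    next
      case False
      then have "1 \<le> t / (2 * m)" using m by simp
      then show ?thesis using t m by (simp add: add_increasing)
    qed
    define T where "T y = ennreal (enn2real (W y) powr (- \<alpha>))" for y
    have [measurable]: "T \<in> meas" unfolding T_def by measurable
    have "?V = (\<integral>\<^sup>+y. indicator (cube a l) y \<partial>lebesgue)" by simp
    also have "\<dots> \<le> (\<integral>\<^sup>+y. ennreal ((2 * m) powr \<alpha>) * (T y * indicator (cube a l) y) + ennreal (1 / (2 * m)) * (W y * indicator (cube a l) y) \<partial>lebesgue)"
    proof (rule nn_integral_mono_AE)
      show "AE y in lebesgue. indicator (cube a l) y \<le> ennreal ((2 * m) powr \<alpha>) * (T y * indicator (cube a l) y) + ennreal (1 / (2 * m)) * (W y * indicator (cube a l) y)"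
        using WQ
      proof eventually_elim
        case (elim y)
        show ?case
        proof (cases "y \<in> cube a l")
          case True
          then obtain t where t: "W y = ennreal t" "0 < t" using elim by blast
          have "ennreal 1 \<le> ennreal ((2 * m) powr \<alpha> * t powr (- \<alpha>) + t / (2 * m))"
            by (intro ennreal_leI pt t)
          also have "\<dots> = ennreal ((2 * m) powr \<alpha>) * ennreal (t powr (- \<alpha>)) + ennreal (1 / (2 * m)) * ennreal t"
            using t m by (subst ennreal_plus) (auto simp: ennreal_mult[symmetric])
          finally show ?thesis using True t by (simp add: T_def)
        qed simp
      qed
    qed
    also have "\<dots> = ennreal ((2 * m) powr \<alpha>) * mass T (cube a l) + ennreal (1 / (2 * m)) * (ennreal m * ?V)"
      unfolding m(1)[symmetric] by (subst nn_integral_add) (auto simp: nn_integral_cmult)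
    also have "ennreal (1 / (2 * m)) * (ennreal m * ?V) = ennreal (1 / 2) * ?V"
      using m by (subst ennreal_mult_assoc) auto
    finally have "ennreal (1 / 2) * ?V + ennreal (1 / 2) * ?V \<le> ennreal (1 / 2) * ?V + ennreal ((2 * m) powr \<alpha>) * mass T (cube a l)"
    proof -
      assume le: "?V \<le> ennreal ((2 * m) powr \<alpha>) * mass T (cube a l) + ennreal (1 / 2) * ?V"
      have "ennreal (1 / 2) + ennreal (1 / 2) = 1" by (subst ennreal_plus[symmetric]) auto
      then have "ennreal (1 / 2) * ?V + ennreal (1 / 2) * ?V = ?V" by (metis distrib_right mult_1)
      then show ?thesis using le by (simp only: add.commute)
    qed
    then have half: "ennreal (1 / 2) * ?V \<le> ennreal ((2 * m) powr \<alpha>) * mass T (cube a l)"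
      using V by (auto simp: ennreal_add_left_cancel_le ennreal_mult_eq_top_iff)
    have "?V = ennreal 2 * (ennreal (1 / 2) * ?V)" by (subst ennreal_mult_assoc) auto
    also have "\<dots> \<le> ennreal 2 * (ennreal ((2 * m) powr \<alpha>) * mass T (cube a l))"
      by (intro mult_left_mono half) auto
    also have "\<dots> = ennreal (2 * (2 * m) powr \<alpha>) * mass T (cube a l)"
      by (intro ennreal_mult_assoc) simp
    finally have VT: "?V \<le> ennreal (2 * (2 * m) powr \<alpha>) * mass T (cube a l)" .
    have "?q * ?V \<le> ?q * (ennreal (2 * (2 * m) powr \<alpha>) * mass T (cube a l))"
      by (intro mult_left_mono VT) auto
    also have "\<dots> = ennreal (2 * (2 * m) powr \<alpha>) * (\<integral>\<^sup>+y. ?q * (T y * indicator (cube a l) y) \<partial>lebesgue)"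
      by (subst nn_integral_cmult) (auto simp: mult.left_commute)
    also have "\<dots> \<le> ennreal (2 * (2 * m) powr \<alpha>) * mass (\<lambda>y. epow (u y) (1 / 2)) (cube a l)"
    proof (intro mult_left_mono nn_integral_mono)
      fix y
      show "?q * (T y * indicator (cube a l) y) \<le> epow (u y) (1 / 2) * indicator (cube a l) y"
      proof (cases "y \<in> cube a l")
        case True
        have "\<mu> * ennreal (1 / C') \<le> ennreal C' * G y * ennreal (1 / C')"
          by (intro mult_right_mono GQ True) auto
        also have "\<dots> = G y"
        proof -
          have "ennreal C' * G y * ennreal (1 / C') = ennreal C' * (ennreal (1 / C') * G y)" by (simp only: mult_ac)
          also have "\<dots> = ennreal (C' * (1 / C')) * G y" using C' by (intro ennreal_mult_assoc) simp
          also have "\<dots> = G y" using C' by simp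
          finally show ?thesis .
        qed
        finally have "?q \<le> epow (G y) (1 / 2)" by (intro epow_mono) auto
        moreover have "epow (u y) (1 / 2) = epow (G y) (1 / 2) * T y"
        proof -
          have ex: "- \<alpha> = (1 - r) * (1 / 2)" by (simp add: \<alpha>_def field_simps)
          show ?thesis unfolding u_def epow_mult T_def ex by (subst epow_ennreal) (simp_all add: powr_powr)
        qed
        ultimately show ?thesis using True by (simp add: mult_right_mono)
      qed simp
    qed auto
    also have "mass (\<lambda>y. epow (u y) (1 / 2)) (cube a l) = s * ?V"
      using V by (simp add: s_def ennreal_divide_times)
    finally show ?thesis .
  qed
  then have low2: "?q \<le> ennreal (2 * (2 * m) powr \<alpha>) * s"
    using V by (subst (asm) mult.assoc[symmetric], subst (asm) (1 2) mult.commute, subst (asm) ennreal_mult_le_mult_iff) auto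
  have "\<mu> * ennreal (1 / C') = epow ?q 2" by simp
  also have "\<dots> \<le> epow (ennreal (2 * (2 * m) powr \<alpha>) * s) 2" using low2 by (intro epow_mono) auto
  also have "\<dots> = ennreal (4 * (2 * m) powr (r - 1)) * epow s 2"
  proof -
    have "\<alpha> * 2 = r - 1" by (simp add: \<alpha>_def)
    then have "((2 * m) powr \<alpha>) powr 2 = (2 * m) powr (r - 1)" by (metis powr_powr)
    then have "(2 * (2 * m) powr \<alpha>) powr 2 = 4 * (2 * m) powr (r - 1)"
      by (subst powr_mult) auto
    then have "epow (ennreal (2 * (2 * m) powr \<alpha>)) 2 = ennreal (4 * (2 * m) powr (r - 1))"
      by (subst epow_ennreal) auto
    then show ?thesis by (simp only: epow_mult)
  qed
  finally have low: "\<mu> * ennreal (1 / C') \<le> ennreal (4 * (2 * m) powr (r - 1)) * epow s 2" .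
  have "ennreal ((C / m) powr (r - 1)) * \<mu> = ennreal ((C / m) powr (r - 1) * C') * (\<mu> * ennreal (1 / C'))"
  proof -
    have "ennreal ((C / m) powr (r - 1) * C') * (\<mu> * ennreal (1 / C')) = ennreal ((C / m) powr (r - 1) * C') * (ennreal (1 / C') * \<mu>)"
      by (simp only: mult_ac)
    also have "\<dots> = ennreal ((C / m) powr (r - 1) * C' * (1 / C')) * \<mu>"
      using C' by (intro ennreal_mult_assoc) auto
    finally show ?thesis using C' by simp
  qed
  also have "\<dots> \<le> ennreal ((C / m) powr (r - 1) * C') * (ennreal (4 * (2 * m) powr (r - 1)) * epow s 2)"
    by (intro mult_left_mono low) auto
  also have "\<dots> = ennreal ((C / m) powr (r - 1) * C' * (4 * (2 * m) powr (r - 1))) * epow s 2"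
    using C' by (intro ennreal_mult_assoc) auto
  also have "(C / m) powr (r - 1) * C' * (4 * (2 * m) powr (r - 1)) = 4 * C' * (2 * C) powr (r - 1)"
  proof -
    have "(2 * C) powr (r - 1) = ((C / m) * (2 * m)) powr (r - 1)" using m by (simp add: mult.commute)
    also have "\<dots> = (C / m) powr (r - 1) * (2 * m) powr (r - 1)" by (rule powr_mult)
    finally show ?thesis by simp
  qed
  finally have avg: "ennreal ((C / m) powr (r - 1)) * \<mu> \<le> ennreal (4 * C' * (2 * C) powr (r - 1)) * epow s 2" .
  have "s \<le> emax (\<lambda>x. epow (u x) (1 / 2)) x"
    unfolding s_def using emax_upper[OF l xa, of "\<lambda>x. epow (u x) (1 / 2)"] V by (simp add: divide_le_ennreal_iff)
  then have "epow s 2 \<le> epow (emax (\<lambda>x. epow (u x) (1 / 2)) x) 2" by (intro epow_mono) auto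
  then have "ennreal (4 * C' * (2 * C) powr (r - 1)) * epow s 2 \<le> ennreal (4 * C' * (2 * C) powr (r - 1)) * epow (emax (\<lambda>x. epow (u x) (1 / 2)) x) 2"
    by (intro mult_left_mono) auto
  with avg have "ennreal ((C / m) powr (r - 1)) * \<mu> \<le> ennreal (4 * C' * (2 * C) powr (r - 1)) * epow (emax (\<lambda>x. epow (u x) (1 / 2)) x) 2"
    by (rule order_trans)
  then show "mass u (cube a l) \<le> ennreal (4 * C' * (2 * C) powr (r - 1)) * epow (emax (\<lambda>x. epow (u x) (1 / 2)) x) 2 * ?V"
    using order_trans[OF up mult_right_mono[of _ _ ?V]] by simp
qed

text \<open>
Take \<open>f\<close> in the unit ball of \<open>conc r N\<close>, and let \<open>W\<close> be the Rubio de Francia majorant of \<open>epow f (1 / r)\<close>.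
The function \<open>g * epow W (r - 1)\<close> lies in the dual of \<open>N\<close> when \<open>g\<close> lies in the dual of \<open>conc r N\<close>, so the algorithm
applies to it there and gives a majorant \<open>G\<close>. With \<open>u = G * W powr (1 - r)\<close>, a majorant of \<open>g\<close>, and \<open>V = epow W r\<close>,
\<open>emax_A1_quotient_le\<close> and the \<open>L\<^sup>2(V)\<close> bound for the square root of \<open>u\<close> bound the integral of \<open>f * emax g\<close> by a
multiple of the integral of \<open>V * u = W * G\<close>, which is controlled by duality between \<open>N\<close> and its dual.
\<close>

lemma (in function_norm) max_bounded_dual_conc:
  assumes B: "max_bounded B N" and sat: "saturated N" and B': "max_bounded B' (dual_norm N)"
  obtains r0 where "1 < r0" "\<And>r. 1 < r \<Longrightarrow> r \<le> r0 \<Longrightarrow> function_norm (conc r N) \<Longrightarrow>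
    \<exists>K. max_bounded K (dual_norm (conc r N))"
proof -
  have B1: "1 \<le> 2 * B" and B2: "1 \<le> 2 * B'" using B B' by (auto simp: max_bounded_def)
  interpret D: function_norm "dual_norm N" by (rule function_norm_dual[OF sat])
  obtain r0 where r0: "1 < r0" "\<And>(w :: real ^ 'n \<Rightarrow> ennreal) r. A1_weight (2 * B) w \<Longrightarrow> 1 < r \<Longrightarrow> r \<le> r0 \<Longrightarrow>
    A1_weight (2 * (2 * B) powr r) (\<lambda>x. epow (w x) r)"
    using A1_weight_power[OF B1, where 'n = 'n] by metis
  show thesis
  proof (rule that[OF r0(1)])
    fix r assume r: "1 < r" "r \<le> r0" and fnr: "function_norm (conc r N)"
    interpret R: function_norm "conc r N" by (rule fnr)
    define C1 where "C1 = 2 * (2 * B) powr r"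
    have C1: "1 \<le> C1"
    proof -
      have "1 \<le> (2 * B) powr r" using B1 r by (intro ge_one_powr_ge_zero) auto
      then show ?thesis by (simp add: C1_def)
    qed
    have two: "1 < (2 :: real)" by simp
    obtain K2 where K2: "0 < K2" "\<And>(w :: real ^ 'n \<Rightarrow> ennreal) f. A1_weight C1 w \<Longrightarrow> f \<in> meas \<Longrightarrow>
      (\<integral>\<^sup>+x. w x * epow (wmax w f x) 2 \<partial>lebesgue) \<le> ennreal K2 * (\<integral>\<^sup>+x. w x * epow (f x) 2 \<partial>lebesgue)"
      using wmax_strong_type[OF two C1, where 'n = 'n] by blast
    define Ka where "Ka = 4 * (2 * B') * (2 * (2 * B)) powr (r - 1)"
    have Ka: "0 \<le> Ka" using B2 by (simp add: Ka_def)
    define K where "K = Ka * (C1 powr 2 * (K2 * (2 * (2 * 3 powr r))))"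
    have K0: "0 \<le> K" using Ka K2 by (simp add: K_def)
    have main: "(\<integral>\<^sup>+x. f x * emax g x \<partial>lebesgue) \<le> ennreal K * d"
      if [measurable]: "g \<in> meas" "f \<in> meas" and Nf: "conc r N f \<le> 1" and d: "dual_norm (conc r N) g = d" "d < top" for f g d
    proof -
      let ?F = "\<lambda>x. epow (f x) (1 / r)"
      have Fm: "?F \<in> meas" by measurable
      have "epow (N ?F) r \<le> epow 1 r" using Nf by (simp add: conc_def)
      then have NF: "N ?F \<le> 1" using r by (subst (asm) epow_le_iff) auto
      then have "N ?F < top" by (rule le_less_trans) simp
      then obtain W where W: "W \<in> meas" "\<And>x. ?F x \<le> W x" "N W \<le> 2 * N ?F"
        "(AE x in lebesgue. ?F x = 0) \<or> A1_weight (2 * B) W"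
        using rubio_de_francia_A1[OF B Fm] by metis
      note [measurable] = W(1)
      have NW: "N W \<le> 2"
        using order_trans[OF W(3) mult_left_mono[OF NF, of 2]] by simp
      show ?thesis
      proof (cases "AE x in lebesgue. ?F x = 0")
        case True
        then have "AE x in lebesgue. f x * emax g x = 0" by (rule eventually_mono) simp
        then have "(\<integral>\<^sup>+x. f x * emax g x \<partial>lebesgue) = 0" by (subst nn_integral_0_iff_AE) auto
        then show ?thesis by simp
      next
        case False
        then have WA: "A1_weight (2 * B) W" using W(4) by blast
        let ?V = "\<lambda>x. epow (W x) r"
        have VA: "A1_weight C1 ?V" unfolding C1_def using WA r by (intro r0) auto
        let ?H = "\<lambda>x. g x * epow (W x) (r - 1)"
        have Hm: "?H \<in> meas" by measurable
        \<comment> \<open>\<open>h * epow W (r - 1)\<close> has norm at most \<open>(1 + 2) powr r\<close> in \<open>conc r N\<close>, by interpolation between \<open>h\<close> and \<open>W\<close>\<close>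
        have dH: "dual_norm N ?H \<le> ennreal (3 powr r) * d"
        proof (rule dual_norm_least)
          fix h :: "real ^ 'n \<Rightarrow> ennreal" assume [measurable]: "h \<in> meas" and Nh: "N h \<le> 1"
          have "N (\<lambda>x. epow (h x * epow (W x) (r - 1)) (1 / r)) \<le> N (\<lambda>x. h x + W x)"
            by (intro mono' epow_interpolate r) auto
          also have "\<dots> \<le> N h + N W" by (intro add) auto
          also have "\<dots> \<le> 1 + 2" by (intro add_mono Nh NW)
          finally have "epow (N (\<lambda>x. epow (h x * epow (W x) (r - 1)) (1 / r))) r \<le> epow (ennreal 3) r"
            using r by (intro epow_mono) auto
          then have "conc r N (\<lambda>x. h x * epow (W x) (r - 1)) \<le> ennreal (3 powr r)"
            by (subst (asm) epow_ennreal) (auto simp: conc_def)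
          then have "(\<integral>\<^sup>+x. (h x * epow (W x) (r - 1)) * g x \<partial>lebesgue) \<le> ennreal (3 powr r) * dual_norm (conc r N) g"
            by (intro R.dual_norm_bound) auto
          then show "(\<integral>\<^sup>+x. h x * (g x * epow (W x) (r - 1)) \<partial>lebesgue) \<le> ennreal (3 powr r) * d"
            unfolding d(1) by (simp add: mult_ac)
        qed
        have "\<exists>G. G \<in> meas \<and> (\<forall>x. ?H x \<le> G x) \<and> dual_norm N G \<le> 2 * dual_norm N ?H \<and>
            (\<forall>x. emax G x \<le> ennreal (2 * B') * G x)"
          by (rule D.rubio_de_francia[OF B' Hm]) (intro exI conjI allI)
        then obtain G where G: "G \<in> meas" "\<And>x. ?H x \<le> G x" "dual_norm N G \<le> 2 * dual_norm N ?H"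
          "\<And>x. emax G x \<le> ennreal (2 * B') * G x"
          by (elim exE conjE) (rule that, assumption, erule spec, assumption, erule spec)
        note [measurable] = G(1)
        define u where "u x = G x * ennreal (enn2real (W x) powr (1 - r))" for x
        have [measurable]: "u \<in> meas" unfolding u_def by measurable
        have Wpos: "AE x in lebesgue. 0 < W x \<and> W x < top" using WA by (simp add: A1_weight_def)
        \<comment> \<open>\<open>epow (W x) (r - 1)\<close> is inverse to \<open>W powr (1 - r)\<close> where \<open>W\<close> is positive and finite\<close>
        have gu: "AE x in lebesgue. g x \<le> u x"
          using Wpos
        proof eventually_elim
          case (elim x)
          then obtain t where t: "W x = ennreal t" "0 < t" by (cases "W x") auto
          have "g x = g x * ennreal (t powr (r - 1) * t powr (1 - r))"
            using t by (simp add: powr_add[symmetric])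
          also have "\<dots> = ?H x * ennreal (t powr (1 - r))"
            using t by (simp add: ennreal_mult' mult.assoc)
          also have "\<dots> \<le> G x * ennreal (t powr (1 - r))" by (intro mult_right_mono G(2)) auto
          also have "\<dots> = u x" using t by (simp add: u_def)
          finally show ?case .
        qed
        have Vu: "AE x in lebesgue. ?V x * epow (epow (u x) (1 / 2)) 2 = W x * G x"
          using Wpos
        proof eventually_elim
          case (elim x)
          then obtain t where t: "W x = ennreal t" "0 < t" by (cases "W x") auto
          have "?V x * u x = ennreal (t powr r * t powr (1 - r)) * G x"
            using t by (simp add: u_def ennreal_mult' mult_ac)
          also have "t powr r * t powr (1 - r) = t" using t by (simp add: powr_add[symmetric])
          finally show ?case using t by simp
        qed
        let ?z = "\<lambda>x. epow (u x) (1 / 2)"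
        have zm: "?z \<in> meas" by measurable
        have Mg: "emax g x \<le> ennreal Ka * epow (ennreal C1 * wmax ?V ?z x) 2" for x
        proof -
          have "emax g x \<le> emax u x" by (rule emax_mono_AE[OF gu])
          also have "\<dots> \<le> ennreal Ka * epow (emax ?z x) 2"
            unfolding Ka_def u_def by (rule emax_A1_quotient_le[OF WA G(1) G(4) B2 r(1)])
          also have "\<dots> \<le> ennreal Ka * epow (ennreal C1 * wmax ?V ?z x) 2"
            by (intro mult_left_mono epow_mono emax_le_wmax[OF VA zm]) auto
          finally show ?thesis .
        qed
        have fV: "f x \<le> ?V x" for x using epow_mono[OF W(2)[of x], of r] r by simp
        have "(\<integral>\<^sup>+x. f x * emax g x \<partial>lebesgue) \<le> (\<integral>\<^sup>+x. ?V x * (ennreal Ka * epow (ennreal C1 * wmax ?V ?z x) 2) \<partial>lebesgue)"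
          by (intro nn_integral_mono mult_mono fV Mg) auto
        also have "\<dots> = (\<integral>\<^sup>+x. ennreal (Ka * C1 powr 2) * (?V x * epow (wmax ?V ?z x) 2) \<partial>lebesgue)"
        proof (intro nn_integral_cong)
          fix x
          have "epow (ennreal C1) 2 = ennreal (C1 powr 2)" using C1 by (intro epow_ennreal) simp
          then have "?V x * (ennreal Ka * epow (ennreal C1 * wmax ?V ?z x) 2) = ennreal Ka * (ennreal (C1 powr 2) * (?V x * epow (wmax ?V ?z x) 2))"
            by (simp only: epow_mult mult_ac)
          then show "?V x * (ennreal Ka * epow (ennreal C1 * wmax ?V ?z x) 2) = ennreal (Ka * C1 powr 2) * (?V x * epow (wmax ?V ?z x) 2)"
            using ennreal_mult_assoc[OF Ka] by metis
        qed
        also have "\<dots> = ennreal (Ka * C1 powr 2) * (\<integral>\<^sup>+x. ?V x * epow (wmax ?V ?z x) 2 \<partial>lebesgue)"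
          by (intro nn_integral_cmult) measurable
        also have "\<dots> \<le> ennreal (Ka * C1 powr 2) * (ennreal K2 * (\<integral>\<^sup>+x. ?V x * epow (?z x) 2 \<partial>lebesgue))"
          by (intro mult_left_mono K2 VA zm) auto
        also have "(\<integral>\<^sup>+x. ?V x * epow (?z x) 2 \<partial>lebesgue) = (\<integral>\<^sup>+x. W x * G x \<partial>lebesgue)"
          by (intro nn_integral_cong_AE Vu)
        also have "\<dots> \<le> ennreal 2 * dual_norm N G" using NW by (intro dual_norm_bound) auto
        also have "\<dots> \<le> ennreal 2 * (ennreal 2 * (ennreal (3 powr r) * d))"
          using order_trans[OF G(3) mult_left_mono[OF dH, of 2]] by (intro mult_left_mono) auto
        also have "ennreal (Ka * C1 powr 2) * (ennreal K2 * (ennreal 2 * (ennreal 2 * (ennreal (3 powr r) * d)))) = ennreal K * d"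
        proof -
          have e1: "ennreal 2 * (ennreal (3 powr r) * d) = ennreal (2 * 3 powr r) * d" by (intro ennreal_mult_assoc) simp
          have e2: "ennreal 2 * (ennreal (2 * 3 powr r) * d) = ennreal (2 * (2 * 3 powr r)) * d" by (intro ennreal_mult_assoc) simp
          have e3: "ennreal K2 * (ennreal (2 * (2 * 3 powr r)) * d) = ennreal (K2 * (2 * (2 * 3 powr r))) * d"
            using K2 by (intro ennreal_mult_assoc) simp
          have e4: "ennreal (Ka * C1 powr 2) * (ennreal (K2 * (2 * (2 * 3 powr r))) * d) = ennreal (Ka * C1 powr 2 * (K2 * (2 * (2 * 3 powr r)))) * d"
            using Ka by (intro ennreal_mult_assoc) simp
          show ?thesis unfolding e1 e2 e3 e4 K_def by (simp only: mult.assoc)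
        qed
        finally show ?thesis by (simp add: mult_left_mono)
      qed
    qed
    let ?K = "max 1 K"
    have "max_bounded ?K (dual_norm (conc r N))"
    proof (rule max_boundedI_finite)
      fix g :: "real ^ 'n \<Rightarrow> ennreal" assume g: "g \<in> meas" and fin: "dual_norm (conc r N) g < top"
      show "dual_norm (conc r N) (emax g) \<le> ennreal ?K * dual_norm (conc r N) g"
      proof (rule dual_norm_least)
        fix f :: "real ^ 'n \<Rightarrow> ennreal" assume f: "f \<in> meas" "conc r N f \<le> 1"
        have "(\<integral>\<^sup>+x. f x * emax g x \<partial>lebesgue) \<le> ennreal K * dual_norm (conc r N) g"
          by (intro main g f refl fin)
        also have "\<dots> \<le> ennreal ?K * dual_norm (conc r N) g" by (intro mult_right_mono ennreal_leI) auto
        finally show "(\<integral>\<^sup>+x. f x * emax g x \<partial>lebesgue) \<le> \<dots>" .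
      qed
    qed simp
    then show "\<exists>K. max_bounded K (dual_norm (conc r N))" by blast
  qed
qed

section \<open>From the dual of a concavification back to the space\<close>

text \<open>
Extrapolation: a bound on \<open>L\<^sup>r(w)\<close>, uniform over \<open>A\<^sub>1\<close> weights with a given constant, implies a bound
in \<open>N\<close>. By Lorentz-Luxemburg duality for \<open>conc r N\<close>, it suffices to integrate \<open>epow \<Phi> r\<close> against functions \<open>u\<close> in
the dual of \<open>conc r N\<close>, and each such \<open>u\<close> that does not vanish almost everywhere is dominated by an \<open>A\<^sub>1\<close> weight of at most twice its
norm.
\<close>

lemma (in function_norm) norm_le_of_A1_bound:
  assumes r: "1 < r" and fnr: "function_norm (conc r N)" and sat: "saturated N"
    and B: "max_bounded B (dual_norm (conc r N))"
    and [measurable]: "f \<in> meas" "\<Phi> \<in> meas" and a: "0 < a" "N f \<le> ennreal a" and K: "0 < K"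
    and bound: "\<And>w. A1_weight (2 * B) w \<Longrightarrow> (\<integral>\<^sup>+x. w x * epow (f x) r \<partial>lebesgue) < top \<Longrightarrow>
      (\<integral>\<^sup>+x. w x * epow (\<Phi> x) r \<partial>lebesgue) \<le> ennreal K * (\<integral>\<^sup>+x. w x * epow (f x) r \<partial>lebesgue)"
  shows "N \<Phi> \<le> ennreal ((2 * K) powr (1 / r) * a)"
proof -
  interpret R: function_norm "conc r N" by (rule fnr)
  interpret D: function_norm "dual_norm (conc r N)" by (rule R.function_norm_dual[OF saturated_conc[OF sat]])
  have "conc r N (\<lambda>x. epow (\<Phi> x) r) \<le> ennreal (2 * K * a powr r)"
  proof (rule R.lorentz_luxemburg)
    show "0 < 2 * K * a powr r" using K a by simp
    fix u :: "real ^ 'n \<Rightarrow> ennreal" assume u [measurable]: "u \<in> meas" and ufin: "dual_norm (conc r N) u < top"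
    let ?d = "dual_norm (conc r N) u"
    obtain w where w: "w \<in> meas" "\<And>x. u x \<le> w x" "dual_norm (conc r N) w \<le> 2 * ?d"
      "(AE x in lebesgue. u x = 0) \<or> A1_weight (2 * B) w"
      using D.rubio_de_francia_A1[OF B u ufin] by metis
    note [measurable] = w(1)
    show "(\<integral>\<^sup>+x. epow (\<Phi> x) r * u x \<partial>lebesgue) \<le> ennreal (2 * K * a powr r) * ?d"
    proof (cases "AE x in lebesgue. u x = 0")
      case True
      then have "AE x in lebesgue. epow (\<Phi> x) r * u x = 0" by (rule eventually_mono) simp
      then have "(\<integral>\<^sup>+x. epow (\<Phi> x) r * u x \<partial>lebesgue) = 0" by (subst nn_integral_0_iff_AE) auto
      then show ?thesis by simp
    next
      case False
      then have wA: "A1_weight (2 * B) w" using w(4) by blast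
      have "epow (N f) r \<le> epow (ennreal a) r" using a r by (intro epow_mono) auto
      then have "conc r N (\<lambda>x. epow (f x) r) \<le> ennreal (a powr r)"
        using a r by (simp add: conc_def)
      then have "(\<integral>\<^sup>+x. epow (f x) r * w x \<partial>lebesgue) \<le> ennreal (a powr r) * dual_norm (conc r N) w"
        using a by (intro R.dual_norm_bound) auto
      also have "\<dots> \<le> ennreal (a powr r) * (ennreal 2 * ?d)" using w(3) by (intro mult_left_mono) auto
      finally have fw: "(\<integral>\<^sup>+x. w x * epow (f x) r \<partial>lebesgue) \<le> ennreal (a powr r) * (ennreal 2 * ?d)"
        by (simp add: mult.commute)
      also have "\<dots> < top" using ufin by (simp add: ennreal_mult_less_top)
      finally have fin: "(\<integral>\<^sup>+x. w x * epow (f x) r \<partial>lebesgue) < top" .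
      have "(\<integral>\<^sup>+x. epow (\<Phi> x) r * u x \<partial>lebesgue) \<le> (\<integral>\<^sup>+x. w x * epow (\<Phi> x) r \<partial>lebesgue)"
      proof (intro nn_integral_mono)
        fix x
        show "epow (\<Phi> x) r * u x \<le> w x * epow (\<Phi> x) r"
          using mult_right_mono[OF w(2)[of x], of "epow (\<Phi> x) r"] by (simp add: mult.commute)
      qed
      also have "\<dots> \<le> ennreal K * (\<integral>\<^sup>+x. w x * epow (f x) r \<partial>lebesgue)" by (rule bound[OF wA fin])
      also have "\<dots> \<le> ennreal K * (ennreal (a powr r) * (ennreal 2 * ?d))" by (intro mult_left_mono fw) auto
      also have "\<dots> = ennreal (2 * K * a powr r) * ?d"
      proof -
        have e1: "ennreal (a powr r) * (ennreal 2 * ?d) = ennreal (a powr r * 2) * ?d" by (intro ennreal_mult_assoc) simp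
        have e2: "ennreal K * (ennreal (a powr r * 2) * ?d) = ennreal (K * (a powr r * 2)) * ?d"
          using K by (intro ennreal_mult_assoc) simp
        show ?thesis unfolding e1 e2 by (simp only: mult_ac)
      qed
      finally show ?thesis .
    qed
  qed measurable
  then have "epow (N \<Phi>) r \<le> ennreal (2 * K * a powr r)" using r by (simp add: conc_def)
  also have "\<dots> = epow (ennreal ((2 * K) powr (1 / r) * a)) r"
    using K a r by (subst epow_ennreal) (auto simp: powr_mult powr_powr)
  finally show ?thesis using r by (subst (asm) epow_le_iff) auto
qed

text \<open>
Extrapolation of the bound for \<open>emax\<close> on \<open>L\<^sup>r(w)\<close>.
\<close>

lemma (in function_norm) max_bounded_of_dual_conc:
  assumes r: "1 < r" and fnr: "function_norm (conc r N)" and sat: "saturated N"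
    and B: "max_bounded B (dual_norm (conc r N))"
  shows "\<exists>K. max_bounded K N"
proof -
  have B1: "1 \<le> 2 * B" using B by (simp add: max_bounded_def)
  obtain K2 where K2: "0 < K2" "\<And>(w :: real ^ 'n \<Rightarrow> ennreal) f. A1_weight (2 * B) w \<Longrightarrow> f \<in> meas \<Longrightarrow>
    (\<integral>\<^sup>+x. w x * epow (wmax w f x) r \<partial>lebesgue) \<le> ennreal K2 * (\<integral>\<^sup>+x. w x * epow (f x) r \<partial>lebesgue)"
    using wmax_strong_type[OF r B1, where 'n = 'n] by blast
  define K where "K = (2 * B) powr r * K2"
  have K: "0 < K" using K2 B1 by (simp add: K_def)
  let ?K = "max 1 ((2 * K) powr (1 / r))"
  have "max_bounded ?K N"
  proof (rule max_boundedI)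
    fix f :: "real ^ 'n \<Rightarrow> ennreal" and a assume f [measurable]: "f \<in> meas" and a: "0 < a" "N f \<le> ennreal a"
    have "N (emax f) \<le> ennreal ((2 * K) powr (1 / r) * a)"
    proof (rule norm_le_of_A1_bound[OF r fnr sat B f emax_measurable a K])
      fix w :: "real ^ 'n \<Rightarrow> ennreal" assume w: "A1_weight (2 * B) w"
      note [measurable] = A1_weight_measurable[OF w]
      have "(\<integral>\<^sup>+x. w x * epow (emax f x) r \<partial>lebesgue) \<le> (\<integral>\<^sup>+x. w x * epow (ennreal (2 * B) * wmax w f x) r \<partial>lebesgue)"
        using r by (intro nn_integral_mono mult_left_mono epow_mono emax_le_wmax[OF w]) auto
      also have "\<dots> = (\<integral>\<^sup>+x. ennreal ((2 * B) powr r) * (w x * epow (wmax w f x) r) \<partial>lebesgue)"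
      proof (intro nn_integral_cong)
        fix x
        have "epow (ennreal (2 * B)) r = ennreal ((2 * B) powr r)" using B1 by (intro epow_ennreal) simp
        then show "w x * epow (ennreal (2 * B) * wmax w f x) r = ennreal ((2 * B) powr r) * (w x * epow (wmax w f x) r)"
          by (simp only: epow_mult mult_ac)
      qed
      also have "\<dots> = ennreal ((2 * B) powr r) * (\<integral>\<^sup>+x. w x * epow (wmax w f x) r \<partial>lebesgue)"
        by (intro nn_integral_cmult) measurable
      also have "\<dots> \<le> ennreal ((2 * B) powr r) * (ennreal K2 * (\<integral>\<^sup>+x. w x * epow (f x) r \<partial>lebesgue))"
        by (intro mult_left_mono K2 w f) auto
      also have "\<dots> = ennreal K * (\<integral>\<^sup>+x. w x * epow (f x) r \<partial>lebesgue)"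
        unfolding K_def by (intro ennreal_mult_assoc) simp
      finally show "(\<integral>\<^sup>+x. w x * epow (emax f x) r \<partial>lebesgue) \<le> ennreal K * (\<integral>\<^sup>+x. w x * epow (f x) r \<partial>lebesgue)" .
    qed
    also have "\<dots> \<le> ennreal (?K * a)" using a by (intro ennreal_leI mult_right_mono) auto
    finally show "N (emax f) \<le> ennreal (?K * a)" .
  qed simp
  then show ?thesis by blast
qed

section \<open>From the dual of a concavification to the dual of the space\<close>

lemma ennreal_absorb_half:
  assumes "x \<le> a + ennreal (1 / 2) * x" "x < top"
  shows "x \<le> ennreal 2 * a"
proof (cases a)
  case (real s)
  obtain t where t: "x = ennreal t" "0 \<le> t" using assms(2) by (cases x) auto
  have "ennreal t \<le> ennreal (s + 1 / 2 * t)"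
    using assms(1) real t by (simp only: ennreal_mult ennreal_plus)
  then have "t \<le> s + 1 / 2 * t" using real t by (subst (asm) ennreal_le_iff) auto
  then have "ennreal t \<le> ennreal (2 * s)" by (intro ennreal_leI) simp
  then show ?thesis using real t by (simp add: ennreal_mult')
qed (simp add: ennreal_mult_top)

text \<open>
Take for the \<open>\<phi> j\<close> the indicators of disjoint subsets of the \<open>S j\<close>: a point is assigned to a \<open>j\<close> that attains the
maximum. They turn a finite maximum of averages into an operator that is linear in the averaged function.
\<close>

lemma linearize_maximum:
  fixes S :: "nat \<Rightarrow> (real ^ 'n::finite) set" and c :: "nat \<Rightarrow> ennreal"
  assumes [measurable]: "\<And>j. S j \<in> sets lebesgue"
  shows "\<exists>\<phi>. (\<forall>j. \<phi> j \<in> meas) \<and> (\<forall>j x. \<phi> j x \<le> indicator (S j) x) \<and> (\<forall>x. (\<Sum>j<n. \<phi> j x) \<le> 1) \<and>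
    (\<forall>x. \<forall>j<n. c j * indicator (S j) x \<le> (\<Sum>j<n. c j * \<phi> j x))"
proof (induction n)
  case 0
  show ?case by (intro exI[of _ "\<lambda>j x. 0"]) auto
next
  case (Suc n)
  then obtain \<phi> where \<phi>: "\<And>j. \<phi> j \<in> meas" "\<And>j x. \<phi> j x \<le> indicator (S j) x" "\<And>x. (\<Sum>j<n. \<phi> j x) \<le> 1"
    "\<And>x j. j < n \<Longrightarrow> c j * indicator (S j) x \<le> (\<Sum>j<n. c j * \<phi> j x)" by blast
  note [measurable] = \<phi>(1)
  define P where "P = {x \<in> space lebesgue. (\<Sum>j<n. c j * \<phi> j x) < c n * indicator (S n) x}"
  have [measurable]: "P \<in> sets lebesgue" unfolding P_def by measurable
  have PS: "x \<in> S n" if "x \<in> P" for x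
    using that by (cases "x \<in> S n") (auto simp: P_def)
  define \<psi> where "\<psi> j x = (if j = n then indicator P x else \<phi> j x * indicator (- P) x)" for j x
  have inP: "\<psi> j x = (if j = n then 1 else 0)" if "x \<in> P" for j x using that by (simp add: \<psi>_def)
  have notP: "\<psi> j x = (if j = n then 0 else \<phi> j x)" if "x \<notin> P" for j x using that by (simp add: \<psi>_def)
  show ?case
  proof (intro exI[of _ \<psi>] conjI allI impI)
    show "\<psi> j \<in> meas" for j unfolding \<psi>_def by (cases "j = n") auto
    show "\<psi> j x \<le> indicator (S j) x" for j x
      using \<phi>(2)[of j x] PS[of x] by (cases "x \<in> P") (auto simp: inP notP)
    show "(\<Sum>j<Suc n. \<psi> j x) \<le> 1" for x
      using \<phi>(3)[of x] by (cases "x \<in> P") (auto simp: inP notP)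
    show "c j * indicator (S j) x \<le> (\<Sum>j<Suc n. c j * \<psi> j x)" if "j < Suc n" for x j
    proof (cases "x \<in> P")
      case True
      have "c j * indicator (S j) x \<le> c n"
      proof (cases "j = n")
        case False
        then have "c j * indicator (S j) x \<le> (\<Sum>j<n. c j * \<phi> j x)" using that by (intro \<phi>(4)) auto
        also have "\<dots> \<le> c n * indicator (S n) x" using True by (simp add: P_def)
        also have "\<dots> \<le> c n" by (auto simp: indicator_def)
        finally show ?thesis .
      qed (auto simp: indicator_def)
      then show ?thesis using True by (simp add: inP)
    next
      case False
      have "c j * indicator (S j) x \<le> (\<Sum>j<n. c j * \<phi> j x)"
        using False that \<phi>(4)[of j x] by (cases "j = n") (auto simp: P_def not_less)
      also have "\<dots> = (\<Sum>j<Suc n. c j * \<psi> j x)" using False by (simp add: notP)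
      finally show ?thesis .
    qed
  qed
qed

text \<open>
The adjoint of the linearized maximal operator
\<open>g \<mapsto> (\<Sum>j<n. (average of g over the j-th cube) * \<phi> j)\<close>; see \<open>adj_duality\<close>.
\<close>

definition adj :: "(nat \<Rightarrow> (real ^ 'n::finite) \<times> real) \<Rightarrow> (nat \<Rightarrow> real ^ 'n \<Rightarrow> ennreal) \<Rightarrow> nat \<Rightarrow> (real ^ 'n \<Rightarrow> ennreal) \<Rightarrow> real ^ 'n \<Rightarrow> ennreal" where
  "adj q \<phi> n f x = (\<Sum>j<n. (\<integral>\<^sup>+y. f y * \<phi> j y \<partial>lebesgue) / vol (cube (fst (q j)) (snd (q j)))
      * indicator (cube (fst (q j)) (snd (q j))) x)"

lemma adj_measurable [measurable]: "adj q \<phi> n f \<in> meas"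
  unfolding adj_def[abs_def] by measurable

lemma adj_duality:
  assumes [measurable]: "f \<in> meas" "g \<in> meas" "\<And>j. \<phi> j \<in> meas"
  shows "(\<integral>\<^sup>+x. adj q \<phi> n f x * g x \<partial>lebesgue)
    = (\<integral>\<^sup>+x. f x * (\<Sum>j<n. mass g (cube (fst (q j)) (snd (q j))) / vol (cube (fst (q j)) (snd (q j))) * \<phi> j x) \<partial>lebesgue)"
proof -
  let ?Q = "\<lambda>j. cube (fst (q j)) (snd (q j))"
  let ?V = "\<lambda>j. vol (?Q j)"
  let ?F = "\<lambda>j. \<integral>\<^sup>+y. f y * \<phi> j y \<partial>lebesgue" and ?G = "\<lambda>j. mass g (?Q j)"
  have "(\<integral>\<^sup>+x. adj q \<phi> n f x * g x \<partial>lebesgue) = (\<integral>\<^sup>+x. (\<Sum>j<n. ?F j / ?V j * (g x * indicator (?Q j) x)) \<partial>lebesgue)"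
    by (intro nn_integral_cong) (simp only: adj_def sum_distrib_right sum_distrib_left mult_ac)
  also have "\<dots> = (\<Sum>j<n. \<integral>\<^sup>+x. ?F j / ?V j * (g x * indicator (?Q j) x) \<partial>lebesgue)"
    by (intro nn_integral_sum) measurable
  also have "\<dots> = (\<Sum>j<n. ?F j / ?V j * ?G j)"
    by (intro sum.cong refl nn_integral_cmult) measurable
  also have "\<dots> = (\<Sum>j<n. ?G j / ?V j * ?F j)"
    by (intro sum.cong refl) (simp add: divide_ennreal_def mult_ac)
  also have "\<dots> = (\<Sum>j<n. \<integral>\<^sup>+x. ?G j / ?V j * (f x * \<phi> j x) \<partial>lebesgue)"
    by (intro sum.cong refl nn_integral_cmult[symmetric]) measurable
  also have "\<dots> = (\<integral>\<^sup>+x. (\<Sum>j<n. ?G j / ?V j * (f x * \<phi> j x)) \<partial>lebesgue)"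
    by (intro nn_integral_sum[symmetric]) measurable
  also have "\<dots> = (\<integral>\<^sup>+x. f x * (\<Sum>j<n. ?G j / ?V j * \<phi> j x) \<partial>lebesgue)"
    by (intro nn_integral_cong) (simp add: sum_distrib_left mult_ac)
  finally show ?thesis .
qed

text \<open>
With \<open>T = adj q \<phi> n f\<close> and \<open>h = epow T (r - 1)\<close>, the integral \<open>I\<close> of \<open>w * epow T r\<close> is the pairing of \<open>T\<close> with
\<open>h * w\<close>. Moving the operator to the other side produces averages of \<open>h * w\<close>, which the \<open>A\<^sub>1\<close> condition bounds by
\<open>C * w * wmax w h\<close>. Young's inequality separates \<open>f\<close> from \<open>wmax w h\<close>; the second term is at most \<open>I / 2\<close> by the
strong type inequality for the conjugate exponent and is absorbed, since \<open>I\<close> is finite.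
\<close>

lemma adj_strong_type:
  assumes r: "1 < r" and C: "1 \<le> C"
  shows "\<exists>K>0. \<forall>(w :: real ^ 'n::finite \<Rightarrow> ennreal) f q \<phi> n. A1_weight C w \<longrightarrow> f \<in> meas \<longrightarrow>
    (\<integral>\<^sup>+x. w x * epow (f x) r \<partial>lebesgue) < top \<longrightarrow> (\<forall>j. q j \<in> rcubes) \<longrightarrow> (\<forall>j. \<phi> j \<in> meas) \<longrightarrow>
    (\<forall>j x. \<phi> j x \<le> indicator (cube (fst (q j)) (snd (q j))) x) \<longrightarrow> (\<forall>x. (\<Sum>j<n. \<phi> j x) \<le> 1) \<longrightarrow>
    (\<integral>\<^sup>+x. w x * epow (adj q \<phi> n f x) r \<partial>lebesgue) \<le> ennreal K * (\<integral>\<^sup>+x. w x * epow (f x) r \<partial>lebesgue)"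
proof -
  let ?s = "r / (r - 1)"
  have s: "1 < ?s" using r by simp
  obtain K2 where K2: "0 < K2" "\<And>(w :: real ^ 'n \<Rightarrow> ennreal) f. A1_weight C w \<Longrightarrow> f \<in> meas \<Longrightarrow>
    (\<integral>\<^sup>+x. w x * epow (wmax w f x) ?s \<partial>lebesgue) \<le> ennreal K2 * (\<integral>\<^sup>+x. w x * epow (f x) ?s \<partial>lebesgue)"
    using wmax_strong_type[OF s C, where 'n = 'n] by blast
  \<comment> \<open>the parameter in Young's inequality, chosen to leave the factor 1/2 in front of the absorbed term\<close>
  define e where "e = 1 / (2 * C * K2)"
  have e: "0 < e" using K2 C by (simp add: e_def)
  define K where "K = 2 * (C * e powr (1 - r))"
  have K: "0 < K" using C e by (simp add: K_def)
  show ?thesis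
  proof (intro exI[of _ K] conjI K allI impI)
    fix w f :: "real ^ 'n \<Rightarrow> ennreal" and q :: "nat \<Rightarrow> (real ^ 'n) \<times> real" and \<phi> :: "nat \<Rightarrow> real ^ 'n \<Rightarrow> ennreal" and n :: nat
    assume w: "A1_weight C w" and [measurable]: "f \<in> meas" and fin: "(\<integral>\<^sup>+x. w x * epow (f x) r \<partial>lebesgue) < top"
      and q: "\<forall>j. q j \<in> rcubes" and \<phi>m: "\<forall>j. \<phi> j \<in> meas"
      and \<phi>S: "\<forall>j x. \<phi> j x \<le> indicator (cube (fst (q j)) (snd (q j))) x" and \<phi>1: "\<forall>x. (\<Sum>j<n. \<phi> j x) \<le> 1"
    have [measurable]: "\<phi> j \<in> meas" for j using \<phi>m by blast
    note [measurable] = A1_weight_measurable[OF w]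
    let ?Q = "\<lambda>j. cube (fst (q j)) (snd (q j))"
    have qr: "(fst (q j), snd (q j)) \<in> rcubes" for j using q by simp
    have l: "0 < snd (q j)" for j using rcubes_pos[OF qr[of j]] .
    note V = emeasure_cube_pos[OF l] emeasure_cube_finite[OF l]
    note Wpf = A1_weight_cube_pos_finite[OF w l]
    let ?T = "adj q \<phi> n f"
    let ?I = "\<integral>\<^sup>+x. w x * epow (?T x) r \<partial>lebesgue" and ?J = "\<integral>\<^sup>+x. w x * epow (f x) r \<partial>lebesgue"
    define h where "h x = epow (?T x) (r - 1)" for x
    have hm [measurable]: "h \<in> meas" unfolding h_def by measurable

    \<comment> \<open>\<open>f\<close> is integrable on cubes, since \<open>f \<le> 1 + epow f r\<close> and \<open>A1_weight_average_le\<close> removes the weight\<close>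
    have fQ: "mass f (?Q j) < top" for j
    proof -
      have "mass (\<lambda>y. f y * w y) (?Q j) \<le> (\<integral>\<^sup>+y. w y * indicator (?Q j) y + w y * epow (f y) r \<partial>lebesgue)"
      proof (intro nn_integral_mono)
        fix y
        have "f y \<le> 1 + epow (f y) r"
        proof (cases "f y \<le> 1")
          case True
          then show ?thesis by (simp add: add_increasing2)
        next
          case False
          then have "epow 1 (r - 1) \<le> epow (f y) (r - 1)" using r by (intro epow_mono) auto
          then have "f y * 1 \<le> f y * epow (f y) (r - 1)" by (intro mult_left_mono) auto
          also have "\<dots> = epow (f y) r" using epow_add[of 1 "r - 1" "f y"] r by simp
          finally show ?thesis by (simp add: add_increasing)
        qed
        from mult_right_mono[OF this, of "w y"]
        show "f y * w y * indicator (?Q j) y \<le> w y * indicator (?Q j) y + w y * epow (f y) r"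
          by (auto simp: indicator_def distrib_left mult.commute)
      qed
      also have "\<dots> = mass w (?Q j) + ?J" by (intro nn_integral_add) measurable
      also have "\<dots> < top" using Wpf(2)[of "fst (q j)" j] fin by simp
      finally have "(ennreal C * vol (?Q j)) * mass (\<lambda>y. f y * w y) (?Q j) < top"
        using V(2)[of "fst (q j)" j] by (simp add: ennreal_mult_less_top)
      then have "(\<integral>\<^sup>+y\<in>?Q j. w y \<partial>lebesgue) * mass f (?Q j) < top"
        using A1_weight_average_le[OF w \<open>f \<in> meas\<close> l[of j], of "fst (q j)"] by (rule le_less_trans[rotated])
      then show ?thesis using Wpf(1)[of "fst (q j)" j] by (auto simp: ennreal_mult_less_top)
    qed
    have Ifin: "?I < top"
    proof -
      define t where "t j = (\<integral>\<^sup>+y. f y * \<phi> j y \<partial>lebesgue) / vol (?Q j)" for j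
      have t: "t j < top" for j
      proof -
        have "(\<integral>\<^sup>+y. f y * \<phi> j y \<partial>lebesgue) \<le> mass f (?Q j)"
          using \<phi>S by (intro nn_integral_mono mult_left_mono) auto
        also have "\<dots> < top" by (rule fQ)
        finally show ?thesis unfolding t_def using V(1)[of "fst (q j)" j]
          by (auto simp: less_top[symmetric] ennreal_divide_eq_top_iff)
      qed
      \<comment> \<open>\<open>adj\<close> is bounded by the sum \<open>\<tau>\<close> and lives on finitely many cubes, so the left-hand side is finite\<close>
      define \<tau> where "\<tau> = (\<Sum>j<n. t j)"
      have \<tau>: "\<tau> < top" using t by (auto simp: \<tau>_def less_top[symmetric])
      have "?I \<le> (\<integral>\<^sup>+x. (\<Sum>j<n. epow \<tau> r * (w x * indicator (?Q j) x)) \<partial>lebesgue)"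
      proof (intro nn_integral_mono)
        fix x
        show "w x * epow (?T x) r \<le> (\<Sum>j<n. epow \<tau> r * (w x * indicator (?Q j) x))"
        proof (cases "\<exists>j<n. x \<in> ?Q j")
          case True
          then obtain j where j: "j < n" "x \<in> ?Q j" by blast
          have "?T x \<le> \<tau>" unfolding adj_def \<tau>_def t_def
            by (intro sum_mono) (auto simp: indicator_def)
          then have "w x * epow (?T x) r \<le> epow \<tau> r * (w x * indicator (?Q j) x)"
            using r j by (subst mult.commute, auto intro!: mult_right_mono epow_mono)
          also have "\<dots> \<le> (\<Sum>j<n. epow \<tau> r * (w x * indicator (?Q j) x))"
            using j by (intro member_le_sum) auto
          finally show ?thesis .
        next
          case False
          then have "?T x = 0" by (auto simp: adj_def)
          then show ?thesis by simp
        qed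
      qed
      also have "\<dots> = (\<Sum>j<n. \<integral>\<^sup>+x. epow \<tau> r * (w x * indicator (?Q j) x) \<partial>lebesgue)"
        by (intro nn_integral_sum) measurable
      also have "\<dots> = (\<Sum>j<n. epow \<tau> r * mass w (?Q j))"
        by (intro sum.cong refl nn_integral_cmult) measurable
      also have "\<dots> < top"
        using \<tau> Wpf(2) by (auto simp: less_top[symmetric] ennreal_mult_eq_top_iff)
      finally show ?thesis .
    qed
    have "?I = (\<integral>\<^sup>+x. ?T x * (h x * w x) \<partial>lebesgue)"
    proof (intro nn_integral_cong)
      fix x
      have "epow (?T x) r = ?T x * h x" unfolding h_def using epow_add[of 1 "r - 1" "?T x"] r by simp
      then show "w x * epow (?T x) r = ?T x * (h x * w x)" by (simp only: mult_ac)
    qed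
    also have "\<dots> = (\<integral>\<^sup>+x. f x * (\<Sum>j<n. mass (\<lambda>y. h y * w y) (?Q j) / vol (?Q j) * \<phi> j x) \<partial>lebesgue)"
      by (intro adj_duality) measurable
    also have "\<dots> \<le> (\<integral>\<^sup>+x. ennreal C * (w x * (f x * wmax w h x)) \<partial>lebesgue)"
    proof (rule nn_integral_mono_AE)
      show "AE x in lebesgue. f x * (\<Sum>j<n. mass (\<lambda>y. h y * w y) (?Q j) / vol (?Q j) * \<phi> j x)
        \<le> ennreal C * (w x * (f x * wmax w h x))"
        using A1_weight_AE_cube[OF w]
      proof eventually_elim
        case (elim x)
        have "mass (\<lambda>y. h y * w y) (?Q j) / vol (?Q j) * \<phi> j x \<le> ennreal C * w x * wmax w h x * \<phi> j x" for j
        proof (cases "x \<in> ?Q j")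
          case True
          have "mass (\<lambda>y. h y * w y) (?Q j) \<le> wmax w h x * mass w (?Q j)"
            by (rule wmax_upper[OF w qr True])
          also have "\<dots> \<le> wmax w h x * (ennreal C * w x * vol (?Q j))"
            using elim l True by (intro mult_left_mono) auto
          also have "\<dots> = (ennreal C * w x * wmax w h x) * vol (?Q j)" by (simp only: mult_ac)
          finally have "mass (\<lambda>y. h y * w y) (?Q j) / vol (?Q j) \<le> ennreal C * w x * wmax w h x"
            by (subst divide_le_ennreal_iff[OF V])
          then show ?thesis by (intro mult_right_mono) auto
        next
          case False
          then have "\<phi> j x = 0" using \<phi>S[rule_format, of j x] by simp
          then show ?thesis by simp
        qed
        then have "(\<Sum>j<n. mass (\<lambda>y. h y * w y) (?Q j) / vol (?Q j) * \<phi> j x)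
            \<le> (\<Sum>j<n. ennreal C * w x * wmax w h x * \<phi> j x)" by (intro sum_mono)
        also have "\<dots> = ennreal C * w x * wmax w h x * (\<Sum>j<n. \<phi> j x)" by (simp only: sum_distrib_left)
        also have "\<dots> \<le> ennreal C * w x * wmax w h x * 1" using \<phi>1 by (intro mult_left_mono) auto
        finally have "f x * (\<Sum>j<n. mass (\<lambda>y. h y * w y) (?Q j) / vol (?Q j) * \<phi> j x)
            \<le> f x * (ennreal C * w x * wmax w h x * 1)" by (intro mult_left_mono) auto
        then show ?case by (simp only: mult_ac mult_1_right mult_1_left)
      qed
    qed
    also have "\<dots> \<le> (\<integral>\<^sup>+x. ennreal (C * e powr (1 - r)) * (w x * epow (f x) r) + ennreal (C * e) * (w x * epow (wmax w h x) ?s) \<partial>lebesgue)"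
    proof (intro nn_integral_mono)
      fix x
      have "ennreal C * (w x * (f x * wmax w h x)) \<le> ennreal C * (w x * (ennreal (e powr (1 - r)) * epow (f x) r + ennreal e * epow (wmax w h x) ?s))"
        by (intro mult_left_mono epow_young r e) auto
      also have "\<dots> = ennreal C * (ennreal (e powr (1 - r)) * (w x * epow (f x) r)) + ennreal C * (ennreal e * (w x * epow (wmax w h x) ?s))"
        by (simp only: distrib_left mult_ac)
      also have "\<dots> = ennreal (C * e powr (1 - r)) * (w x * epow (f x) r) + ennreal (C * e) * (w x * epow (wmax w h x) ?s)"
      proof -
        have "0 \<le> C" using C by simp
        then show ?thesis by (simp only: ennreal_mult_assoc)
      qed
      finally show "ennreal C * (w x * (f x * wmax w h x)) \<le> \<dots>" .
    qed
    also have "\<dots> = ennreal (C * e powr (1 - r)) * ?J + ennreal (C * e) * (\<integral>\<^sup>+x. w x * epow (wmax w h x) ?s \<partial>lebesgue)"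
      by (subst nn_integral_add) (auto simp: nn_integral_cmult)
    also have "\<dots> \<le> ennreal (C * e powr (1 - r)) * ?J + ennreal (C * e) * (ennreal K2 * (\<integral>\<^sup>+x. w x * epow (h x) ?s \<partial>lebesgue))"
      by (intro add_left_mono mult_left_mono K2 w hm) auto
    also have "(\<integral>\<^sup>+x. w x * epow (h x) ?s \<partial>lebesgue) = ?I"
      using r by (intro nn_integral_cong) (simp add: h_def)
    also have "ennreal (C * e) * (ennreal K2 * ?I) = ennreal (1 / 2) * ?I"
    proof -
      have eq: "C * e * K2 = 1 / 2" using K2 C by (simp add: e_def)
      have "0 \<le> C * e" using C e by simp
      then have "ennreal (C * e) * (ennreal K2 * ?I) = ennreal (C * e * K2) * ?I" by (rule ennreal_mult_assoc)
      then show ?thesis unfolding eq .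
    qed
    finally have abs: "?I \<le> ennreal (C * e powr (1 - r)) * ?J + ennreal (1 / 2) * ?I" .
    have "?I \<le> ennreal 2 * (ennreal (C * e powr (1 - r)) * ?J)"
      by (rule ennreal_absorb_half[OF abs Ifin])
    also have "\<dots> = ennreal K * ?J" unfolding K_def by (intro ennreal_mult_assoc) simp
    finally show "?I \<le> ennreal K * ?J" .
  qed
qed

text \<open>
The maximal operator is not linear, so its bound on the dual space is not directly dual to a bound on the
space. For the maximum over finitely many cubes it is: extrapolation of \<open>adj_strong_type\<close> bounds \<open>adj\<close> in \<open>N\<close>,
uniformly in the number of cubes and in the linearization.
\<close>

lemma (in function_norm) max_bounded_dual_of_dual_conc:
  assumes r: "1 < r" and fnr: "function_norm (conc r N)" and sat: "saturated N"
    and B: "max_bounded B (dual_norm (conc r N))"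
  shows "\<exists>K. max_bounded K (dual_norm N)"
proof -
  have B1: "1 \<le> 2 * B" using B by (simp add: max_bounded_def)
  define C where "C = 2 * B"
  obtain K where K: "0 < K" and adj: "\<And>(w :: real ^ 'n \<Rightarrow> ennreal) f q \<phi> n. A1_weight C w \<Longrightarrow> f \<in> meas \<Longrightarrow>
    (\<integral>\<^sup>+x. w x * epow (f x) r \<partial>lebesgue) < top \<Longrightarrow> (\<forall>j. q j \<in> rcubes) \<Longrightarrow> (\<forall>j. \<phi> j \<in> meas) \<Longrightarrow>
    (\<forall>j x. \<phi> j x \<le> indicator (cube (fst (q j)) (snd (q j))) x) \<Longrightarrow> (\<forall>x. (\<Sum>j<n. \<phi> j x) \<le> 1) \<Longrightarrow>
    (\<integral>\<^sup>+x. w x * epow (adj q \<phi> n f x) r \<partial>lebesgue) \<le> ennreal K * (\<integral>\<^sup>+x. w x * epow (f x) r \<partial>lebesgue)"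
    using adj_strong_type[OF r B1[folded C_def], where 'n = 'n] by blast
  define M where "M = max 1 ((2 * K) powr (1 / r))"
  have M: "0 < M" by (simp add: M_def)
  have ne: "(rcubes :: ((real ^ 'n) \<times> real) set) \<noteq> {}"
  proof -
    have "((\<chi> i. 0) :: real ^ 'n, 1) \<in> rcubes" by (simp add: rcubes_def)
    then show ?thesis by blast
  qed
  define q where "q = from_nat_into (rcubes :: ((real ^ 'n) \<times> real) set)"
  have q: "q j \<in> rcubes" for j unfolding q_def using ne by (rule from_nat_into)
  let ?Q = "\<lambda>j. cube (fst (q j)) (snd (q j))"
  have main: "(\<integral>\<^sup>+x. f x * emax g x \<partial>lebesgue) \<le> ennreal M * dual_norm N g"
    if [measurable]: "f \<in> meas" "g \<in> meas" and Nf: "N f \<le> 1" for f g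
  proof -
    define c where "c j = mass g (?Q j) / vol (?Q j)" for j
    \<comment> \<open>the maximal function over the first \<open>n\<close> rational cubes\<close>
    define m where "m n x = (SUP j\<in>{..<n}. c j * indicator (?Q j) x)" for n :: nat and x
    have [measurable]: "m n \<in> meas" for n unfolding m_def[abs_def] by (intro borel_measurable_SUP) auto
    have inc: "incseq (\<lambda>n. m n x)" for x
      unfolding incseq_def m_def by (intro allI impI SUP_subset_mono) auto
    have em: "emax g x \<le> (SUP n. m n x)" for x
      unfolding emax_eq_rcubes
    proof (rule SUP_least)
      fix p :: "(real ^ 'n) \<times> real" assume "p \<in> rcubes"
      then obtain j where j: "p = q j" unfolding q_def using from_nat_into_surj[OF countable_rcubes] by metis
      have "c j * indicator (?Q j) x \<le> m (Suc j) x" unfolding m_def by (rule SUP_upper) simp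
      also have "\<dots> \<le> (SUP n. m n x)" by (rule SUP_upper) simp
      finally show "(case p of (a, l) \<Rightarrow> mass g (cube a l) / vol (cube a l) * indicator (cube a l) x) \<le> (SUP n. m n x)"
        unfolding j c_def by (simp add: case_prod_unfold)
    qed
    have step: "(\<integral>\<^sup>+x. f x * m n x \<partial>lebesgue) \<le> ennreal M * dual_norm N g" for n
    proof -
      obtain \<phi> where \<phi>: "\<forall>j. \<phi> j \<in> meas" "\<forall>j x. \<phi> j x \<le> indicator (?Q j) x" "\<forall>x. (\<Sum>j<n. \<phi> j x) \<le> 1"
        "\<forall>x. \<forall>j<n. c j * indicator (?Q j) x \<le> (\<Sum>j<n. c j * \<phi> j x)"
        using linearize_maximum[of ?Q n c, OF cube_sets] by blast
      have [measurable]: "\<phi> j \<in> meas" for j using \<phi>(1) by blast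
      have "N (adj q \<phi> n f) \<le> ennreal ((2 * K) powr (1 / r) * 1)"
      proof (rule norm_le_of_A1_bound[OF r fnr sat B])
        show "N f \<le> ennreal 1" using Nf by simp
        fix w :: "real ^ 'n \<Rightarrow> ennreal" assume "A1_weight (2 * B) w" "(\<integral>\<^sup>+x. w x * epow (f x) r \<partial>lebesgue) < top"
        then show "(\<integral>\<^sup>+x. w x * epow (adj q \<phi> n f x) r \<partial>lebesgue) \<le> ennreal K * (\<integral>\<^sup>+x. w x * epow (f x) r \<partial>lebesgue)"
          using q \<phi> by (intro adj) (auto simp: C_def)
      qed (use K in auto)
      also have "\<dots> \<le> ennreal M" by (intro ennreal_leI) (simp add: M_def)
      finally have NT: "N (adj q \<phi> n f) \<le> ennreal M" .
      have "(\<integral>\<^sup>+x. f x * m n x \<partial>lebesgue) \<le> (\<integral>\<^sup>+x. f x * (\<Sum>j<n. c j * \<phi> j x) \<partial>lebesgue)"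
        unfolding m_def using \<phi>(4) by (intro nn_integral_mono mult_left_mono SUP_least) auto
      also have "\<dots> = (\<integral>\<^sup>+x. adj q \<phi> n f x * g x \<partial>lebesgue)"
        unfolding c_def by (intro adj_duality[symmetric]) measurable
      also have "\<dots> \<le> ennreal M * dual_norm N g"
        by (intro dual_norm_bound NT M) measurable
      finally show ?thesis .
    qed
    have "(\<integral>\<^sup>+x. f x * emax g x \<partial>lebesgue) \<le> (\<integral>\<^sup>+x. (SUP n. f x * m n x) \<partial>lebesgue)"
      by (intro nn_integral_mono) (simp add: SUP_mult_left_ennreal[symmetric] mult_left_mono em)
    also have "\<dots> = (SUP n. \<integral>\<^sup>+x. f x * m n x \<partial>lebesgue)"
      using inc by (intro nn_integral_monotone_convergence_SUP) (auto simp: incseq_def le_fun_def intro!: mult_left_mono)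
    also have "\<dots> \<le> ennreal M * dual_norm N g" by (intro SUP_least step)
    finally show ?thesis .
  qed
  have "dual_norm N (emax g) \<le> ennreal M * dual_norm N g" if "g \<in> meas" for g
    using that by (intro dual_norm_least main) auto
  then show ?thesis unfolding max_bounded_def by (intro exI[of _ M]) (auto simp: M_def)
qed

section \<open>Banach function spaces as extended norms\<close>

text \<open>
Finiteness almost everywhere has to be required explicitly, because \<open>enn2real\<close> sends \<open>\<infinity>\<close> to 0.
\<close>

definition ext_norm :: "'n::finite fspace \<Rightarrow> (real ^ 'n \<Rightarrow> ennreal) \<Rightarrow> ennreal" where
  "ext_norm X f = (if f \<in> meas \<and> (AE x in lebesgue. f x < top) \<and> (\<lambda>x. enn2real (f x)) \<in> elems X
     then ennreal (fnorm X (\<lambda>x. enn2real (f x))) else top)"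

text \<open>
The part of the structure of a function space that the translation of boundedness into extended norms uses.
It is shared by Banach function spaces, their concavifications and associate spaces.
\<close>

definition solid :: "'n::finite fspace \<Rightarrow> bool" where
  "solid X \<longleftrightarrow> ideal_property X \<and> elems X \<subseteq> borel_measurable lebesgue \<and> (\<forall>f\<in>elems X. 0 \<le> fnorm X f)"

lemma solid_measurable: "solid X \<Longrightarrow> f \<in> elems X \<Longrightarrow> f \<in> borel_measurable lebesgue"
  and solid_nonneg: "solid X \<Longrightarrow> f \<in> elems X \<Longrightarrow> 0 \<le> fnorm X f"
  by (auto simp: solid_def)

lemma solid_ideal:
  assumes "solid X" "f \<in> elems X" "g \<in> borel_measurable lebesgue" "AE x in lebesgue. \<bar>g x\<bar> \<le> \<bar>f x\<bar>"
  shows "g \<in> elems X" "fnorm X g \<le> fnorm X f"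
  using assms unfolding solid_def ideal_property_def by blast+

lemma solid_banach_function_space: "banach_function_space X \<Longrightarrow> solid X"
  by (auto simp: banach_function_space_def solid_def normed_fspace_def)

lemma ext_normD:
  assumes "ext_norm X f < top"
  shows "AE x in lebesgue. f x < top" "(\<lambda>x. enn2real (f x)) \<in> elems X"
    "ext_norm X f = ennreal (fnorm X (\<lambda>x. enn2real (f x)))" "f \<in> meas"
  using assms by (auto simp: ext_norm_def split: if_splits)

lemma ext_normI:
  assumes "f \<in> meas" "AE x in lebesgue. f x < top" "(\<lambda>x. enn2real (f x)) \<in> elems X"
  shows "ext_norm X f = ennreal (fnorm X (\<lambda>x. enn2real (f x)))"
  using assms by (simp add: ext_norm_def)

lemma ext_norm_abs:
  assumes X: "solid X" and f: "f \<in> elems X"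
  shows "ext_norm X (\<lambda>x. ennreal \<bar>f x\<bar>) = ennreal (fnorm X (\<lambda>x. \<bar>f x\<bar>))"
    "fnorm X (\<lambda>x. \<bar>f x\<bar>) \<le> fnorm X f" "(\<lambda>x. \<bar>f x\<bar>) \<in> elems X"
proof -
  have [measurable]: "f \<in> borel_measurable lebesgue" by (rule solid_measurable[OF X f])
  show *: "fnorm X (\<lambda>x. \<bar>f x\<bar>) \<le> fnorm X f" "(\<lambda>x. \<bar>f x\<bar>) \<in> elems X"
    by (rule solid_ideal[OF X f]; simp)+
  then show "ext_norm X (\<lambda>x. ennreal \<bar>f x\<bar>) = ennreal (fnorm X (\<lambda>x. \<bar>f x\<bar>))"
    using ext_normI[of "\<lambda>x. ennreal \<bar>f x\<bar>" X] by simp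
qed

text \<open>
The one delicate axiom is \<open>sup\<close>, as the Fatou property of the space presupposes that the limit is finite. Let
\<open>E\<close> be the set where the limit is infinite. For every \<open>k\<close> the truncations at height \<open>k\<close> increase on \<open>E\<close> to the
constant \<open>k\<close>, so \<open>k\<close> times the norm of the indicator of \<open>E\<close> stays bounded, and \<open>E\<close> is a null set.
\<close>

lemma function_norm_ext_norm:
  assumes X: "banach_function_space X"
  shows "function_norm (ext_norm X)"
proof -
  have sol: "solid X" by (rule solid_banach_function_space[OF X])
  have nf: "normed_fspace X" and fat: "fatou_property X" using X by (auto simp: banach_function_space_def)
  have mono: "ext_norm X f \<le> ext_norm X g" if [measurable]: "f \<in> meas" "g \<in> meas" and le: "AE x in lebesgue. f x \<le> g x" for f g
  proof (cases "ext_norm X g < top")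
    case True
    note g = ext_normD[OF True]
    have ffin: "AE x in lebesgue. f x < top" using le g(1) by eventually_elim (rule le_less_trans)
    have "AE x in lebesgue. \<bar>enn2real (f x)\<bar> \<le> \<bar>enn2real (g x)\<bar>"
      using le g(1) by eventually_elim (auto intro: enn2real_mono)
    note i = solid_ideal[OF sol g(2) _ this]
    have "(\<lambda>x. enn2real (f x)) \<in> elems X" by (rule i(1)) measurable
    then have "ext_norm X f = ennreal (fnorm X (\<lambda>x. enn2real (f x)))" using ffin by (intro ext_normI) auto
    also have "\<dots> \<le> ext_norm X g" unfolding g(3) by (intro ennreal_leI i(2)) measurable
    finally show ?thesis .
  qed (simp add: not_less top.extremum_unique)
  show ?thesis
  proof
    show "ext_norm X f \<le> ext_norm X g" if "f \<in> meas" "g \<in> meas" "AE x in lebesgue. f x \<le> g x" for f g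
      using that by (rule mono)
    show "ext_norm X (\<lambda>x. ennreal c * f x) \<le> ennreal c * ext_norm X f" if [measurable]: "f \<in> meas" and c: "0 < c" for f c
    proof (cases "ext_norm X f < top")
      case True
      note f = ext_normD[OF True]
      have eq: "(\<lambda>x. enn2real (ennreal c * f x)) = (\<lambda>x. c * enn2real (f x))"
        using c by (simp add: enn2real_mult)
      have "ext_norm X (\<lambda>x. ennreal c * f x) = ennreal (fnorm X (\<lambda>x. enn2real (ennreal c * f x)))"
      proof (rule ext_normI)
        show "AE x in lebesgue. ennreal c * f x < top"
          using f(1) by eventually_elim (simp add: ennreal_mult_less_top)
        show "(\<lambda>x. enn2real (ennreal c * f x)) \<in> elems X"
          unfolding eq using nf f(2) by (auto simp: normed_fspace_def)
      qed measurable
      also have "fnorm X (\<lambda>x. enn2real (ennreal c * f x)) = c * fnorm X (\<lambda>x. enn2real (f x))"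
        unfolding eq using nf f(2) c by (auto simp: normed_fspace_def)
      finally show ?thesis using c by (simp add: f(3) ennreal_mult')
    next
      case False
      then have "ennreal c * ext_norm X f = top" using c by (simp add: not_less top.extremum_unique ennreal_mult_top)
      then show ?thesis by simp
    qed
    show "ext_norm X (\<lambda>x. f x + g x) \<le> ext_norm X f + ext_norm X g" if [measurable]: "f \<in> meas" "g \<in> meas" for f g
    proof (cases "ext_norm X f < top \<and> ext_norm X g < top")
      case True
      note f = ext_normD[OF conjunct1[OF True]] and g = ext_normD[OF conjunct2[OF True]]
      let ?s = "\<lambda>x. enn2real (f x) + enn2real (g x)"
      have s: "?s \<in> elems X" "fnorm X ?s \<le> fnorm X (\<lambda>x. enn2real (f x)) + fnorm X (\<lambda>x. enn2real (g x))"
        using nf f(2) g(2) by (auto simp: normed_fspace_def)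
      have "AE x in lebesgue. \<bar>enn2real (f x + g x)\<bar> \<le> \<bar>?s x\<bar>"
        using f(1) g(1) by eventually_elim (simp add: enn2real_plus)
      note i = solid_ideal[OF sol s(1) _ this]
      have "ext_norm X (\<lambda>x. f x + g x) = ennreal (fnorm X (\<lambda>x. enn2real (f x + g x)))"
      proof (rule ext_normI)
        show "AE x in lebesgue. f x + g x < top" using f(1) g(1) by eventually_elim simp
        show "(\<lambda>x. enn2real (f x + g x)) \<in> elems X" by (rule i(1)) measurable
      qed measurable
      also have "fnorm X (\<lambda>x. enn2real (f x + g x)) \<le> fnorm X ?s" by (rule i(2)) measurable
      also note s(2)
      also have "ennreal (fnorm X (\<lambda>x. enn2real (f x)) + fnorm X (\<lambda>x. enn2real (g x))) = ext_norm X f + ext_norm X g"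
        unfolding f(3) g(3) using solid_nonneg[OF sol] f(2) g(2) by (intro ennreal_plus) auto
      finally show ?thesis by (simp add: ennreal_leI)
    next
      case False
      then have "ext_norm X f = top \<or> ext_norm X g = top" by (auto simp: not_less top.extremum_unique)
      then show ?thesis by auto
    qed
    show "ext_norm X (\<lambda>x. SUP n. f n x) \<le> (SUP n. ext_norm X (f n))"
      if f [measurable]: "\<And>n::nat. f n \<in> meas" and inc: "\<And>x. incseq (\<lambda>n. f n x)" for f
    proof (cases "(SUP n. ext_norm X (f n)) < top")
      case True
      define F where "F x = (SUP n. f n x)" for x
      have Fm [measurable]: "F \<in> meas" unfolding F_def[abs_def] by measurable
      obtain s where s: "(SUP n. ext_norm X (f n)) = ennreal s" "0 \<le> s" using True by (cases "SUP n. ext_norm X (f n)") auto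
      have le: "ext_norm X (f n) \<le> ennreal s" for n unfolding s(1)[symmetric] by (rule SUP_upper) simp
      have fin: "ext_norm X (f n) < top" for n by (rule le_less_trans[OF le]) simp
      note fD = ext_normD[OF fin]
      have fs: "fnorm X (\<lambda>x. enn2real (f n x)) \<le> s" for n using le[of n] s(2) unfolding fD(3) by simp
      have fF: "f n x \<le> F x" for n x unfolding F_def by (rule SUP_upper) simp
      have conv: "(\<lambda>n. f n x) \<longlonglongrightarrow> F x" for x unfolding F_def by (rule LIMSEQ_SUP[OF inc])
      have fatou: "h \<in> elems X \<and> fnorm X h \<le> s"
        if u: "\<And>n. u n \<in> borel_measurable lebesgue" "\<And>n. AE x in lebesgue. \<bar>u n x\<bar> \<le> \<bar>enn2real (f n x)\<bar>"
          and h: "h \<in> borel_measurable lebesgue"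
          and lim: "AE x in lebesgue. (\<forall>n. 0 \<le> u n x) \<and> incseq (\<lambda>n. u n x) \<and> (\<lambda>n. u n x) \<longlonglongrightarrow> h x" for u h
      proof -
        have ui: "u n \<in> elems X" "fnorm X (u n) \<le> s" for n
          using solid_ideal[OF sol fD(2) u(1) u(2), of n] fs[of n] by auto
        have bdd: "bdd_above (range (\<lambda>n. fnorm X (u n)))" using ui(2) by (intro bdd_aboveI2[of _ _ s])
        have "h \<in> elems X \<and> fnorm X h = (SUP n. fnorm X (u n))"
          using fat h ui(1) lim bdd unfolding fatou_property_def by blast
        moreover have "(SUP n. fnorm X (u n)) \<le> s" by (intro cSUP_least ui) auto
        ultimately show ?thesis by simp
      qed
      define E where "E = {x \<in> space lebesgue. F x = top}"
      have E [measurable]: "E \<in> sets lebesgue" unfolding E_def by measurable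
      have Ek: "(\<lambda>x. real k * indicator E x) \<in> elems X \<and> fnorm X (\<lambda>x. real k * indicator E x) \<le> s" for k :: nat
      proof (rule fatou)
        let ?u = "\<lambda>n x. enn2real (min (f n x) (ennreal (real k))) * indicator E x"
        show "?u n \<in> borel_measurable lebesgue" for n by measurable
        show "(\<lambda>x. real k * indicator E x) \<in> borel_measurable lebesgue" by measurable
        show "AE x in lebesgue. \<bar>?u n x\<bar> \<le> \<bar>enn2real (f n x)\<bar>" for n
          using fD(1)[of n] by eventually_elim (auto simp: indicator_def intro: enn2real_mono)
        show "AE x in lebesgue. (\<forall>n. 0 \<le> ?u n x) \<and> incseq (\<lambda>n. ?u n x) \<and> (\<lambda>n. ?u n x) \<longlonglongrightarrow> real k * indicator E x"
        proof (intro AE_I2 conjI allI)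
          fix x
          show "0 \<le> ?u n x" for n by simp
          show "incseq (\<lambda>n. ?u n x)"
            unfolding incseq_def
            by (intro allI impI mult_right_mono enn2real_mono min.mono incseqD[OF inc]) (auto simp: min_less_iff_disj)
          show "(\<lambda>n. ?u n x) \<longlonglongrightarrow> real k * indicator E x"
          proof (cases "x \<in> E")
            case True
            have "(\<lambda>n. min (f n x) (ennreal (real k))) \<longlonglongrightarrow> min (F x) (ennreal (real k))"
              by (intro tendsto_min conv tendsto_const)
            then have "(\<lambda>n. min (f n x) (ennreal (real k))) \<longlonglongrightarrow> ennreal (real k)"
              using True by (simp add: E_def)
            then have "(\<lambda>n. enn2real (min (f n x) (ennreal (real k)))) \<longlonglongrightarrow> enn2real (ennreal (real k))"
              by (intro tendsto_enn2real) auto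
            then show ?thesis using True by simp
          qed simp
        qed
      qed
      have E1: "(\<lambda>x. indicator E x :: real) \<in> elems X" using Ek[of 1] by simp
      have Escale: "fnorm X (\<lambda>x. real k * indicator E x) = real k * fnorm X (\<lambda>x. indicator E x)" for k
        using nf E1 by (auto simp: normed_fspace_def)
      have "fnorm X (\<lambda>x. indicator E x) = 0"
      proof (rule ccontr)
        assume "fnorm X (\<lambda>x. indicator E x) \<noteq> 0"
        then have "0 < fnorm X (\<lambda>x. indicator E x)" using solid_nonneg[OF sol E1] by simp
        then obtain k :: nat where "s < real k * fnorm X (\<lambda>x. indicator E x)" using reals_Archimedean3 by blast
        then show False using Ek[of k] Escale[of k] by simp
      qed
      then have "AE x in lebesgue. (indicator E x :: real) = 0" using nf E1 by (auto simp: normed_fspace_def)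
      then have Ffin: "AE x in lebesgue. F x < top"
        by (rule eventually_mono) (auto simp: E_def indicator_def less_top split: if_splits)
      have "(\<lambda>x. enn2real (F x)) \<in> elems X \<and> fnorm X (\<lambda>x. enn2real (F x)) \<le> s"
      proof (rule fatou[where u = "\<lambda>n x. enn2real (f n x)"])
        show "AE x in lebesgue. (\<forall>n. 0 \<le> enn2real (f n x)) \<and> incseq (\<lambda>n. enn2real (f n x)) \<and> (\<lambda>n. enn2real (f n x)) \<longlonglongrightarrow> enn2real (F x)"
          using Ffin
        proof eventually_elim
          case (elim x)
          have "f n x < top" for n using fF[of n x] elim by (rule le_less_trans)
          then have "incseq (\<lambda>n. enn2real (f n x))"
            unfolding incseq_def by (intro allI impI enn2real_mono incseqD[OF inc]) auto
          moreover have "(\<lambda>n. enn2real (f n x)) \<longlonglongrightarrow> enn2real (F x)"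
            using elim conv[of x] by (intro tendsto_enn2real) (auto simp: less_top)
          ultimately show ?case by simp
        qed
      qed measurable
      then have "ext_norm X F \<le> ennreal s"
        using ext_normI[OF Fm Ffin, of X] by (auto intro: ennreal_leI)
      then show ?thesis unfolding s(1) F_def .
    next
      case False
      then have "(SUP n. ext_norm X (f n)) = top" by (simp only: not_less top.extremum_unique)
      then show ?thesis by (simp only: top_greatest)
    qed
    show "ext_norm X (\<lambda>x. 0) = 0"
    proof -
      have "(\<lambda>x. 0) \<in> elems X" "fnorm X (\<lambda>x. 0) = 0" using nf by (auto simp: normed_fspace_def)
      then show ?thesis by (simp add: ext_norm_def)
    qed
    show "AE x in lebesgue. f x < top" if "f \<in> meas" "ext_norm X f < top" for f
      using that by (intro ext_normD)
  qed
qed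

lemma saturated_ext_norm:
  assumes X: "banach_function_space X"
  shows "saturated (ext_norm X)"
  unfolding saturated_def
proof (intro ballI impI)
  fix E :: "(real ^ 'a) set" assume E: "E \<in> sets lebesgue" "0 < vol E"
  then obtain F where F: "F \<in> sets lebesgue" "F \<subseteq> E" "0 < vol F" "indicator F \<in> elems X"
    using X unfolding banach_function_space_def saturation_property_def by blast
  have eq: "(\<lambda>x. enn2real (indicator F x)) = indicator F" by (auto simp: indicator_def fun_eq_iff)
  have "ext_norm X (indicator F) = ennreal (fnorm X (\<lambda>x. enn2real (indicator F x)))"
  proof (rule ext_normI)
    show "indicator F \<in> meas" using F(1) by measurable
    show "AE x in lebesgue. indicator F x < (top :: ennreal)" by (intro AE_I2) (simp add: indicator_def)
    show "(\<lambda>x. enn2real (indicator F x)) \<in> elems X" unfolding eq by (rule F(4))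
  qed
  also have "\<dots> < top" by simp
  finally show "\<exists>F\<in>sets lebesgue. F \<subseteq> E \<and> 0 < vol F \<and> ext_norm X (indicator F) < top"
    using F by blast
qed

text \<open>
It shows that the function in the definition of \<open>p\<close>-convexity belongs to the space.
\<close>

lemma powr_add_le:
  fixes a b p :: real
  assumes "1 \<le> p" "0 \<le> a" "0 \<le> b"
  shows "(a powr p + b powr p) powr (1 / p) \<le> a + b"
proof -
  have le: "c powr p \<le> c * (a + b) powr (p - 1)" if "0 \<le> c" "c \<le> a + b" for c
  proof -
    have "c powr p = c * c powr (p - 1)" using that powr_add[of c 1 "p - 1"] by (cases "c = 0") auto
    also have "\<dots> \<le> c * (a + b) powr (p - 1)" using that assms by (intro mult_left_mono powr_mono2) auto
    finally show ?thesis .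
  qed
  have "a powr p + b powr p \<le> a * (a + b) powr (p - 1) + b * (a + b) powr (p - 1)"
    using assms by (intro add_mono le) auto
  also have "\<dots> = (a + b) * (a + b) powr (p - 1)" by (simp add: distrib_right)
  also have "\<dots> = (a + b) powr p" using assms powr_add[of "a + b" 1 "p - 1"] by (cases "a + b = 0") auto
  finally have "(a powr p + b powr p) powr (1 / p) \<le> ((a + b) powr p) powr (1 / p)"
    using assms by (intro powr_mono2) auto
  then show ?thesis using assms by (simp add: powr_powr)
qed

lemma norm_convex_ext_norm:
  assumes X: "solid X" and add: "\<forall>f\<in>elems X. \<forall>g\<in>elems X. (\<lambda>x. f x + g x) \<in> elems X" and p: "1 \<le> p" and conv: "p_convex p X"
  shows "norm_convex p (ext_norm X)"
  unfolding norm_convex_def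
proof (intro ballI)
  fix f g :: "real ^ 'a \<Rightarrow> ennreal" assume [measurable]: "f \<in> meas" "g \<in> meas"
  let ?h = "\<lambda>x. epow (epow (f x) p + epow (g x) p) (1 / p)"
  show "ext_norm X ?h \<le> epow (epow (ext_norm X f) p + epow (ext_norm X g) p) (1 / p)"
  proof (cases "ext_norm X f < top \<and> ext_norm X g < top")
    case True
    note f = ext_normD[OF conjunct1[OF True]] and g = ext_normD[OF conjunct2[OF True]]
    let ?f = "\<lambda>x. enn2real (f x)" and ?g = "\<lambda>x. enn2real (g x)"
    let ?k = "\<lambda>x. (\<bar>?f x\<bar> powr p + \<bar>?g x\<bar> powr p) powr (1 / p)"
    have kb: "fnorm X ?k \<le> (fnorm X ?f powr p + fnorm X ?g powr p) powr (1 / p)"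
      by (rule bspec[OF bspec[OF conv[unfolded p_convex_def] f(2)] g(2)])
    have sum: "(\<lambda>x. ?f x + ?g x) \<in> elems X" by (rule bspec[OF bspec[OF add f(2)] g(2)])
    have k: "?k \<in> elems X"
    proof (rule solid_ideal(1)[OF X sum])
      show "AE x in lebesgue. \<bar>?k x\<bar> \<le> \<bar>?f x + ?g x\<bar>"
        using powr_add_le[OF p] by (intro AE_I2) auto
    qed measurable
    have hk: "AE x in lebesgue. \<bar>enn2real (?h x)\<bar> \<le> \<bar>?k x\<bar>"
      using f(1) g(1) by eventually_elim (simp add: enn2real_epow enn2real_plus)
    note i = solid_ideal[OF X k _ hk]
    have "ext_norm X ?h = ennreal (fnorm X (\<lambda>x. enn2real (?h x)))"
    proof (rule ext_normI)
      show "AE x in lebesgue. ?h x < top" using f(1) g(1) by eventually_elim simp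
      show "(\<lambda>x. enn2real (?h x)) \<in> elems X" by (rule i(1)) measurable
    qed measurable
    also have "fnorm X (\<lambda>x. enn2real (?h x)) \<le> fnorm X ?k" by (rule i(2)) measurable
    also note kb
    also have "ennreal ((fnorm X ?f powr p + fnorm X ?g powr p) powr (1 / p)) = epow (epow (ext_norm X f) p + epow (ext_norm X g) p) (1 / p)"
      unfolding f(3) g(3) using solid_nonneg[OF X f(2)] solid_nonneg[OF X g(2)]
      by (simp add: ennreal_plus[symmetric] del: ennreal_plus)
    finally show ?thesis by (simp add: ennreal_leI)
  next
    case False
    then have "ext_norm X f = top \<or> ext_norm X g = top" by (auto simp: not_less top.extremum_unique)
    then have "epow (epow (ext_norm X f) p + epow (ext_norm X g) p) (1 / p) = top" by auto
    then show ?thesis by (simp only: top_greatest)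
  qed
qed

section \<open>Boundedness of the maximal operator in terms of extended norms\<close>

lemma maximal_enn2real:
  assumes "AE x in lebesgue. f x < top"
  shows "maximal (\<lambda>x. enn2real (f x)) = emax f"
proof
  fix x
  have "AE x in lebesgue. ennreal \<bar>enn2real (f x)\<bar> = f x" using assms by eventually_elim simp
  then show "maximal (\<lambda>x. enn2real (f x)) x = emax f x"
    unfolding maximal_eq_emax by (intro antisym emax_mono_AE) (auto elim!: eventually_mono)
qed

lemma maximal_bounded_on_iff:
  assumes X: "solid X"
  shows "maximal_bounded_on X \<longleftrightarrow> (\<exists>K. max_bounded K (ext_norm X))"
proof
  assume "maximal_bounded_on X"
  then obtain C where C: "\<And>f. f \<in> elems X \<Longrightarrow> (AE x in lebesgue. maximal f x < top) \<and>
        (\<lambda>x. enn2real (maximal f x)) \<in> elems X \<and> fnorm X (\<lambda>x. enn2real (maximal f x)) \<le> C * fnorm X f"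
    unfolding maximal_bounded_on_def by auto
  have "max_bounded (max 1 C) (ext_norm X)"
  proof (rule max_boundedI_finite)
    fix f assume "ext_norm X f < top"
    note f = ext_normD[OF this]
    note M = C[OF f(2), unfolded maximal_enn2real[OF f(1)]]
    have "ext_norm X (emax f) = ennreal (fnorm X (\<lambda>x. enn2real (emax f x)))"
      using M by (intro ext_normI) auto
    also have "\<dots> \<le> ennreal (max 1 C * fnorm X (\<lambda>x. enn2real (f x)))"
      using solid_nonneg[OF X f(2)]
      by (intro ennreal_leI order_trans[OF conjunct2[OF conjunct2[OF M]] mult_right_mono]) auto
    also have "\<dots> = ennreal (max 1 C) * ext_norm X f" unfolding f(3) by (intro ennreal_mult') simp
    finally show "ext_norm X (emax f) \<le> ennreal (max 1 C) * ext_norm X f" .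
  qed simp
  then show "\<exists>K. max_bounded K (ext_norm X)" by blast
next
  assume "\<exists>K. max_bounded K (ext_norm X)"
  then obtain K where K: "1 \<le> K" "\<And>f. f \<in> meas \<Longrightarrow> ext_norm X (emax f) \<le> ennreal K * ext_norm X f"
    unfolding max_bounded_def by blast
  show "maximal_bounded_on X"
    unfolding maximal_bounded_on_def
  proof (intro exI[of _ K] ballI)
    fix f assume f: "f \<in> elems X"
    have [measurable]: "f \<in> borel_measurable lebesgue" by (rule solid_measurable[OF X f])
    note a = ext_norm_abs[OF X f]
    have le: "ext_norm X (maximal f) \<le> ennreal K * ennreal (fnorm X (\<lambda>x. \<bar>f x\<bar>))"
      using K(2)[of "\<lambda>x. ennreal \<bar>f x\<bar>"] by (simp add: maximal_eq_emax a(1))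
    also have "\<dots> < top" by (simp add: ennreal_mult_less_top)
    finally have "ext_norm X (maximal f) < top" .
    note M = ext_normD[OF this]
    have "ennreal (fnorm X (\<lambda>x. enn2real (maximal f x))) \<le> ennreal (K * fnorm X (\<lambda>x. \<bar>f x\<bar>))"
      using le K(1) unfolding M(3) by (simp add: ennreal_mult')
    then have "fnorm X (\<lambda>x. enn2real (maximal f x)) \<le> K * fnorm X (\<lambda>x. \<bar>f x\<bar>)"
      using K(1) solid_nonneg[OF X a(3)] by (subst (asm) ennreal_le_iff) auto
    also have "\<dots> \<le> K * fnorm X f" using K(1) a(2) by (intro mult_left_mono) auto
    finally show "(AE x in lebesgue. maximal f x < \<infinity>) \<and> (\<lambda>x. enn2real (maximal f x)) \<in> elems X \<and>
        fnorm X (\<lambda>x. enn2real (maximal f x)) \<le> K * fnorm X f"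
      using M by simp
  qed
qed

lemma solid_concavification:
  assumes X: "solid X" and r: "0 < r"
  shows "solid (concavification r X)"
proof -
  have "g \<in> elems (concavification r X) \<and> fnorm (concavification r X) g \<le> fnorm (concavification r X) f"
    if f: "f \<in> elems (concavification r X)" and [measurable]: "g \<in> borel_measurable lebesgue"
      and le: "AE x in lebesgue. \<bar>g x\<bar> \<le> \<bar>f x\<bar>" for f g
  proof -
    have f': "(\<lambda>x. \<bar>f x\<bar> powr (1 / r)) \<in> elems X" using f by (simp add: concavification_def)
    have "AE x in lebesgue. \<bar>\<bar>g x\<bar> powr (1 / r)\<bar> \<le> \<bar>\<bar>f x\<bar> powr (1 / r)\<bar>"
      using le by eventually_elim (use r in \<open>auto intro!: powr_mono2\<close>)
    note i = solid_ideal[OF X f' _ this]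
    have g: "(\<lambda>x. \<bar>g x\<bar> powr (1 / r)) \<in> elems X" by (rule i(1)) measurable
    moreover have "fnorm X (\<lambda>x. \<bar>g x\<bar> powr (1 / r)) powr r \<le> fnorm X (\<lambda>x. \<bar>f x\<bar> powr (1 / r)) powr r"
      using r solid_nonneg[OF X g] by (intro powr_mono2 i(2)) auto
    ultimately show ?thesis by (simp add: concavification_def)
  qed
  then show ?thesis by (auto simp: solid_def ideal_property_def concavification_def)
qed

lemma ext_norm_concavification:
  assumes X: "solid X" and r: "0 < r"
  shows "ext_norm (concavification r X) = conc r (ext_norm X)"
proof
  fix f :: "real ^ 'a \<Rightarrow> ennreal"
  let ?F = "\<lambda>x. epow (f x) (1 / r)"
  have m: "?F \<in> meas \<longleftrightarrow> f \<in> meas"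
  proof
    assume "?F \<in> meas"
    then have "(\<lambda>x. epow (?F x) r) \<in> meas" by measurable
    then show "f \<in> meas" using r by simp
  qed measurable
  have e: "(\<lambda>x. enn2real (?F x)) = (\<lambda>x. \<bar>enn2real (f x)\<bar> powr (1 / r))" by (simp add: enn2real_epow)
  show "ext_norm (concavification r X) f = conc r (ext_norm X) f"
  proof (cases "f \<in> meas \<and> (AE x in lebesgue. f x < top) \<and> (\<lambda>x. \<bar>enn2real (f x)\<bar> powr (1 / r)) \<in> elems X")
    case True
    then have [measurable]: "f \<in> meas" by blast
    have "ext_norm X ?F = ennreal (fnorm X (\<lambda>x. enn2real (?F x)))"
      using True by (intro ext_normI) (auto simp: e)
    then have "conc r (ext_norm X) f = ennreal (fnorm X (\<lambda>x. \<bar>enn2real (f x)\<bar> powr (1 / r)) powr r)"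
      using solid_nonneg[OF X] True unfolding conc_def e by simp
    moreover have "ext_norm (concavification r X) f = ennreal (fnorm (concavification r X) (\<lambda>x. enn2real (f x)))"
      using True by (intro ext_normI) (auto simp: concavification_def)
    ultimately show ?thesis by (simp add: concavification_def)
  next
    case False
    then have "ext_norm X ?F = top"
      unfolding ext_norm_def e m by auto
    moreover have "ext_norm (concavification r X) f = top"
      using False by (auto simp: ext_norm_def concavification_def)
    ultimately show ?thesis by (simp add: conc_def)
  qed
qed

lemma solid_associate: "solid (associate X)"
proof -
  have le: "assoc_ennorm X g \<le> assoc_ennorm X f" if "AE x in lebesgue. \<bar>g x\<bar> \<le> \<bar>f x\<bar>" for f g
    unfolding assoc_ennorm_def
    by (intro SUP_subset_mono subset_refl nn_integral_mono_AE eventually_mono[OF that] ennreal_leI)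
       (auto simp: abs_mult intro!: mult_left_mono)
  have "g \<in> elems (associate X) \<and> fnorm (associate X) g \<le> fnorm (associate X) f"
    if "f \<in> elems (associate X)" "g \<in> borel_measurable lebesgue" "AE x in lebesgue. \<bar>g x\<bar> \<le> \<bar>f x\<bar>" for f g
    using that(1,2) le[OF that(3)] by (auto simp: associate_def intro: le_less_trans enn2real_mono)
  then show ?thesis by (auto simp: solid_def ideal_property_def associate_def)
qed

lemma assoc_ennorm_enn2real:
  assumes X: "solid X" and [measurable]: "g \<in> meas" and gfin: "AE x in lebesgue. g x < top"
  shows "assoc_ennorm X (\<lambda>x. enn2real (g x)) = dual_norm (ext_norm X) g"
proof (rule antisym)
  show "assoc_ennorm X (\<lambda>x. enn2real (g x)) \<le> dual_norm (ext_norm X) g"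
    unfolding assoc_ennorm_def
  proof (rule SUP_least)
    fix f assume "f \<in> {f \<in> elems X. fnorm X f \<le> 1}"
    then have f: "f \<in> elems X" "fnorm X f \<le> 1" by auto
    have [measurable]: "f \<in> borel_measurable lebesgue" by (rule solid_measurable[OF X f(1)])
    note a = ext_norm_abs[OF X f(1)]
    have "(\<integral>\<^sup>+x. ennreal \<bar>f x * enn2real (g x)\<bar> \<partial>lebesgue) = (\<integral>\<^sup>+x. ennreal \<bar>f x\<bar> * g x \<partial>lebesgue)"
    proof (intro nn_integral_cong_AE)
      show "AE x in lebesgue. ennreal \<bar>f x * enn2real (g x)\<bar> = ennreal \<bar>f x\<bar> * g x"
        using gfin by eventually_elim (simp add: abs_mult ennreal_mult)
    qed
    also have "\<dots> \<le> dual_norm (ext_norm X) g"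
    proof (rule dual_norm_upper)
      have "fnorm X (\<lambda>x. \<bar>f x\<bar>) \<le> 1" using a(2) f(2) by simp
      then show "ext_norm X (\<lambda>x. ennreal \<bar>f x\<bar>) \<le> 1" unfolding a(1) using ennreal_leI by fastforce
    qed measurable
    finally show "(\<integral>\<^sup>+x. ennreal \<bar>f x * enn2real (g x)\<bar> \<partial>lebesgue) \<le> dual_norm (ext_norm X) g" .
  qed
  show "dual_norm (ext_norm X) g \<le> assoc_ennorm X (\<lambda>x. enn2real (g x))"
  proof (rule dual_norm_least)
    fix f :: "real ^ 'a \<Rightarrow> ennreal" assume [measurable]: "f \<in> meas" and Nf: "ext_norm X f \<le> 1"
    have "ext_norm X f < top" by (rule le_less_trans[OF Nf]) simp
    note f = ext_normD[OF this]
    have "fnorm X (\<lambda>x. enn2real (f x)) \<le> 1" using Nf unfolding f(3) by simp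
    then have "(\<integral>\<^sup>+x. ennreal \<bar>enn2real (f x) * enn2real (g x)\<bar> \<partial>lebesgue) \<le> assoc_ennorm X (\<lambda>x. enn2real (g x))"
      unfolding assoc_ennorm_def using f(2) by (intro SUP_upper2[of "\<lambda>x. enn2real (f x)"]) auto
    moreover have "(\<integral>\<^sup>+x. ennreal \<bar>enn2real (f x) * enn2real (g x)\<bar> \<partial>lebesgue) = (\<integral>\<^sup>+x. f x * g x \<partial>lebesgue)"
    proof (intro nn_integral_cong_AE)
      show "AE x in lebesgue. ennreal \<bar>enn2real (f x) * enn2real (g x)\<bar> = f x * g x"
        using f(1) gfin by eventually_elim (simp add: abs_mult ennreal_mult)
    qed
    ultimately show "(\<integral>\<^sup>+x. f x * g x \<partial>lebesgue) \<le> assoc_ennorm X (\<lambda>x. enn2real (g x))" by simp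
  qed
qed

lemma ext_norm_associate:
  assumes X: "solid X" and fn: "function_norm (ext_norm X)" and sat: "saturated (ext_norm X)" and g [measurable]: "g \<in> meas"
  shows "ext_norm (associate X) g = dual_norm (ext_norm X) g"
proof (cases "AE x in lebesgue. g x < top")
  case True
  have eq: "assoc_ennorm X (\<lambda>x. enn2real (g x)) = dual_norm (ext_norm X) g"
    by (rule assoc_ennorm_enn2real[OF X g True])
  show ?thesis
  proof (cases "dual_norm (ext_norm X) g < top")
    case fin: True
    have "ext_norm (associate X) g = ennreal (fnorm (associate X) (\<lambda>x. enn2real (g x)))"
      using True fin by (intro ext_normI) (auto simp: associate_def eq)
    then show ?thesis using fin by (simp add: associate_def eq)
  next
    case False
    then have "(\<lambda>x. enn2real (g x)) \<notin> elems (associate X)" by (simp add: associate_def eq)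
    then show ?thesis using False by (simp add: ext_norm_def not_less top.extremum_unique)
  qed
next
  case False
  interpret D: function_norm "dual_norm (ext_norm X)" by (rule function_norm.function_norm_dual[OF fn sat])
  have "\<not> dual_norm (ext_norm X) g < top" using D.finite_AE[OF g] False by blast
  then show ?thesis using False by (simp add: ext_norm_def not_less top.extremum_unique)
qed

lemma maximal_bounded_on_associate_iff:
  assumes "solid X" "function_norm (ext_norm X)" "saturated (ext_norm X)"
  shows "maximal_bounded_on (associate X) \<longleftrightarrow> (\<exists>K. max_bounded K (dual_norm (ext_norm X)))"
  unfolding maximal_bounded_on_iff[OF solid_associate] max_bounded_def
  by (simp add: ext_norm_associate[OF assms])

theorem propositionB:
  fixes X :: "'n::finite fspace" and rs :: real
  assumes "1 < rs"
    and "banach_function_space X"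
    and "p_convex rs X"
  shows
    "((maximal_bounded_on X \<and> maximal_bounded_on (associate X)) \<longleftrightarrow>
      (\<exists>r0. 1 < r0 \<and> r0 \<le> rs \<and>
         (\<forall>r. 1 < r \<and> r \<le> r0 \<longrightarrow>
            maximal_bounded_on (concavification r X) \<and>
            maximal_bounded_on (associate (concavification r X))))) \<and>
     ((\<exists>r0. 1 < r0 \<and> r0 \<le> rs \<and>
         (\<forall>r. 1 < r \<and> r \<le> r0 \<longrightarrow>
            maximal_bounded_on (concavification r X) \<and>
            maximal_bounded_on (associate (concavification r X)))) \<longleftrightarrow>
      (\<exists>r. 1 < r \<and> r \<le> rs \<and> maximal_bounded_on (associate (concavification r X))))"
    (is "(?i \<longleftrightarrow> ?ii) \<and> (?ii \<longleftrightarrow> ?iii)")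
proof -
  let ?N = "ext_norm X"
  have sol: "solid X" by (rule solid_banach_function_space[OF assms(2)])
  interpret function_norm ?N by (rule function_norm_ext_norm[OF assms(2)])
  have sat: "saturated ?N" by (rule saturated_ext_norm[OF assms(2)])
  have conv: "norm_convex rs ?N"
    using assms by (intro norm_convex_ext_norm sol) (auto simp: banach_function_space_def normed_fspace_def)
  have fnr: "function_norm (conc r ?N)" if "1 < r" "r \<le> rs" for r
    using that by (intro function_norm_conc[of r rs] conv) auto
  have conc_iff: "maximal_bounded_on (concavification r X) \<longleftrightarrow> (\<exists>K. max_bounded K (conc r ?N))" if "1 < r" for r
    using that by (simp add: maximal_bounded_on_iff solid_concavification ext_norm_concavification sol)
  have assoc_conc_iff: "maximal_bounded_on (associate (concavification r X)) \<longleftrightarrow> (\<exists>K. max_bounded K (dual_norm (conc r ?N)))"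
    if "1 < r" "r \<le> rs" for r
    using that maximal_bounded_on_associate_iff[of "concavification r X"] fnr[OF that] saturated_conc[OF sat, of r]
    by (simp add: solid_concavification ext_norm_concavification sol)
  have i_iff: "?i \<longleftrightarrow> (\<exists>K. max_bounded K ?N) \<and> (\<exists>K. max_bounded K (dual_norm ?N))"
    using maximal_bounded_on_iff[OF sol] maximal_bounded_on_associate_iff[OF sol function_norm_axioms sat] by simp
  have i_ii: ?ii if i: ?i
  proof -
    obtain B B' where B: "max_bounded B ?N" and B': "max_bounded B' (dual_norm ?N)"
      using i unfolding i_iff by blast
    obtain r1 where r1: "1 < r1" "\<And>r. 1 < r \<Longrightarrow> r \<le> r1 \<Longrightarrow> \<exists>K. max_bounded K (conc r ?N)"
      using max_bounded_conc[OF B] by blast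
    obtain r2 where r2: "1 < r2" "\<And>r. 1 < r \<Longrightarrow> r \<le> r2 \<Longrightarrow> function_norm (conc r ?N) \<Longrightarrow> \<exists>K. max_bounded K (dual_norm (conc r ?N))"
      using max_bounded_dual_conc[OF B sat B'] by blast
    show ?thesis
      using r1 r2 assms(1) fnr
      by (intro exI[of _ "min rs (min r1 r2)"]) (auto simp: conc_iff assoc_conc_iff)
  qed
  have ii_iii: ?iii if ?ii using that by blast
  have iii_i: ?i if iii: ?iii
  proof -
    obtain r B where r: "1 < r" "r \<le> rs" and B: "max_bounded B (dual_norm (conc r ?N))"
      using iii by (auto simp: assoc_conc_iff)
    show ?thesis
      unfolding i_iff
      using max_bounded_of_dual_conc[OF r(1) fnr[OF r] sat B] max_bounded_dual_of_dual_conc[OF r(1) fnr[OF r] sat B]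
      by blast
  qed
  show ?thesis using i_ii ii_iii iii_i by blast
qed

end
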